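(* Let $k$ be a field. For all $n\ge1$, $c(k[t],n)=n-1$.
   Context: Let $R=k[t]$, $K=k(t)$, and let $\deg$ be the usual degree on $k[t]$, extended to $K$ by $\deg(f/g)=\deg f-\deg g$ and $\deg0=-\infty$. Fix $q>1$ and put $|x|=q^{\deg x}$; for a nonzero ideal $I$, $|I|=q^{\dim_kR/I}$, extended multiplicatively to nonzero fractional ideals. Here $\mathcal{N}=|K^\times|=q^{\mathbb{Z}}$. An $R$-lattice in $K^n$ is a finitely generated $R$-submodule $\Lambda\subset K^n$ spanning $K^n$ over $K$. For a finite length $R$-module $M\cong\bigoplus_iR/\mathfrak{p}_i^{n_i}$ put $\chi(M)=\prod_i\mathfrak{p}_i^{n_i}$. For a lattice $\Lambda$ choose nonzero $\alpha\in R$ with $\alpha\Lambda\subset R^n$, and put $\chi(\Lambda)=\alpha^{-n}\chi(R^n/\alpha\Lambda)$ (independent of $\alpha$) and $\operatorname{Covol}\Lambda=|\chi(\Lambda)|$. The linear constant $C(R,n)$ is the supremum of all $C\in q^{\mathbb{Z}}$ such that: for all $M=(m_{ij})\in GL_n(K)$, all $R$-lattices $\Lambda\subset K^n$ and all $\epsilon_1,\ldots,\epsilon_n\in q^{\mathbb{Z}}$ with $|\det M|\operatorname{Covol}\Lambda\le C\prod_{i=1}^n\epsilon_i$, there is a nonzero $x=(x_1,\ldots,x_n)\in\Lambda$ with $|\sum_{j=1}^nm_{ij}x_j|\le\epsilon_i$ for all $1\le i\le n$. Put $c(R,n)=\log_qC(R,n)$. *)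

theory Defs
  imports
    "Jordan_Normal_Form.VS_Connect"
    "HOL-Computational_Algebra.Polynomial_Factorial"
    "HOL-Algebra.Ideal_Product"
begin

text \<open>Throughout, \<open>k\<close> is a type of class field, \<open>R = k[t]\<close> is the type of polynomials
  over it, viewed as a ring via \<open>class_ring\<close>, and \<open>K = k(t)\<close> is the type of fractions of
  \<open>R\<close>, in which \<open>R\<close> is embedded by \<open>to_fract\<close>. Vector and matrix entries are indexed from \<open>0\<close>.\<close>

text \<open>The degree on \<open>K\<close> at nonzero elements; the convention \<open>deg 0 = -\<infinity>\<close> appears as
  \<open>fract_abs q 0 = 0\<close>.\<close>

definition fract_degree :: "'k::field poly fract \<Rightarrow> int" where
  "fract_degree x = (THE d. \<exists>f g. f \<noteq> 0 \<and> g \<noteq> 0 \<and> x = Fract f g \<and>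
     d = int (degree f) - int (degree g))"

definition fract_abs :: "real \<Rightarrow> 'k::field poly fract \<Rightarrow> real" where
  "fract_abs q x = (if x = 0 then 0 else q powi fract_degree x)"

definition qpowers :: "real \<Rightarrow> real set" where
  "qpowers q = range (\<lambda>m::int. q powi m)"


subsection \<open>Quotients, direct sums and isomorphisms of modules\<close>

text \<open>\<open>r\<close> times a coset \<open>X\<close> of \<open>N\<close> is the coset \<open>N + r X\<close>; the summand \<open>N\<close> is needed
  since \<open>r X\<close> itself is in general only contained in a coset.\<close>

definition quot_module :: "('a, 'b, 'c) module_scheme \<Rightarrow> 'b set \<Rightarrow> ('a, 'b set) module" where
  "quot_module M N = \<lparr>carrier = a_rcosets\<^bsub>M\<^esub> N, mult = undefined, one = undefined, zero = N,
     add = (\<lambda>X Y. X <+>\<^bsub>M\<^esub> Y), smult = (\<lambda>r X. N <+>\<^bsub>M\<^esub> ((\<lambda>x. r \<odot>\<^bsub>M\<^esub> x) ` X))\<rparr>"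

text \<open>This is the direct product, which is the direct sum since only finite \<open>I\<close> are used.\<close>

definition fin_direct_sum ::
  "'i set \<Rightarrow> ('i \<Rightarrow> ('a, 'b, 'c) module_scheme) \<Rightarrow> ('a, 'i \<Rightarrow> 'b) module" where
  "fin_direct_sum I M = \<lparr>carrier = (\<Pi>\<^sub>E i\<in>I. carrier (M i)), mult = undefined, one = undefined,
     zero = (\<lambda>i\<in>I. \<zero>\<^bsub>M i\<^esub>),
     add = (\<lambda>f g. \<lambda>i\<in>I. f i \<oplus>\<^bsub>M i\<^esub> g i),
     smult = (\<lambda>r f. \<lambda>i\<in>I. r \<odot>\<^bsub>M i\<^esub> f i)\<rparr>"

definition module_isomorphic ::
  "('a, 'r) ring_scheme \<Rightarrow> ('a, 'b, 'c) module_scheme \<Rightarrow> ('a, 'd, 'e) module_scheme \<Rightarrow> bool" where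
  "module_isomorphic R M N \<longleftrightarrow> (\<exists>f \<in> LinearCombinations.module_hom R M N. bij_betw f (carrier M) (carrier N))"


subsection \<open>Ideals and fractional ideals of \<open>k[t]\<close>\<close>

definition poly_module :: "('s \<Rightarrow> 'k::field poly \<Rightarrow> 'k poly) \<Rightarrow> ('s, 'k poly) module" where
  "poly_module sc = \<lparr>carrier = UNIV, mult = (*), one = 1, zero = 0, add = (+), smult = sc\<rparr>"

definition ideal_norm :: "real \<Rightarrow> 'k::field poly set \<Rightarrow> real" where
  "ideal_norm q I = q ^ vectorspace.dim (class_ring :: 'k ring)
     (quot_module (poly_module Polynomial.smult) I)"

text \<open>The multiplicative extension of the norm to fractional ideals \<open>J\<close>: if \<open>a \<noteq> 0\<close> and
  \<open>a J \<subseteq> R\<close>, then \<open>|J| = |a J| / |a R|\<close>, which does not depend on \<open>a\<close>.\<close>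

definition frac_ideal_norm :: "real \<Rightarrow> 'k::field poly fract set \<Rightarrow> real" where
  "frac_ideal_norm q J =
     (let a = (SOME a. a \<noteq> 0 \<and> (\<lambda>x. to_fract a * x) ` J \<subseteq> range to_fract)
      in ideal_norm q {b. \<exists>x\<in>J. to_fract b = to_fract a * x} / ideal_norm q (range (\<lambda>b. a * b)))"

text \<open>The ideal \<open>\<chi>(M)\<close> of a finite length module \<open>M\<close>. It does not depend on the chosen
  decomposition; the primes \<open>P i\<close> are nonzero because \<open>M\<close> has finite length.\<close>

definition chi :: "('k::field poly, 'm, 'c) module_scheme \<Rightarrow> 'k poly set" where
  "chi M = (SOME J. \<exists>(r::nat) P (e :: nat \<Rightarrow> nat).
     (\<forall>i<r. primeideal (P i) (class_ring :: 'k poly ring) \<and> P i \<noteq> {0} \<and> 0 < e i) \<and>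
     module_isomorphic (class_ring :: 'k poly ring) M
       (fin_direct_sum {..<r} (\<lambda>i. quot_module (poly_module (*))
          (P i [^]\<^bsub>ideals_set (class_ring :: 'k poly ring)\<^esub> e i))) \<and>
     J = (\<Otimes>\<^bsub>ideals_set (class_ring :: 'k poly ring)\<^esub> i\<in>{..<r}.
            P i [^]\<^bsub>ideals_set (class_ring :: 'k poly ring)\<^esub> e i))"


subsection \<open>Lattices in \<open>K\<^sup>n\<close>\<close>

definition Kn_module :: "nat \<Rightarrow> ('k::field poly, 'k poly fract vec) module" where
  "Kn_module n = \<lparr>carrier = carrier_vec n, mult = undefined, one = undefined, zero = 0\<^sub>v n,
     add = (+), smult = (\<lambda>p v. to_fract p \<cdot>\<^sub>v v)\<rparr>"

definition std_lattice :: "nat \<Rightarrow> 'k::field poly fract vec set" where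
  "std_lattice n = {v \<in> carrier_vec n. \<forall>i<n. v $ i \<in> range to_fract}"

definition is_lattice :: "nat \<Rightarrow> 'k::field poly fract vec set \<Rightarrow> bool" where
  "is_lattice n \<Lambda> \<longleftrightarrow>
     LinearCombinations.submodule (class_ring :: 'k poly ring) \<Lambda> (Kn_module n) \<and>
     (\<exists>S. finite S \<and> S \<subseteq> \<Lambda> \<and>
        LinearCombinations.module.span (class_ring :: 'k poly ring) (Kn_module n) S = \<Lambda>) \<and>
     LinearCombinations.module.span (class_ring :: 'k poly fract ring)
       (module_vec TYPE('k poly fract) n) \<Lambda> = carrier_vec n"

definition lattice_chi :: "nat \<Rightarrow> 'k::field poly fract vec set \<Rightarrow> 'k poly fract set" where
  "lattice_chi n \<Lambda> =
     (let \<alpha> = (SOME \<alpha>. \<alpha> \<noteq> 0 \<and> (\<lambda>v. to_fract \<alpha> \<cdot>\<^sub>v v) ` \<Lambda> \<subseteq> std_lattice n)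
      in (\<lambda>p. inverse (to_fract \<alpha> ^ n) * to_fract p) `
           chi (quot_module ((Kn_module n)\<lparr>carrier := std_lattice n\<rparr>)
                  ((\<lambda>v. to_fract \<alpha> \<cdot>\<^sub>v v) ` \<Lambda>)))"

definition covol :: "real \<Rightarrow> nat \<Rightarrow> 'k::field poly fract vec set \<Rightarrow> real" where
  "covol q n \<Lambda> = frac_ideal_norm q (lattice_chi n \<Lambda>)"


subsection \<open>The linear constant\<close>

definition admissible_constant :: "'k::field itself \<Rightarrow> real \<Rightarrow> nat \<Rightarrow> real \<Rightarrow> bool" where
  "admissible_constant k q n C \<longleftrightarrow>
     (\<forall>M \<in> carrier_mat n n. \<forall>\<Lambda> :: 'k poly fract vec set. \<forall>\<epsilon> :: nat \<Rightarrow> real.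
        invertible_mat M \<longrightarrow> is_lattice n \<Lambda> \<longrightarrow> (\<forall>i<n. \<epsilon> i \<in> qpowers q) \<longrightarrow>
        fract_abs q (det M) * covol q n \<Lambda> \<le> C * (\<Prod>i<n. \<epsilon> i) \<longrightarrow>
        (\<exists>x\<in>\<Lambda>. x \<noteq> 0\<^sub>v n \<and> (\<forall>i<n. fract_abs q (\<Sum>j<n. M $$ (i, j) * x $ j) \<le> \<epsilon> i)))"

definition linear_constant :: "'k::field itself \<Rightarrow> real \<Rightarrow> nat \<Rightarrow> real" where
  "linear_constant k q n = Sup {C \<in> qpowers q. admissible_constant k q n C}"

definition log_linear_constant :: "'k::field itself \<Rightarrow> real \<Rightarrow> nat \<Rightarrow> real" where
  "log_linear_constant k q n = log q (linear_constant k q n)"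

end

theory Submission
  imports Defs
begin

text \<open>
  Why the constant is \<open>q\<^sup>n\<^sup>-\<^sup>1\<close>. Let \<open>\<Lambda> = B R\<^sup>n\<close> be a lattice. Its covolume is \<open>|det B|\<close>, so the volume
  condition for \<open>C = q\<^sup>n\<^sup>-\<^sup>1\<close> bounds \<open>|det (M B)|\<close> by \<open>q\<^sup>n\<^sup>-\<^sup>1 \<Prod> \<epsilon>\<^sub>i\<close>. Scaling the rows by powers of \<open>t\<close> makes
  all \<open>\<epsilon>\<^sub>i\<close> equal to \<open>1\<close>, and a common denominator \<open>b\<close> leads to a matrix \<open>A\<close> over \<open>R\<close> with
  \<open>deg (det A) \<le> n deg b + n - 1\<close>. The point sought is a nonzero element of \<open>A R\<^sup>n\<close> with entries of degree
  at most \<open>deg b\<close>. Vectors with such entries form a \<open>k\<close>-space of dimension \<open>n (deg b + 1)\<close>, while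
  \<open>R\<^sup>n / A R\<^sup>n\<close> has dimension \<open>deg (det A)\<close>, which is smaller; so one of these vectors other than \<open>0\<close> lies in
  \<open>A R\<^sup>n\<close> (\<open>has_codim_short_vector\<close>, \<open>minkowski_function_field\<close>). No larger constant is possible: for
  \<open>M = 1\<close>, \<open>\<Lambda> = R\<^sup>n\<close> and \<open>\<epsilon>\<^sub>i = 1/q\<close> the volume condition holds once \<open>C \<ge> q\<^sup>n\<close>, but a nonzero polynomial
  has absolute value at least \<open>1\<close> (\<open>admissible_constant_upper_bound\<close>).

  Both halves rest on the formula \<open>covol (B R\<^sup>n) = |det B|\<close> (\<open>covol_lattice_of\<close>) and on the
  existence of a basis \<open>B\<close> (\<open>lattice_has_basis\<close>). They come from a normal form: every submodule \<open>L\<close> of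
  \<open>R\<^sup>n\<close> is described, after a unimodular change of coordinates \<open>U\<close>, by divisibility conditions
  \<open>d\<^sub>i dvd (U v)\<^sub>i\<close> (\<open>submodule_normal_form\<close>). Thus \<open>R\<^sup>n / L\<close> is the direct sum of the \<open>R / (d\<^sub>i)\<close>; if no
  \<open>d\<^sub>i\<close> is zero, it has dimension \<open>\<Sum> deg d\<^sub>i\<close> over \<open>k\<close>, which equals \<open>deg (det A)\<close> for \<open>L = A R\<^sup>n\<close>, and splitting the \<open>d\<^sub>i\<close> into
  prime powers yields a decomposition of the kind that defines \<open>chi\<close>. The ideal \<open>chi\<close> is selected from
  all such decompositions at once, but the dimension of the quotient determines the degree of its
  generator (\<open>chi_of_normal_form\<close>), and the norm depends on nothing else.
\<close>

section \<open>The absolute value on \<open>k(t)\<close>\<close>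

lemma fract_eq_quotient_nonzero:
  fixes x :: "'a::idom fract"
  assumes "x \<noteq> 0"
  obtains f g where "f \<noteq> 0" "g \<noteq> 0" "x = to_fract f / to_fract g"
proof (cases x)
  case (Fract a b)
  moreover from Fract assms have "a \<noteq> 0"
    by (auto simp: Fract_conv_to_fract)
  ultimately show thesis
    using that by (auto simp: Fract_conv_to_fract)
qed

lemma fract_degree_quotient:
  fixes f g :: "'k::field poly"
  assumes "f \<noteq> 0" "g \<noteq> 0"
  shows "fract_degree (to_fract f / to_fract g) = int (degree f) - int (degree g)"
  unfolding fract_degree_def
proof (rule the_equality)
  show "\<exists>f' g'. f' \<noteq> 0 \<and> g' \<noteq> 0 \<and> to_fract f / to_fract g = Fract f' g' \<and>
    int (degree f) - int (degree g) = int (degree f') - int (degree g')"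
    using assms by (auto simp: Fract_conv_to_fract)
next
  fix d
  assume "\<exists>f' g'. f' \<noteq> 0 \<and> g' \<noteq> 0 \<and> to_fract f / to_fract g = Fract f' g' \<and>
    d = int (degree f') - int (degree g')"
  then obtain f' g' where fg: "f' \<noteq> 0" "g' \<noteq> 0" "Fract f g = Fract f' g'"
      "d = int (degree f') - int (degree g')"
    by (auto simp: Fract_conv_to_fract)
  with assms have "f * g' = f' * g" by (simp add: eq_fract)
  then have "degree (f * g') = degree (f' * g)" by simp
  then have "degree f + degree g' = degree f' + degree g"
    using assms fg by (simp add: degree_mult_eq)
  with fg show "d = int (degree f) - int (degree g)" by simp
qed

lemma fract_abs_to_fract:
  "p \<noteq> 0 \<Longrightarrow> fract_abs q (to_fract p) = q ^ degree p"
  using fract_degree_quotient[of p 1] by (simp add: fract_abs_def)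

lemma fract_abs_mult:
  assumes "1 < q"
  shows "fract_abs q (x * y) = fract_abs q x * fract_abs q y"
proof (cases "x = 0 \<or> y = 0")
  case False
  then obtain f g f' g' where *: "f \<noteq> 0" "g \<noteq> 0" "x = to_fract f / to_fract g"
      "f' \<noteq> 0" "g' \<noteq> 0" "y = to_fract f' / to_fract g'"
    using fract_eq_quotient_nonzero[of x] fract_eq_quotient_nonzero[of y] by metis
  have "x * y = to_fract (f * f') / to_fract (g * g')" using * by simp
  then have "fract_degree (x * y) = fract_degree x + fract_degree y"
    using * fract_degree_quotient[of "f * f'" "g * g'"]
    by (simp add: fract_degree_quotient degree_mult_eq)
  with False assms show ?thesis by (simp add: fract_abs_def power_int_add)
qed (auto simp: fract_abs_def)

lemma fract_abs_inverse:
  assumes "1 < q"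
  shows "fract_abs q (inverse x) = inverse (fract_abs q x)"
proof (cases "x = 0")
  case False
  have "fract_abs q (1 :: 'a poly fract) = 1"
    using fract_abs_to_fract[of "1 :: 'a poly" q] by simp
  with False have "fract_abs q x * fract_abs q (inverse x) = 1"
    by (simp flip: fract_abs_mult[OF assms])
  then show ?thesis by (metis inverse_unique)
qed (simp add: fract_abs_def)

lemma fract_abs_power:
  assumes "1 < q"
  shows "fract_abs q (x ^ m) = fract_abs q x ^ m"
  using fract_abs_to_fract[of "1 :: 'a poly" q]
  by (induction m) (simp_all add: fract_abs_mult[OF assms])

lemma fract_abs_prod:
  assumes "1 < q"
  shows "fract_abs q (\<Prod>i\<in>I. f i) = (\<Prod>i\<in>I. fract_abs q (f i))"
  using fract_abs_to_fract[of "1 :: 'a poly" q]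
  by (induction I rule: infinite_finite_induct) (simp_all add: fract_abs_mult[OF assms])

lemma fract_abs_power_int:
  assumes "1 < q"
  shows "fract_abs q (x powi m) = fract_abs q x powi m"
  by (simp add: power_int_def fract_abs_power[OF assms] fract_abs_inverse[OF assms])

section \<open>Homogeneous linear systems\<close>

text \<open>Induction on the number of equations: if some coefficient \<open>a s\<^sub>0 t\<close> of the equation \<open>t\<close> is
  nonzero, the equation is solved for \<open>x s\<^sub>0\<close> and eliminates one unknown from the others.\<close>
lemma underdetermined_system_nontrivial_solution:
  fixes a :: "'s \<Rightarrow> 't \<Rightarrow> 'k::field"
  assumes "finite T" "finite S" "card T < card S"
  shows "\<exists>x. (\<exists>s\<in>S. x s \<noteq> 0) \<and> (\<forall>t\<in>T. (\<Sum>s\<in>S. x s * a s t) = 0)"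
  using assms
proof (induction T arbitrary: S a rule: finite_induct)
  case empty
  then have "S \<noteq> {}" by auto
  then show ?case by (intro exI[of _ "\<lambda>_. 1"]) auto
next
  case (insert t T)
  show ?case
  proof (cases "\<forall>s\<in>S. a s t = 0")
    case True
    from insert have "card T < card S" by simp
    then obtain x where "\<exists>s\<in>S. x s \<noteq> 0" "\<forall>t\<in>T. (\<Sum>s\<in>S. x s * a s t) = 0"
      using insert by blast
    with True show ?thesis by (intro exI[of _ x]) auto
  next
    case False
    then obtain s0 where s0: "s0 \<in> S" "a s0 t \<noteq> 0" by auto
    define S' where "S' = S - {s0}"
    have "finite S'" and S: "S = insert s0 S'" "s0 \<notin> S'"
      using insert s0 by (auto simp: S'_def)
    then have card: "card T < card S'" using insert by auto
    from insert.IH[OF \<open>finite S'\<close> card, of "\<lambda>s u. a s u - a s t / a s0 t * a s0 u"]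
    obtain x where x: "\<exists>s\<in>S'. x s \<noteq> 0"
      "\<And>u. u \<in> T \<Longrightarrow> (\<Sum>s\<in>S'. x s * (a s u - a s t / a s0 t * a s0 u)) = 0" by blast
    define c where "c = - (\<Sum>s\<in>S'. x s * a s t) / a s0 t"
    define y where "y = x(s0 := c)"
    have y: "(\<Sum>s\<in>S. y s * a s u) = c * a s0 u + (\<Sum>s\<in>S'. x s * a s u)" for u
      unfolding S(1) using S(2) \<open>finite S'\<close>
      by (auto simp: y_def intro!: sum.cong)
    have "(\<Sum>s\<in>S. y s * a s t) = 0"
      unfolding y c_def using s0 by simp
    moreover have "(\<Sum>s\<in>S. y s * a s u) = 0" if "u \<in> T" for u
    proof -
      have "(\<Sum>s\<in>S. y s * a s u) = (\<Sum>s\<in>S'. x s * (a s u - a s t / a s0 t * a s0 u))"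
        unfolding y c_def
        by (simp add: algebra_simps sum_subtractf sum_distrib_left sum_divide_distrib)
      with x that show ?thesis by simp
    qed
    moreover have "\<exists>s\<in>S. y s \<noteq> 0" using x(1) S by (auto simp: y_def)
    ultimately show ?thesis by (intro exI[of _ y]) auto
  qed
qed

section \<open>Normal form of submodules of \<open>R\<^sup>n\<close>\<close>

definition vec_submodule :: "nat \<Rightarrow> 'a::comm_ring_1 vec set \<Rightarrow> bool" where
  "vec_submodule n L \<longleftrightarrow> L \<subseteq> carrier_vec n \<and> 0\<^sub>v n \<in> L \<and>
     (\<forall>v\<in>L. \<forall>w\<in>L. v + w \<in> L) \<and> (\<forall>c. \<forall>v\<in>L. c \<cdot>\<^sub>v v \<in> L)"

text \<open>The matrix of the row operation \<open>w \<mapsto> w - w\<^sub>p c\<close>. It is unimodular when \<open>c\<^sub>p = 0\<close>, and such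
  operations are the only ones that the reduction below performs.\<close>
definition transvection :: "nat \<Rightarrow> nat \<Rightarrow> (nat \<Rightarrow> 'a::comm_ring_1) \<Rightarrow> 'a mat" where
  "transvection n p c = mat n n (\<lambda>(i, j). (if i = j then 1 else 0) - (if j = p then c i else 0))"

lemma transvection_carrier [simp]: "transvection n p c \<in> carrier_mat n n"
  by (simp add: transvection_def)

lemma transvection_mult_vec:
  assumes "w \<in> carrier_vec n" "p < n"
  shows "transvection n p c *\<^sub>v w = vec n (\<lambda>i. w $ i - c i * w $ p)"
proof (rule eq_vecI)
  fix i assume "i < dim_vec (vec n (\<lambda>i. w $ i - c i * w $ p))"
  then have i: "i < n" by simp
  have "(transvection n p c *\<^sub>v w) $ i
      = (\<Sum>j = 0..<n. ((if i = j then 1 else 0) - (if j = p then c i else 0)) * w $ j)"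
    using i assms by (simp add: transvection_def scalar_prod_def)
  also have "\<dots> = (\<Sum>j = 0..<n. (if i = j then w $ j else 0) - (if j = p then c i * w $ j else 0))"
    by (intro sum.cong) (auto simp: algebra_simps)
  also have "\<dots> = w $ i - c i * w $ p"
    using i assms by (simp add: sum_subtractf)
  finally show "(transvection n p c *\<^sub>v w) $ i = vec n (\<lambda>i. w $ i - c i * w $ p) $ i"
    using i by simp
qed (simp add: transvection_def)

lemma mat_eq_if_mult_vec_eq:
  fixes A B :: "'a::comm_ring_1 mat"
  assumes "A \<in> carrier_mat m n" "B \<in> carrier_mat m n"
    and "\<And>v. v \<in> carrier_vec n \<Longrightarrow> A *\<^sub>v v = B *\<^sub>v v"
  shows "A = B"
proof (rule eq_matI)
  fix i j assume ij: "i < dim_row B" "j < dim_col B"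
  have "(A *\<^sub>v unit_vec n j) $ i = (B *\<^sub>v unit_vec n j) $ i"
    using assms(3)[of "unit_vec n j"] by simp
  then show "A $$ (i, j) = B $$ (i, j)"
    using assms(1,2) ij by (simp add: scalar_prod_right_unit)
qed (use assms in auto)

lemma transvection_inverse:
  assumes "p < n" "c p = 0"
  shows "transvection n p c * transvection n p (\<lambda>i. - c i) = 1\<^sub>m n"
    and "transvection n p (\<lambda>i. - c i) * transvection n p c = 1\<^sub>m n"
proof -
  have *: "transvection n p c * transvection n p (\<lambda>i. - c i) = 1\<^sub>m n" if "c p = 0" for c :: "nat \<Rightarrow> 'a"
  proof (rule mat_eq_if_mult_vec_eq)
    fix v :: "'a vec" assume v: "v \<in> carrier_vec n"
    have "transvection n p c * transvection n p (\<lambda>i. - c i) *\<^sub>v v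
        = transvection n p c *\<^sub>v (transvection n p (\<lambda>i. - c i) *\<^sub>v v)"
      using v by (intro assoc_mult_mat_vec[of _ n n]) auto
    also have "\<dots> = v"
      using v assms that by (auto simp: transvection_mult_vec)
    finally show "transvection n p c * transvection n p (\<lambda>i. - c i) *\<^sub>v v = 1\<^sub>m n *\<^sub>v v"
      using v by simp
  qed (auto intro!: mult_carrier_mat[of _ n n])
  show "transvection n p c * transvection n p (\<lambda>i. - c i) = 1\<^sub>m n" using *[of c] assms by simp
  show "transvection n p (\<lambda>i. - c i) * transvection n p c = 1\<^sub>m n"
    using *[of "\<lambda>i. - c i"] assms by simp
qed

lemma mult_mat_vec_smult:
  fixes A :: "'a::comm_ring_1 mat"
  assumes "A \<in> carrier_mat m n" "v \<in> carrier_vec n"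
  shows "A *\<^sub>v (c \<cdot>\<^sub>v v) = c \<cdot>\<^sub>v (A *\<^sub>v v)"
  using assms by (intro eq_vecI) auto

lemma mat_mult_regroup:
  assumes "A \<in> carrier_mat n n" "B \<in> carrier_mat n n" "C \<in> carrier_mat n n" "D \<in> carrier_mat n n"
  shows "(A * B) * (C * D) = A * ((B * C) * D)"
proof -
  have "(A * B) * (C * D) = A * (B * (C * D))"
    using assms by (intro assoc_mult_mat[of _ n n _ n _ n]) auto
  also have "B * (C * D) = (B * C) * D"
    using assms by (intro assoc_mult_mat[of _ n n _ n _ n, symmetric]) auto
  finally show ?thesis .
qed

text \<open>\<open>U\<close> is a change of coordinates with inverse \<open>W\<close>. On the coordinates in \<open>I\<close> the submodule \<open>U L\<close>
  is already diagonal: it contains \<open>d\<^sub>i e\<^sub>i\<close>, and the \<open>i\<close>-th coordinate of each of its elements is a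
  multiple of \<open>d\<^sub>i\<close>, so that it splits off the summand \<open>R d\<^sub>i e\<^sub>i\<close>. The set \<open>I\<close> is arbitrary rather than
  an initial segment because then no coordinates ever have to be exchanged.\<close>
definition adapted_on ::
  "nat \<Rightarrow> nat set \<Rightarrow> 'a::comm_ring_1 vec set \<Rightarrow> 'a mat \<Rightarrow> 'a mat \<Rightarrow> (nat \<Rightarrow> 'a) \<Rightarrow> bool" where
  "adapted_on n I L U W d \<longleftrightarrow>
     U \<in> carrier_mat n n \<and> W \<in> carrier_mat n n \<and> U * W = 1\<^sub>m n \<and> W * U = 1\<^sub>m n \<and>
     (\<forall>i\<in>I. (\<forall>v\<in>L. d i dvd (U *\<^sub>v v) $ i) \<and> W *\<^sub>v (d i \<cdot>\<^sub>v unit_vec n i) \<in> L)"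

lemma adapted_on_combination:
  assumes "adapted_on n I L U W d" "vec_submodule n L" "J \<subseteq> I" "finite J"
  shows "W *\<^sub>v vec n (\<lambda>i. if i \<in> J then b i * d i else 0) \<in> L"
  using assms(4,3)
proof (induction J rule: finite_induct)
  case empty
  have "W *\<^sub>v 0\<^sub>v n = 0\<^sub>v n" using assms(1) by (simp add: adapted_on_def mult_mat_vec_def)
     (intro eq_vecI; auto)
  moreover have "vec n (\<lambda>i. if i \<in> {} then b i * d i else 0) = 0\<^sub>v n" by auto
  ultimately show ?case using assms(2) by (simp add: vec_submodule_def)
next
  case (insert j J)
  have W: "W \<in> carrier_mat n n" using assms(1) by (simp add: adapted_on_def)
  let ?x = "vec n (\<lambda>i. if i \<in> J then b i * d i else 0)"
  let ?y = "d j \<cdot>\<^sub>v unit_vec n j"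
  have eq: "vec n (\<lambda>i. if i \<in> insert j J then b i * d i else 0) = ?x + b j \<cdot>\<^sub>v ?y"
    using insert by (intro eq_vecI) (auto simp: unit_vec_def)
  have "W *\<^sub>v (?x + b j \<cdot>\<^sub>v ?y) = W *\<^sub>v ?x + b j \<cdot>\<^sub>v (W *\<^sub>v ?y)"
    using W by (simp add: mult_add_distrib_mat_vec[where nr = n and nc = n]
        mult_mat_vec_smult[where m = n and n = n])
  moreover have "W *\<^sub>v ?x \<in> L" "W *\<^sub>v ?y \<in> L"
    using insert assms(1) by (auto simp: adapted_on_def)
  ultimately show ?case unfolding eq using assms(2) by (simp add: vec_submodule_def)
qed

text \<open>The operation changes only coordinates outside \<open>I\<close> and fixes the vectors \<open>e\<^sub>i\<close> with \<open>i \<in> I\<close>, so what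
  was achieved on \<open>I\<close> survives.\<close>
lemma adapted_on_transvection:
  assumes A: "adapted_on n I L U W d" and L: "L \<subseteq> carrier_vec n"
    and p: "p < n" "p \<notin> I" "I \<subseteq> {..<n}" and c: "c p = 0" "\<And>i. i \<in> I \<Longrightarrow> c i = 0"
  shows "adapted_on n I L (transvection n p c * U) (W * transvection n p (\<lambda>i. - c i)) d"
proof -
  let ?E = "transvection n p c" and ?F = "transvection n p (\<lambda>i. - c i)"
  have U: "U \<in> carrier_mat n n" and W: "W \<in> carrier_mat n n" and UW: "U * W = 1\<^sub>m n" "W * U = 1\<^sub>m n"
    using A by (auto simp: adapted_on_def)
  have "(?E * U) * (W * ?F) = ?E * ((U * W) * ?F)"
    using U W by (intro mat_mult_regroup[of _ n]) auto
  also have "\<dots> = 1\<^sub>m n"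
    using UW transvection_inverse[of p n c] p c by (simp add: left_mult_one_mat[where nr=n and nc=n])
  finally have 1: "(?E * U) * (W * ?F) = 1\<^sub>m n" .
  have "(W * ?F) * (?E * U) = W * ((?F * ?E) * U)"
    using U W by (intro mat_mult_regroup[of _ n]) auto
  also have "\<dots> = 1\<^sub>m n"
    using U UW transvection_inverse[of p n c] p c by (simp add: left_mult_one_mat[where nr=n and nc=n])
  finally have 2: "(W * ?F) * (?E * U) = 1\<^sub>m n" .
  have 3: "d i dvd ((?E * U) *\<^sub>v v) $ i" if "i \<in> I" "v \<in> L" for i v
  proof -
    have v: "v \<in> carrier_vec n" using that L by auto
    have "(?E * U) *\<^sub>v v = ?E *\<^sub>v (U *\<^sub>v v)"
      using v U by (intro assoc_mult_mat_vec[of _ n n]) auto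
    moreover have "i < n" using that p by auto
    ultimately have "((?E * U) *\<^sub>v v) $ i = (U *\<^sub>v v) $ i"
      using that c U v p by (simp add: transvection_mult_vec[of _ n])
    then show ?thesis using A that by (simp add: adapted_on_def)
  qed
  have 4: "(W * ?F) *\<^sub>v (d i \<cdot>\<^sub>v unit_vec n i) \<in> L" if "i \<in> I" for i
  proof -
    have "i \<noteq> p" "i < n" using that p by auto
    have "(W * ?F) *\<^sub>v (d i \<cdot>\<^sub>v unit_vec n i) = W *\<^sub>v (?F *\<^sub>v (d i \<cdot>\<^sub>v unit_vec n i))"
      using W by (intro assoc_mult_mat_vec[of _ n n _ n]) auto
    also have "?F *\<^sub>v (d i \<cdot>\<^sub>v unit_vec n i) = d i \<cdot>\<^sub>v unit_vec n i"
      using \<open>i \<noteq> p\<close> \<open>i < n\<close> p by (subst transvection_mult_vec) (auto simp: unit_vec_def)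
    finally show ?thesis using A that by (simp add: adapted_on_def)
  qed
  show ?thesis unfolding adapted_on_def using U W 1 2 3 4
    by (auto intro!: mult_carrier_mat[of _ n n])
qed

text \<open>Among all adapted coordinate changes, all elements of \<open>L\<close> and all coordinates outside \<open>I\<close>, a
  nonzero coordinate \<open>c\<close> of least degree is chosen, at the place \<open>p\<close> of the vector \<open>v\<close>. Division with
  remainder and minimality show that \<open>c\<close> divides the \<open>p\<close>-th coordinate of every element of \<open>U L\<close>, and
  also every other coordinate of the vector once its coordinates in \<open>I\<close> are cleared. A last
  transvection then turns that vector into \<open>c e\<^sub>p\<close>.\<close>
lemma adapted_on_extend:
  fixes L :: "'k::field poly vec set"
  assumes L: "vec_submodule n L" and A0: "adapted_on n I L U0 W0 d0"
    and I: "I \<subseteq> {..<n}" "card I < n"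
  obtains p U W d where "p < n" "p \<notin> I" "adapted_on n (insert p I) L U W d"
proof (cases "\<exists>U W d v i. adapted_on n I L U W d \<and> v \<in> L \<and> i < n \<and> i \<notin> I \<and> (U *\<^sub>v v) $ i \<noteq> 0")
  case False
  have "\<exists>p<n. p \<notin> I"
  proof (rule ccontr)
    assume "\<not> (\<exists>p<n. p \<notin> I)"
    then have "{..<n} \<subseteq> I" by auto
    then have "card {..<n} \<le> card I" using I by (intro card_mono finite_subset[OF I(1)]) auto
    with I show False by simp
  qed
  then obtain p where p: "p < n" "p \<notin> I" by blast
  have "W0 \<in> carrier_mat n n" using A0 by (simp add: adapted_on_def)
  then have "W0 *\<^sub>v (0 \<cdot>\<^sub>v unit_vec n p) = 0\<^sub>v n"
    by (intro eq_vecI) (auto simp: scalar_prod_def)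
  then have "W0 *\<^sub>v (0 \<cdot>\<^sub>v unit_vec n p) \<in> L" using L by (simp add: vec_submodule_def)
  moreover have "(U0 *\<^sub>v v) $ p = 0" if "v \<in> L" for v using False A0 p that by blast
  ultimately have "adapted_on n (insert p I) L U0 W0 (d0(p := 0))"
    using A0 p by (auto simp: adapted_on_def)
  with p that show thesis by blast
next
  case True
  define bad where "bad m \<longleftrightarrow> (\<exists>U W d v i. adapted_on n I L U W d \<and> v \<in> L \<and> i < n \<and> i \<notin> I \<and>
    (U *\<^sub>v v) $ i \<noteq> 0 \<and> degree ((U *\<^sub>v v) $ i) = m)" for m
  define m where "m = (LEAST m. bad m)"
  have "\<exists>m. bad m" using True unfolding bad_def by blast
  then have "bad m" unfolding m_def by (rule LeastI_ex)
  then obtain U W d v p where A: "adapted_on n I L U W d" and v: "v \<in> L" and p: "p < n" "p \<notin> I"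
    and nz: "(U *\<^sub>v v) $ p \<noteq> 0" and deg: "degree ((U *\<^sub>v v) $ p) = m"
    unfolding bad_def by blast
  have minimal: "(U' *\<^sub>v v') $ i = 0"
    if "adapted_on n I L U' W' d'" "v' \<in> L" "i < n" "i \<notin> I" "degree ((U' *\<^sub>v v') $ i) < m"
    for U' W' d' v' i
    using that not_less_Least[of "degree ((U' *\<^sub>v v') $ i)" bad] unfolding m_def bad_def by blast
  have U: "U \<in> carrier_mat n n" and W: "W \<in> carrier_mat n n" and UW: "U * W = 1\<^sub>m n" "W * U = 1\<^sub>m n"
    using A by (auto simp: adapted_on_def)
  have Lcarr: "L \<subseteq> carrier_vec n" using L by (simp add: vec_submodule_def)
  have Lc: "w \<in> carrier_vec n" if "w \<in> L" for w using L that by (auto simp: vec_submodule_def)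
  have UWv: "U *\<^sub>v (W *\<^sub>v w) = w" "W *\<^sub>v (U *\<^sub>v w) = w" if "w \<in> carrier_vec n" for w
    using that U W UW by (simp_all flip: assoc_mult_mat_vec[where n\<^sub>1=n and n\<^sub>2=n and n\<^sub>3=n])
  have Lsub: "a + (- c) \<cdot>\<^sub>v b \<in> L" if "a \<in> L" "b \<in> L" for a b c
    using L that by (simp add: vec_submodule_def)
  have Usub: "U *\<^sub>v (a + (- c) \<cdot>\<^sub>v b) = U *\<^sub>v a + (- c) \<cdot>\<^sub>v (U *\<^sub>v b)"
    if "a \<in> carrier_vec n" "b \<in> carrier_vec n" for a b c
    using U that by (simp add: mult_add_distrib_mat_vec[where nr = n and nc = n]
        mult_mat_vec_smult[where m = n and n = n])
  have finI: "finite I" using I finite_subset by blast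
  (* subtracting an element of L that lies in the part already split off clears the coordinates in I *)
  define b where "b i = (U *\<^sub>v v) $ i div d i" for i
  define x where "x = vec n (\<lambda>i. if i \<in> I then b i * d i else 0)"
  define v1 where "v1 = v + (- 1) \<cdot>\<^sub>v (W *\<^sub>v x)"
  have "W *\<^sub>v x \<in> L" unfolding x_def using adapted_on_combination[OF A L] finI by blast
  then have v1: "v1 \<in> L" unfolding v1_def using v Lsub by blast
  have "U *\<^sub>v v1 = U *\<^sub>v v + (- 1) \<cdot>\<^sub>v x"
    unfolding v1_def using Usub Lc[OF v] Lc[OF \<open>W *\<^sub>v x \<in> L\<close>] UWv[of x] by (simp add: x_def)
  then have Uv1: "(U *\<^sub>v v1) $ i = (if i \<in> I then 0 else (U *\<^sub>v v) $ i)" if "i < n" for i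
    using that A v U by (auto simp: x_def b_def adapted_on_def)
  define c where "c = (U *\<^sub>v v1) $ p"
  (* the p-th coordinate has not changed, so c still has the least degree *)
  have c: "c \<noteq> 0" "degree c = m" using Uv1 p nz deg by (auto simp: c_def)
  have dvd_p: "c dvd (U *\<^sub>v w) $ p" if w: "w \<in> L" for w
  proof -
    define r where "r = (U *\<^sub>v w) $ p mod c"
    define w' where "w' = w + (- ((U *\<^sub>v w) $ p div c)) \<cdot>\<^sub>v v1"
    have "w' \<in> L" unfolding w'_def using w v1 Lsub by blast
    moreover have r: "(U *\<^sub>v w') $ p = r"
      unfolding w'_def Usub[OF Lc[OF w] Lc[OF v1]] r_def using U p
      by (simp add: minus_div_mult_eq_mod flip: c_def)
    moreover have "degree r < m \<or> r = 0"
      using degree_mod_less[OF c(1), of "(U *\<^sub>v w) $ p"] c by (auto simp: r_def)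
    ultimately have "r = 0" using minimal[OF A \<open>w' \<in> L\<close> p] by auto
    then show ?thesis by (simp add: r_def mod_eq_0_iff_dvd)
  qed
  have dvd_i: "c dvd (U *\<^sub>v v1) $ i" if i: "i < n" for i
  proof (cases "i \<in> I \<or> i = p")
    case True
    then show ?thesis using Uv1 i c_def by auto
  next
    case False
    (* if the division left a remainder, this operation would produce a coordinate of smaller degree *)
    define q where "q j = (if j = i then (U *\<^sub>v v1) $ i div c else 0)" for j
    have A': "adapted_on n I L (transvection n p q * U) (W * transvection n p (\<lambda>i. - q i)) d"
      using False by (intro adapted_on_transvection[OF A Lcarr p I(1)]) (auto simp: q_def)
    define r where "r = (U *\<^sub>v v1) $ i mod c"
    have "((transvection n p q * U) *\<^sub>v v1) $ i = r"
      using U Lc[OF v1] p i by (simp add: assoc_mult_mat_vec[where n\<^sub>1=n and n\<^sub>2=n and n\<^sub>3=n]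
          transvection_mult_vec q_def r_def minus_div_mult_eq_mod flip: c_def)
    moreover have "degree r < m \<or> r = 0"
      using degree_mod_less[OF c(1), of "(U *\<^sub>v v1) $ i"] c by (auto simp: r_def)
    ultimately have "r = 0" using minimal[OF A' v1 i] False by auto
    then show ?thesis by (simp add: r_def mod_eq_0_iff_dvd)
  qed
  (* this operation turns the coordinates of v1 into c times the p-th unit vector *)
  define q where "q i = (if i = p then 0 else (U *\<^sub>v v1) $ i div c)" for i
  define U' where "U' = transvection n p q * U"
  define W' where "W' = W * transvection n p (\<lambda>i. - q i)"
  have A': "adapted_on n I L U' W' d" unfolding U'_def W'_def
    using Uv1 I by (intro adapted_on_transvection[OF A Lcarr p I(1)]) (auto simp: q_def)
  have U'w: "U' *\<^sub>v w = vec n (\<lambda>i. (U *\<^sub>v w) $ i - q i * (U *\<^sub>v w) $ p)" if "w \<in> L" for w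
    unfolding U'_def using U Lc[OF that] p
    by (simp add: assoc_mult_mat_vec[where n\<^sub>1=n and n\<^sub>2=n and n\<^sub>3=n] transvection_mult_vec)
  have "U' *\<^sub>v v1 = c \<cdot>\<^sub>v unit_vec n p"
    unfolding U'w[OF v1] using dvd_i p by (intro eq_vecI) (auto simp: q_def c_def unit_vec_def)
  moreover have "W' *\<^sub>v (U' *\<^sub>v v1) = v1"
    using A' Lc[OF v1] by (simp add: adapted_on_def flip: assoc_mult_mat_vec[where n\<^sub>1=n and n\<^sub>2=n and n\<^sub>3=n])
  ultimately have "W' *\<^sub>v (c \<cdot>\<^sub>v unit_vec n p) \<in> L" using v1 by simp
  moreover have "c dvd (U' *\<^sub>v w) $ p" if "w \<in> L" for w
    using dvd_p[OF that] U'w[OF that] p by (simp add: q_def)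
  ultimately have "adapted_on n (insert p I) L U' W' (d(p := c))"
    using A' p by (auto simp: adapted_on_def)
  with p show thesis by (rule that)
qed

text \<open>The stacked bases theorem for the Euclidean ring \<open>k[t]\<close>: the columns of \<open>W\<close> form a basis of \<open>R\<^sup>n\<close>
  whose multiples by the \<open>d\<^sub>i\<close> generate \<open>L\<close>. A defect of rank appears as \<open>d\<^sub>i = 0\<close>.\<close>
theorem submodule_normal_form:
  fixes L :: "'k::field poly vec set"
  assumes L: "vec_submodule n L"
  obtains U W d where "U \<in> carrier_mat n n" "W \<in> carrier_mat n n" "U * W = 1\<^sub>m n" "W * U = 1\<^sub>m n"
    "\<And>v. v \<in> carrier_vec n \<Longrightarrow> v \<in> L \<longleftrightarrow> (\<forall>i<n. d i dvd (U *\<^sub>v v) $ i)"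
proof -
  have "\<exists>I U W d. I \<subseteq> {..<n} \<and> card I = m \<and> adapted_on n I L U W d" if "m \<le> n" for m
    using that
  proof (induction m)
    case 0
    have "adapted_on n {} L (1\<^sub>m n) (1\<^sub>m n) (\<lambda>_. 0)" by (simp add: adapted_on_def)
    then show ?case by (metis card.empty empty_subsetI)
  next
    case (Suc m)
    then obtain I U W d where I: "I \<subseteq> {..<n}" "card I = m" "adapted_on n I L U W d" by auto
    with Suc.prems adapted_on_extend[OF L I(3) I(1)] obtain p U W d
      where "p < n" "p \<notin> I" "adapted_on n (insert p I) L U W d"
      by (metis Suc_le_lessD)
    moreover have "finite I" using I finite_subset by blast
    ultimately show ?case using I by (intro exI[of _ "insert p I"]) auto
  qed
  from this[of n] obtain I U W d where I: "I \<subseteq> {..<n}" "card I = n" and A': "adapted_on n I L U W d"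
    by blast
  from I have "I = {..<n}" by (intro card_subset_eq) auto
  with A' have A: "adapted_on n {..<n} L U W d" by simp
  have UW: "U \<in> carrier_mat n n" "W \<in> carrier_mat n n" "U * W = 1\<^sub>m n" "W * U = 1\<^sub>m n"
    using A by (auto simp: adapted_on_def)
  have "v \<in> L \<longleftrightarrow> (\<forall>i<n. d i dvd (U *\<^sub>v v) $ i)" if v: "v \<in> carrier_vec n" for v
  proof
    assume "v \<in> L"
    then show "\<forall>i<n. d i dvd (U *\<^sub>v v) $ i" using A by (auto simp: adapted_on_def)
  next
    assume dvd: "\<forall>i<n. d i dvd (U *\<^sub>v v) $ i"
    define x where "x = vec n (\<lambda>i. if i \<in> {..<n} then ((U *\<^sub>v v) $ i div d i) * d i else 0)"
    have "W *\<^sub>v x \<in> L" unfolding x_def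
      by (rule adapted_on_combination[OF A L]) auto
    moreover have "x = U *\<^sub>v v" using dvd UW by (intro eq_vecI) (auto simp: x_def)
    moreover have "W *\<^sub>v (U *\<^sub>v v) = v"
      using UW v by (simp flip: assoc_mult_mat_vec[where n\<^sub>1=n and n\<^sub>2=n and n\<^sub>3=n])
    ultimately show "v \<in> L" by simp
  qed
  with UW that show thesis by blast
qed

section \<open>Codimension over \<open>k\<close>\<close>

text \<open>The functionals \<open>\<phi> s\<close> are linear over \<open>k\<close>, vanish simultaneously exactly on \<open>L\<close>, and possess a dual
  family of vectors; they are coordinates on the \<open>k\<close>-space \<open>R\<^sup>n / L\<close>.\<close>
definition quotient_coordinates ::
  "nat \<Rightarrow> 'k::field poly vec set \<Rightarrow> 's set \<Rightarrow> ('s \<Rightarrow> 'k poly vec \<Rightarrow> 'k) \<Rightarrow> bool" where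
  "quotient_coordinates n L S \<phi> \<longleftrightarrow> finite S \<and>
     (\<forall>s\<in>S. \<forall>v\<in>carrier_vec n. \<forall>w\<in>carrier_vec n. \<phi> s (v + w) = \<phi> s v + \<phi> s w) \<and>
     (\<forall>s\<in>S. \<forall>c. \<forall>v\<in>carrier_vec n. \<phi> s ([:c:] \<cdot>\<^sub>v v) = c * \<phi> s v) \<and>
     (\<forall>v\<in>carrier_vec n. v \<in> L \<longleftrightarrow> (\<forall>s\<in>S. \<phi> s v = 0)) \<and>
     (\<forall>s\<in>S. \<exists>w\<in>carrier_vec n. \<forall>t\<in>S. \<phi> t w = (if t = s then 1 else 0))"

text \<open>The index type is fixed because a definition cannot quantify over types; pairs of numbers suit the
  bases that occur, where a coefficient is indexed by its component and its degree.\<close>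
definition has_codim :: "nat \<Rightarrow> 'k::field poly vec set \<Rightarrow> nat \<Rightarrow> bool" where
  "has_codim n L N \<longleftrightarrow>
     (\<exists>(S :: (nat \<times> nat) set) \<phi>. quotient_coordinates n L S \<phi> \<and> card S = N)"

lemma quotient_coordinatesD:
  assumes "quotient_coordinates n L S \<phi>"
  shows "finite S"
    and "\<And>s v w. s \<in> S \<Longrightarrow> v \<in> carrier_vec n \<Longrightarrow> w \<in> carrier_vec n \<Longrightarrow> \<phi> s (v + w) = \<phi> s v + \<phi> s w"
    and "\<And>s c v. s \<in> S \<Longrightarrow> v \<in> carrier_vec n \<Longrightarrow> \<phi> s ([:c:] \<cdot>\<^sub>v v) = c * \<phi> s v"
    and "\<And>v. v \<in> carrier_vec n \<Longrightarrow> v \<in> L \<longleftrightarrow> (\<forall>s\<in>S. \<phi> s v = 0)"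
    and "\<And>s. s \<in> S \<Longrightarrow> \<exists>w\<in>carrier_vec n. \<forall>t\<in>S. \<phi> t w = (if t = s then 1 else 0)"
  using assms unfolding quotient_coordinates_def by simp_all

text \<open>The linear combination \<open>\<Sum> x\<^sub>s w\<^sub>s\<close> with coefficients in \<open>k\<close>, written out by entries since
  the vectors of all lengths together form no additive group.\<close>
definition vec_comb :: "nat \<Rightarrow> 's set \<Rightarrow> ('s \<Rightarrow> 'k::field) \<Rightarrow> ('s \<Rightarrow> 'k poly vec) \<Rightarrow> 'k poly vec" where
  "vec_comb n S x w = vec n (\<lambda>i. \<Sum>s\<in>S. [:x s:] * w s $ i)"

lemma functional_vec_comb:
  fixes \<phi> :: "'k::field poly vec \<Rightarrow> 'k"
  assumes add: "\<And>v w. v \<in> carrier_vec n \<Longrightarrow> w \<in> carrier_vec n \<Longrightarrow> \<phi> (v + w) = \<phi> v + \<phi> w"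
    and smult: "\<And>c v. v \<in> carrier_vec n \<Longrightarrow> \<phi> ([:c:] \<cdot>\<^sub>v v) = c * \<phi> v"
    and "finite S" and w: "\<And>s. s \<in> S \<Longrightarrow> w s \<in> carrier_vec n"
  shows "\<phi> (vec_comb n S x w) = (\<Sum>s\<in>S. x s * \<phi> (w s))"
  using \<open>finite S\<close> w
proof (induction S rule: finite_induct)
  case empty
  have "[:0:] \<cdot>\<^sub>v 0\<^sub>v n = (0\<^sub>v n :: 'k poly vec)" by (intro eq_vecI) auto
  then have "\<phi> (0\<^sub>v n) = 0" using smult[of "0\<^sub>v n" 0] by simp
  then show ?case by (simp add: vec_comb_def zero_vec_def)
next
  case (insert s S)
  have "vec_comb n (insert s S) x w = [:x s:] \<cdot>\<^sub>v w s + vec_comb n S x w"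
    using insert.hyps insert.prems[of s] by (intro eq_vecI) (auto simp: vec_comb_def)
  then show ?case
    using insert add[of "[:x s:] \<cdot>\<^sub>v w s" "vec_comb n S x w"]
    by (simp add: smult) (simp add: vec_comb_def)
qed

text \<open>More vectors than the codimension are linearly dependent modulo \<open>L\<close>: their images in the
  coordinates of \<open>R\<^sup>n / L\<close> give a system with fewer equations than unknowns.\<close>
lemma has_codim_dependent_mod:
  fixes L :: "'k::field poly vec set"
  assumes "has_codim n L N" "finite T" "N < card T" "\<And>t. t \<in> T \<Longrightarrow> w t \<in> carrier_vec n"
  obtains x where "\<exists>t\<in>T. x t \<noteq> 0" "vec_comb n T x w \<in> L"
proof -
  obtain S :: "(nat \<times> nat) set" and \<phi> where coords: "quotient_coordinates n L S \<phi>" and S: "card S = N"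
    using assms(1) unfolding has_codim_def by blast
  note fin = quotient_coordinatesD(1)[OF coords] and add = quotient_coordinatesD(2)[OF coords]
    and smult = quotient_coordinatesD(3)[OF coords] and ker = quotient_coordinatesD(4)[OF coords]
  obtain x where x: "\<exists>t\<in>T. x t \<noteq> 0" "\<forall>s\<in>S. (\<Sum>t\<in>T. x t * \<phi> s (w t)) = 0"
    using underdetermined_system_nontrivial_solution[of S T "\<lambda>t s. \<phi> s (w t)"] fin S assms by blast
  have "\<phi> s (vec_comb n T x w) = 0" if "s \<in> S" for s
    using functional_vec_comb[of n "\<phi> s" T w x] add[OF that] smult[OF that] assms x(2) that
    by simp
  then have "vec_comb n T x w \<in> L" using ker[of "vec_comb n T x w"] by (simp add: vec_comb_def)
  with x that show thesis by blast
qed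

text \<open>Otherwise the vectors dual to the \<open>N'\<close> functionals would be dependent modulo \<open>L\<close>, whereas these
  functionals read off the coefficients of any linear combination of them.\<close>
lemma has_codim_le:
  fixes L :: "'k::field poly vec set"
  assumes "has_codim n L N" "has_codim n L N'"
  shows "N' \<le> N"
proof (rule ccontr)
  assume "\<not> N' \<le> N"
  obtain T :: "(nat \<times> nat) set" and \<psi> where coords: "quotient_coordinates n L T \<psi>" and T: "card T = N'"
    using assms(2) unfolding has_codim_def by blast
  note fin = quotient_coordinatesD(1)[OF coords] and add = quotient_coordinatesD(2)[OF coords]
    and smult = quotient_coordinatesD(3)[OF coords] and ker = quotient_coordinatesD(4)[OF coords]
  from quotient_coordinatesD(5)[OF coords] obtain w where w: "\<And>s. s \<in> T \<Longrightarrow> w s \<in> carrier_vec n"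
    "\<And>s t. s \<in> T \<Longrightarrow> t \<in> T \<Longrightarrow> \<psi> t (w s) = (if t = s then 1 else 0)" by metis
  have wc: "\<And>t. t \<in> T \<Longrightarrow> w t \<in> carrier_vec n" by (fact w(1))
  obtain x where x: "\<exists>t\<in>T. x t \<noteq> 0" "vec_comb n T x w \<in> L"
    by (rule has_codim_dependent_mod[OF assms(1) fin _ wc]) (use T \<open>\<not> N' \<le> N\<close> in auto)
  have "x t = 0" if t: "t \<in> T" for t
  proof -
    have "0 = \<psi> t (vec_comb n T x w)"
      using ker[of "vec_comb n T x w"] x t by (simp add: vec_comb_def)
    also have "\<dots> = (\<Sum>s\<in>T. x s * \<psi> t (w s))"
      using add[OF t] smult[OF t] fin wc by (intro functional_vec_comb)
    also have "\<dots> = (\<Sum>s\<in>T. if s = t then x s else 0)" using w t by (intro sum.cong) auto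
    also have "\<dots> = x t" using t fin by simp
    finally show ?thesis by simp
  qed
  with x show False by blast
qed

lemma has_codim_unique:
  "has_codim n L N \<Longrightarrow> has_codim n L N' \<Longrightarrow> N = N'"
  by (simp add: has_codim_le antisym)

text \<open>The pigeonhole principle that takes the place of Minkowski's convex body theorem: the vectors all of
  whose entries have degree below \<open>m\<close> form a \<open>k\<close>-space of dimension \<open>n m\<close>, which cannot inject into
  a quotient of smaller dimension.\<close>
lemma has_codim_short_vector:
  fixes L :: "'k::field poly vec set"
  assumes "has_codim n L N" "N < n * m"
  obtains v where "v \<in> L" "v \<in> carrier_vec n" "v \<noteq> 0\<^sub>v n" "\<And>i. i < n \<Longrightarrow> v $ i = 0 \<or> degree (v $ i) < m"
proof -
  define T where "T = {..<n} \<times> {..<m}"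
  define w :: "nat \<times> nat \<Rightarrow> 'k poly vec" where "w = (\<lambda>(i, j). monom 1 j \<cdot>\<^sub>v unit_vec n i)"
  obtain x where x: "\<exists>t\<in>T. x t \<noteq> 0" "vec_comb n T x w \<in> L"
    by (rule has_codim_dependent_mod[OF assms(1), of T w]) (use assms(2) in \<open>auto simp: T_def w_def\<close>)
  let ?v = "vec_comb n T x w"
  have v: "?v $ i = (\<Sum>j<m. monom (x (i, j)) j)" if "i < n" for i
  proof -
    have "?v $ i = (\<Sum>l<n. \<Sum>j<m. [:x (l, j):] * (w (l, j) $ i))"
      using that by (simp add: vec_comb_def T_def sum.cartesian_product case_prod_unfold)
    also have "\<dots> = (\<Sum>l<n. if l = i then (\<Sum>j<m. monom (x (l, j)) j) else 0)"
      using that by (intro sum.cong) (auto simp: w_def unit_vec_def smult_monom)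
    finally show ?thesis using that by simp
  qed
  have coeff: "coeff (?v $ i) j = (if j < m then x (i, j) else 0)" if "i < n" for i j
    using that by (simp add: v coeff_sum)
  have "?v \<noteq> 0\<^sub>v n"
  proof
    assume "?v = 0\<^sub>v n"
    then have "x (i, j) = 0" if "i < n" "j < m" for i j using coeff[of i j] that by simp
    with x show False by (auto simp: T_def)
  qed
  moreover have "?v $ i = 0 \<or> degree (?v $ i) < m" if "i < n" for i
  proof (cases "m = 0")
    case False
    then have "degree (?v $ i) \<le> m - 1" using coeff[OF that] by (intro degree_le) auto
    with False show ?thesis by linarith
  qed (use coeff[OF that] in \<open>auto intro: poly_eqI\<close>)
  moreover have "?v \<in> carrier_vec n" by (simp add: vec_comb_def)
  ultimately show thesis using that x by blast
qed

text \<open>The maps \<open>g\<^sub>j\<close> represent an \<open>R\<close>-linear surjection of \<open>R\<^sup>n\<close> onto the direct sum of the \<open>R / (a\<^sub>j)\<close>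
  with kernel \<open>L\<close>. They are required to be linear only modulo \<open>a\<^sub>j\<close>, so that arbitrary
  representatives of residue classes are allowed.\<close>
definition residue_system ::
  "nat \<Rightarrow> 'k::field poly vec set \<Rightarrow> nat \<Rightarrow> (nat \<Rightarrow> 'k poly) \<Rightarrow> (nat \<Rightarrow> 'k poly vec \<Rightarrow> 'k poly) \<Rightarrow> bool" where
  "residue_system n L r a g \<longleftrightarrow>
     (\<forall>j<r. \<forall>v\<in>carrier_vec n. \<forall>w\<in>carrier_vec n. a j dvd g j (v + w) - (g j v + g j w)) \<and>
     (\<forall>j<r. \<forall>c. \<forall>v\<in>carrier_vec n. a j dvd g j (c \<cdot>\<^sub>v v) - c * g j v) \<and>
     (\<forall>b. \<exists>v\<in>carrier_vec n. \<forall>j<r. a j dvd g j v - b j) \<and>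
     (\<forall>v\<in>carrier_vec n. v \<in> L \<longleftrightarrow> (\<forall>j<r. a j dvd g j v))"

text \<open>The coefficients of the remainders modulo \<open>a\<^sub>j\<close> are coordinates on the direct sum of the
  \<open>R / (a\<^sub>j)\<close>, of dimension \<open>deg a\<^sub>j\<close> each.\<close>
lemma has_codim_residues:
  fixes g :: "nat \<Rightarrow> 'k::field poly vec \<Rightarrow> 'k poly"
  assumes a: "\<And>j. j < r \<Longrightarrow> a j \<noteq> 0" and "residue_system n L r a g"
  shows "has_codim n L (\<Sum>j<r. degree (a j))"
proof -
  have add: "\<And>j v w. j < r \<Longrightarrow> v \<in> carrier_vec n \<Longrightarrow> w \<in> carrier_vec n \<Longrightarrow>
      a j dvd g j (v + w) - (g j v + g j w)"
    and smult: "\<And>j c v. j < r \<Longrightarrow> v \<in> carrier_vec n \<Longrightarrow> a j dvd g j (c \<cdot>\<^sub>v v) - c * g j v"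
    and surj: "\<And>b. \<exists>v\<in>carrier_vec n. \<forall>j<r. a j dvd g j v - b j"
    and ker: "\<And>v. v \<in> carrier_vec n \<Longrightarrow> v \<in> L \<longleftrightarrow> (\<forall>j<r. a j dvd g j v)"
    using assms(2) by (simp_all add: residue_system_def)
  define S where "S = (SIGMA j:{..<r}. {..<degree (a j)})"
  define \<phi> where "\<phi> = (\<lambda>(j, l) v. coeff (g j v mod a j) l)"
  have 1: "finite S" "card S = (\<Sum>j<r. degree (a j))" by (simp_all add: S_def)
  have 2: "\<phi> s (v + w) = \<phi> s v + \<phi> s w"
    if sS: "s \<in> S" and that: "v \<in> carrier_vec n" "w \<in> carrier_vec n" for s v w
  proof -
    obtain j l where s: "s = (j, l)" "j < r" using sS by (auto simp: S_def)
    have "g j (v + w) mod a j = (g j v + g j w) mod a j"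
      using add[OF s(2) that] by (simp add: mod_eq_dvd_iff)
    then show ?thesis by (simp add: \<phi>_def s poly_mod_add_left)
  qed
  have 3: "\<phi> s ([:c:] \<cdot>\<^sub>v v) = c * \<phi> s v" if sS: "s \<in> S" and v: "v \<in> carrier_vec n" for s c v
  proof -
    obtain j l where s: "s = (j, l)" "j < r" using sS by (auto simp: S_def)
    have "g j ([:c:] \<cdot>\<^sub>v v) mod a j = (Polynomial.smult c (g j v)) mod a j"
      using smult[OF s(2) v, of "[:c:]"] by (simp add: mod_eq_dvd_iff)
    then show ?thesis by (simp add: \<phi>_def s mod_smult_left)
  qed
  have 4: "v \<in> L \<longleftrightarrow> (\<forall>s\<in>S. \<phi> s v = 0)" if v: "v \<in> carrier_vec n" for v
  proof -
    have "a j dvd g j v \<longleftrightarrow> (\<forall>l<degree (a j). coeff (g j v mod a j) l = 0)" if "j < r" for j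
    proof
      assume "\<forall>l<degree (a j). coeff (g j v mod a j) l = 0"
      moreover have "coeff (g j v mod a j) l = 0" if "l \<ge> degree (a j)" for l
        using degree_mod_less[OF a[OF \<open>j < r\<close>], of "g j v"] that by (auto simp: coeff_eq_0)
      ultimately have "g j v mod a j = 0" by (intro poly_eqI) (metis coeff_0 not_less)
      then show "a j dvd g j v" by (simp add: mod_eq_0_iff_dvd)
    qed (simp add: dvd_eq_mod_eq_0)
    then show ?thesis using ker[OF v] by (auto simp: S_def \<phi>_def)
  qed
  have 5: "\<exists>w\<in>carrier_vec n. \<forall>t\<in>S. \<phi> t w = (if t = s then 1 else 0)" if sS: "s \<in> S" for s
  proof -
    obtain j l where s: "s = (j, l)" "j < r" "l < degree (a j)" using sS by (auto simp: S_def)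
    obtain w where w: "w \<in> carrier_vec n" "\<And>i. i < r \<Longrightarrow> a i dvd g i w - (if i = j then monom 1 l else 0)"
      using surj[of "\<lambda>i. if i = j then monom 1 l else 0"] by auto
    have "\<phi> (i, m) w = (if (i, m) = s then 1 else 0)" if "i < r" "m < degree (a i)" for i m
    proof (cases "i = j")
      case True
      then have "g i w mod a i = monom 1 l mod a i" using w(2)[OF that(1)] by (simp add: mod_eq_dvd_iff)
      also have "\<dots> = monom 1 l" using s True by (intro mod_poly_less) (simp add: degree_monom_eq)
      finally show ?thesis using True s by (simp add: \<phi>_def)
    next
      case False
      then have "g i w mod a i = 0" using w(2)[OF that(1)] by (simp add: mod_eq_0_iff_dvd)
      then show ?thesis using False s by (simp add: \<phi>_def)
    qed
    with w(1) show ?thesis by (force simp: S_def)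
  qed
  have "quotient_coordinates n L S \<phi>"
    unfolding quotient_coordinates_def using 1(1) 2 3 4 5 by simp
  with 1 show ?thesis unfolding has_codim_def by blast
qed

lemma vec_submodule_range:
  assumes "A \<in> carrier_mat n n"
  shows "vec_submodule n {A *\<^sub>v y | y. y \<in> carrier_vec n}"
  unfolding vec_submodule_def
proof (intro conjI ballI allI)
  show "{A *\<^sub>v y |y. y \<in> carrier_vec n} \<subseteq> carrier_vec n" using assms by auto
  show "0\<^sub>v n \<in> {A *\<^sub>v y |y. y \<in> carrier_vec n}"
    using assms by (intro CollectI exI[of _ "0\<^sub>v n"]) (auto intro!: eq_vecI simp: scalar_prod_def)
next
  fix v w assume "v \<in> {A *\<^sub>v y |y. y \<in> carrier_vec n}" "w \<in> {A *\<^sub>v y |y. y \<in> carrier_vec n}"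
  then obtain y z where "v = A *\<^sub>v y" "w = A *\<^sub>v z" "y \<in> carrier_vec n" "z \<in> carrier_vec n" by auto
  then show "v + w \<in> {A *\<^sub>v y |y. y \<in> carrier_vec n}"
    using assms by (intro CollectI exI[of _ "y + z"]) (simp add: mult_add_distrib_mat_vec[of _ n n])
next
  fix c v assume "v \<in> {A *\<^sub>v y |y. y \<in> carrier_vec n}"
  then obtain y where "v = A *\<^sub>v y" "y \<in> carrier_vec n" by auto
  then show "c \<cdot>\<^sub>v v \<in> {A *\<^sub>v y |y. y \<in> carrier_vec n}"
    using assms by (intro CollectI exI[of _ "c \<cdot>\<^sub>v y"]) (simp add: mult_mat_vec_smult[of _ n n])
qed

lemma mult_unit_vec:
  fixes A :: "'a::comm_ring_1 mat"
  assumes "A \<in> carrier_mat m n" "j < n"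
  shows "A *\<^sub>v unit_vec n j = col A j"
  using assms by (intro eq_vecI) (auto simp: scalar_prod_right_unit)

lemma det_diagonal:
  "det (mat n n (\<lambda>(i, j). if i = j then d i else (0::'a::comm_ring_1))) = (\<Prod>i<n. d i)"
proof -
  let ?D = "mat n n (\<lambda>(i, j). if i = j then d i else 0)"
  have "det ?D = prod_list (diag_mat ?D)"
    by (intro det_upper_triangular[of _ n]) auto
  also have "diag_mat ?D = map d [0..<n]" by (auto simp: diag_mat_def)
  also have "prod_list (map d [0..<n]) = (\<Prod>i\<in>set [0..<n]. d i)"
    by (intro prod.distinct_set_conv_list[symmetric]) simp
  also have "set [0..<n] = {..<n}" by auto
  finally show ?thesis .
qed

lemma mult_vec_diagonal:
  fixes w :: "'a::comm_ring_1 vec"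
  assumes "w \<in> carrier_vec n"
  shows "mat n n (\<lambda>(i, j). if i = j then d i else 0) *\<^sub>v w = vec n (\<lambda>i. d i * w $ i)"
proof (rule eq_vecI)
  fix i assume "i < dim_vec (vec n (\<lambda>i. d i * w $ i))"
  moreover have "(\<Sum>j = 0..<n. (if i = j then d i else 0) * w $ j)
      = (\<Sum>j = 0..<n. if i = j then d i * w $ j else 0)" by (intro sum.cong) auto
  ultimately show "(mat n n (\<lambda>(i, j). if i = j then d i else 0) *\<^sub>v w) $ i = vec n (\<lambda>i. d i * w $ i) $ i"
    using assms by (auto simp: scalar_prod_def)
qed auto

text \<open>The diagonal matrix \<open>D\<close> of the \<open>d\<^sub>i\<close> satisfies \<open>U A = D V\<close> and \<open>W D = A V'\<close> for some matrices \<open>V\<close> and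
  \<open>V'\<close> over \<open>R\<close>, because \<open>A\<close> and \<open>W D\<close> generate the same submodule. Hence \<open>det A\<close> and \<open>det D\<close> divide
  each other up to the units \<open>det U\<close> and \<open>det W\<close>, and they have the same degree.\<close>
theorem range_normal_form:
  fixes A :: "'k::field poly mat"
  assumes A: "A \<in> carrier_mat n n" and det: "det A \<noteq> 0"
  obtains U W d where "U \<in> carrier_mat n n" "W \<in> carrier_mat n n" "U * W = 1\<^sub>m n"
    "\<And>v. v \<in> carrier_vec n \<Longrightarrow> (\<exists>y\<in>carrier_vec n. v = A *\<^sub>v y) \<longleftrightarrow> (\<forall>i<n. d i dvd (U *\<^sub>v v) $ i)"
    "\<And>i. i < n \<Longrightarrow> d i \<noteq> 0" "(\<Sum>i<n. degree (d i)) = degree (det A)"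
proof -
  define L where "L = {A *\<^sub>v y | y. y \<in> carrier_vec n}"
  have "vec_submodule n L" unfolding L_def by (rule vec_submodule_range[OF A])
  then obtain U W d where U: "U \<in> carrier_mat n n" and W: "W \<in> carrier_mat n n"
    and UW: "U * W = 1\<^sub>m n" "W * U = 1\<^sub>m n"
    and mem: "\<And>v. v \<in> carrier_vec n \<Longrightarrow> v \<in> L \<longleftrightarrow> (\<forall>i<n. d i dvd (U *\<^sub>v v) $ i)"
    by (rule submodule_normal_form) blast
  define D where "D = mat n n (\<lambda>(i, j). if i = j then d i else 0)"
  have D: "D \<in> carrier_mat n n" by (simp add: D_def)
  have colL: "A *\<^sub>v y \<in> L" if "y \<in> carrier_vec n" for y using that by (auto simp: L_def)
  define G where "G = U * A"
  have G: "G \<in> carrier_mat n n" unfolding G_def using U A by simp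
  define V where "V = mat n n (\<lambda>(i, j). G $$ (i, j) div d i)"
  have V: "V \<in> carrier_mat n n" by (simp add: V_def)
  have "G = D * V"
  proof (rule mat_eq_if_mult_vec_eq[of _ n n])
    have dvd: "d i dvd G $$ (i, j)" if "i < n" "j < n" for i j
    proof -
      have "G $$ (i, j) = (U *\<^sub>v (A *\<^sub>v unit_vec n j)) $ i"
        using that U A by (simp add: G_def mult_unit_vec[OF A])
      moreover have "A *\<^sub>v unit_vec n j \<in> carrier_vec n" using A by simp
      ultimately show ?thesis using mem[of "A *\<^sub>v unit_vec n j"] colL that by simp
    qed
    fix v :: "'k poly vec" assume v: "v \<in> carrier_vec n"
    have "D * V *\<^sub>v v = D *\<^sub>v (V *\<^sub>v v)" using D V v by (intro assoc_mult_mat_vec[of _ n n _ n]) auto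
    also have "\<dots> = vec n (\<lambda>i. d i * (V *\<^sub>v v) $ i)"
      unfolding D_def using V v by (intro mult_vec_diagonal) auto
    also have "\<dots> = G *\<^sub>v v"
    proof (rule eq_vecI)
      fix i assume "i < dim_vec (G *\<^sub>v v)"
      then have i: "i < n" using G by simp
      have "d i * (V *\<^sub>v v) $ i = (\<Sum>j = 0..<n. d i * (V $$ (i, j) * v $ j))"
        using i v V by (simp add: scalar_prod_def sum_distrib_left)
      also have "\<dots> = (\<Sum>j = 0..<n. G $$ (i, j) * v $ j)"
        using i dvd by (intro sum.cong) (auto simp: V_def simp flip: mult.assoc)
      finally show "vec n (\<lambda>i. d i * (V *\<^sub>v v) $ i) $ i = (G *\<^sub>v v) $ i"
        using i v G by (simp add: scalar_prod_def)
    qed (use G in auto)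
    finally show "G *\<^sub>v v = D * V *\<^sub>v v" by simp
  qed (use G D V in \<open>auto intro: mult_carrier_mat\<close>)
  then have "det (U * A) = det (D * V)" by (simp add: G_def)
  then have det1: "det U * det A = det D * det V"
    using U A D V by (simp add: det_mult[of _ n])
  have "\<exists>y\<in>carrier_vec n. W *\<^sub>v (d j \<cdot>\<^sub>v unit_vec n j) = A *\<^sub>v y" if "j < n" for j
  proof -
    have "U *\<^sub>v (W *\<^sub>v (d j \<cdot>\<^sub>v unit_vec n j)) = d j \<cdot>\<^sub>v unit_vec n j"
      using U W UW by (simp flip: assoc_mult_mat_vec[of U n n W n])
    then have "W *\<^sub>v (d j \<cdot>\<^sub>v unit_vec n j) \<in> L"
      using mem[of "W *\<^sub>v (d j \<cdot>\<^sub>v unit_vec n j)"] W that by (auto simp: unit_vec_def)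
    then show ?thesis by (auto simp: L_def)
  qed
  then obtain y where y: "\<And>j. j < n \<Longrightarrow> y j \<in> carrier_vec n"
    "\<And>j. j < n \<Longrightarrow> W *\<^sub>v (d j \<cdot>\<^sub>v unit_vec n j) = A *\<^sub>v y j" by metis
  define V' where "V' = mat n n (\<lambda>(i, j). y j $ i)"
  have V': "V' \<in> carrier_mat n n" by (simp add: V'_def)
  have "W * D = A * V'"
  proof (rule eq_matI)
    fix i j assume "i < dim_row (A * V')" "j < dim_col (A * V')"
    then have ij: "i < n" "j < n" using A V' by auto
    have "col D j = d j \<cdot>\<^sub>v unit_vec n j" using ij by (auto simp: D_def unit_vec_def)
    then have "(W * D) $$ (i, j) = (W *\<^sub>v (d j \<cdot>\<^sub>v unit_vec n j)) $ i"
      using ij W D by simp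
    moreover have "col V' j = y j" using ij y(1)[OF ij(2)] by (intro eq_vecI) (auto simp: V'_def)
    then have "(A * V') $$ (i, j) = (A *\<^sub>v y j) $ i" using ij A V' by simp
    ultimately show "(W * D) $$ (i, j) = (A * V') $$ (i, j)" using y ij by simp
  qed (use A W D V' in auto)
  then have "det (W * D) = det (A * V')" by simp
  then have det2: "det W * det D = det A * det V'"
    using W A D V' by (simp add: det_mult[of _ n])
  have "det U * det W = 1" using U W UW(1) det_mult[of U n W] by simp
  then have nz: "det U \<noteq> 0" "det W \<noteq> 0" by auto
  with arg_cong[OF \<open>det U * det W = 1\<close>, of degree]
  have deg0: "degree (det U) = 0" "degree (det W) = 0" "det U \<noteq> 0" "det W \<noteq> 0"
    by (simp_all add: degree_mult_eq)
  have D0: "det D \<noteq> 0" using det1 det deg0 by auto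
  have detD: "det D = (\<Prod>i<n. d i)" unfolding D_def by (rule det_diagonal)
  have d0: "d i \<noteq> 0" if "i < n" for i using D0 detD that by auto
  have "det V \<noteq> 0" using det1 det deg0 by auto
  have "det V' \<noteq> 0" using det2 D0 deg0 by auto
  have "degree (det A) = degree (det D) + degree (det V)"
    using arg_cong[OF det1, of degree] det deg0 D0 \<open>det V \<noteq> 0\<close> by (simp add: degree_mult_eq)
  moreover have "degree (det D) = degree (det A) + degree (det V')"
    using arg_cong[OF det2, of degree] det deg0 D0 \<open>det V' \<noteq> 0\<close> by (simp add: degree_mult_eq)
  ultimately have "degree (det A) = degree (det D)" by simp
  also have "\<dots> = (\<Sum>i<n. degree (d i))"
    unfolding detD by (intro degree_prod_eq_sum_degree) (use d0 in auto)
  finally have "(\<Sum>i<n. degree (d i)) = degree (det A)" by simp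
  moreover have "(\<exists>y\<in>carrier_vec n. v = A *\<^sub>v y) \<longleftrightarrow> (\<forall>i<n. d i dvd (U *\<^sub>v v) $ i)"
    if "v \<in> carrier_vec n" for v
    using mem[OF that] by (auto simp: L_def)
  ultimately show thesis using that[OF U W UW(1)] d0 by blast
qed

text \<open>The index \<open>ix j\<close> is the coordinate of \<open>U v\<close> that the modulus \<open>a j\<close> looks at; several moduli may look
  at the same coordinate, as the prime powers of a single \<open>d\<^sub>i\<close> do.\<close>
lemma residue_system_coordinates:
  fixes U W :: "'k::field poly mat"
  assumes U: "U \<in> carrier_mat n n" and W: "W \<in> carrier_mat n n" and UW: "U * W = 1\<^sub>m n"
    and ix: "\<And>j. j < r \<Longrightarrow> ix j < n"
    and surj: "\<And>b. \<exists>y. \<forall>j<r. a j dvd y (ix j) - b j"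
    and mem: "\<And>v. v \<in> carrier_vec n \<Longrightarrow> v \<in> L \<longleftrightarrow> (\<forall>j<r. a j dvd (U *\<^sub>v v) $ ix j)"
  shows "residue_system n L r a (\<lambda>j v. (U *\<^sub>v v) $ ix j)"
  unfolding residue_system_def
proof (intro conjI allI impI ballI)
  fix b :: "nat \<Rightarrow> 'k poly"
  from surj[of b] obtain y where y: "\<forall>j<r. a j dvd y (ix j) - b j" ..
  have "U *\<^sub>v (W *\<^sub>v vec n y) = vec n y"
    using U W UW by (simp flip: assoc_mult_mat_vec[of U n n W n])
  then show "\<exists>v\<in>carrier_vec n. \<forall>j<r. a j dvd (U *\<^sub>v v) $ ix j - b j"
    using W y ix by (intro bexI[of _ "W *\<^sub>v vec n y"]) auto
next
  fix v :: "'k poly vec" assume v: "v \<in> carrier_vec n"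
  show "v \<in> L \<longleftrightarrow> (\<forall>j<r. a j dvd (U *\<^sub>v v) $ ix j)" by (rule mem[OF v])
next
  fix j and v w :: "'k poly vec" assume "j < r" "v \<in> carrier_vec n" "w \<in> carrier_vec n"
  then show "a j dvd (U *\<^sub>v (v + w)) $ ix j - ((U *\<^sub>v v) $ ix j + (U *\<^sub>v w) $ ix j)"
    using U ix by (simp add: mult_add_distrib_mat_vec[of _ n n])
next
  fix j c and v :: "'k poly vec" assume "j < r" "v \<in> carrier_vec n"
  then show "a j dvd (U *\<^sub>v (c \<cdot>\<^sub>v v)) $ ix j - c * (U *\<^sub>v v) $ ix j"
    using U ix by (simp add: mult_mat_vec_smult[of _ n n])
qed

corollary has_codim_range:
  fixes A :: "'k::field poly mat"
  assumes A: "A \<in> carrier_mat n n" and det: "det A \<noteq> 0"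
  shows "has_codim n {A *\<^sub>v y | y. y \<in> carrier_vec n} (degree (det A))"
proof -
  obtain U W d where U: "U \<in> carrier_mat n n" and W: "W \<in> carrier_mat n n" and UW: "U * W = 1\<^sub>m n"
    and mem: "\<And>v. v \<in> carrier_vec n \<Longrightarrow>
      (\<exists>y\<in>carrier_vec n. v = A *\<^sub>v y) \<longleftrightarrow> (\<forall>i<n. d i dvd (U *\<^sub>v v) $ i)"
    and d: "\<And>i. i < n \<Longrightarrow> d i \<noteq> 0" "(\<Sum>i<n. degree (d i)) = degree (det A)"
    using range_normal_form[OF A det] by blast
  have "residue_system n {A *\<^sub>v y | y. y \<in> carrier_vec n} n d (\<lambda>i v. (U *\<^sub>v v) $ i)"
  proof (rule residue_system_coordinates[OF U W UW])
    show "\<exists>y. \<forall>j<n. d j dvd y j - b j" for b by (intro exI[of _ b]) simp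
    show "v \<in> {A *\<^sub>v y | y. y \<in> carrier_vec n} \<longleftrightarrow> (\<forall>j<n. d j dvd (U *\<^sub>v v) $ j)"
      if "v \<in> carrier_vec n" for v
      using mem[OF that] by auto
  qed
  from has_codim_residues[OF d(1) this] d(2) show ?thesis by simp
qed

section \<open>Quotient modules\<close>

lemma mem_coset_iff: "z \<in> N +>\<^bsub>M\<^esub> x \<longleftrightarrow> (\<exists>h\<in>N. z = h \<oplus>\<^bsub>M\<^esub> x)"
  by (auto simp: a_r_coset_def')

lemma mem_set_add_iff: "z \<in> A <+>\<^bsub>M\<^esub> B \<longleftrightarrow> (\<exists>a\<in>A. \<exists>b\<in>B. z = a \<oplus>\<^bsub>M\<^esub> b)"
  by (auto simp: set_add_def')

context Module.module
begin

lemma submodule_uminus_closed: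
  assumes "LinearCombinations.submodule R N M" "h \<in> N"
  shows "\<ominus>\<^bsub>M\<^esub> h \<in> N"
proof -
  have h: "h \<in> carrier M" using assms by (auto simp: LinearCombinations.submodule_def)
  have "(\<ominus> \<one>) \<odot>\<^bsub>M\<^esub> h \<in> N"
    using assms by (auto simp: LinearCombinations.submodule_def)
  then show ?thesis using h by (simp add: smult_l_minus)
qed

lemma coset_eq_iff:
  assumes N: "LinearCombinations.submodule R N M" and xy: "x \<in> carrier M" "y \<in> carrier M"
  shows "N +>\<^bsub>M\<^esub> x = N +>\<^bsub>M\<^esub> y \<longleftrightarrow> (\<exists>h\<in>N. x = h \<oplus>\<^bsub>M\<^esub> y)"
proof
  assume eq: "N +>\<^bsub>M\<^esub> x = N +>\<^bsub>M\<^esub> y"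
  have "x = \<zero>\<^bsub>M\<^esub> \<oplus>\<^bsub>M\<^esub> x" "\<zero>\<^bsub>M\<^esub> \<in> N" using N xy by (auto simp: LinearCombinations.submodule_def)
  then have "x \<in> N +>\<^bsub>M\<^esub> x" unfolding mem_coset_iff by blast
  with eq show "\<exists>h\<in>N. x = h \<oplus>\<^bsub>M\<^esub> y" by (simp add: mem_coset_iff)
next
  assume "\<exists>h\<in>N. x = h \<oplus>\<^bsub>M\<^esub> y"
  then obtain h where h: "h \<in> N" "x = h \<oplus>\<^bsub>M\<^esub> y" by blast
  have Nc: "N \<subseteq> carrier M" and add: "\<And>a b. a \<in> N \<Longrightarrow> b \<in> N \<Longrightarrow> a \<oplus>\<^bsub>M\<^esub> b \<in> N"
    using N by (auto simp: LinearCombinations.submodule_def)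
  have "h' \<oplus>\<^bsub>M\<^esub> x = (h' \<oplus>\<^bsub>M\<^esub> h) \<oplus>\<^bsub>M\<^esub> y" if "h' \<in> N" for h'
    using that h Nc xy by (simp add: M.add.m_assoc subset_eq)
  moreover have "h' \<oplus>\<^bsub>M\<^esub> y = (h' \<oplus>\<^bsub>M\<^esub> \<ominus>\<^bsub>M\<^esub> h) \<oplus>\<^bsub>M\<^esub> x" if "h' \<in> N" for h'
  proof -
    have c: "h' \<in> carrier M" "h \<in> carrier M" using that h Nc by auto
    have "\<ominus>\<^bsub>M\<^esub> h \<oplus>\<^bsub>M\<^esub> x = y" unfolding h(2) using c xy by (simp add: M.r_neg1)
    then show ?thesis using c xy by (simp add: M.add.m_assoc)
  qed
  ultimately have "z \<in> N +>\<^bsub>M\<^esub> x \<longleftrightarrow> z \<in> N +>\<^bsub>M\<^esub> y" for z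
    unfolding mem_coset_iff using h(1) add submodule_uminus_closed[OF N] by metis
  then show "N +>\<^bsub>M\<^esub> x = N +>\<^bsub>M\<^esub> y" by blast
qed

lemma carrier_quot_module: "carrier (quot_module M N) = (\<lambda>x. N +>\<^bsub>M\<^esub> x) ` carrier M"
  by (auto simp: quot_module_def A_RCOSETS_def')

lemma add_quot_module:
  assumes N: "LinearCombinations.submodule R N M" and xy: "x \<in> carrier M" "y \<in> carrier M"
  shows "(N +>\<^bsub>M\<^esub> x) \<oplus>\<^bsub>quot_module M N\<^esub> (N +>\<^bsub>M\<^esub> y) = N +>\<^bsub>M\<^esub> (x \<oplus>\<^bsub>M\<^esub> y)"
proof -
  have Nc: "\<And>h. h \<in> N \<Longrightarrow> h \<in> carrier M" and add: "\<And>a b. a \<in> N \<Longrightarrow> b \<in> N \<Longrightarrow> a \<oplus>\<^bsub>M\<^esub> b \<in> N"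
    and zero: "\<zero>\<^bsub>M\<^esub> \<in> N"
    using N by (auto simp: LinearCombinations.submodule_def)
  have 1: "(h \<oplus>\<^bsub>M\<^esub> x) \<oplus>\<^bsub>M\<^esub> (h' \<oplus>\<^bsub>M\<^esub> y) = (h \<oplus>\<^bsub>M\<^esub> h') \<oplus>\<^bsub>M\<^esub> (x \<oplus>\<^bsub>M\<^esub> y)" if "h \<in> N" "h' \<in> N" for h h'
    using Nc[OF that(1)] Nc[OF that(2)] xy by (simp add: M.add.m_ac)
  have 2: "h \<oplus>\<^bsub>M\<^esub> (x \<oplus>\<^bsub>M\<^esub> y) = (h \<oplus>\<^bsub>M\<^esub> x) \<oplus>\<^bsub>M\<^esub> (\<zero>\<^bsub>M\<^esub> \<oplus>\<^bsub>M\<^esub> y)" if "h \<in> N" for h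
    using Nc[OF that] xy by (simp add: M.add.m_assoc)
  have "z \<in> (N +>\<^bsub>M\<^esub> x) <+>\<^bsub>M\<^esub> (N +>\<^bsub>M\<^esub> y) \<longleftrightarrow> z \<in> N +>\<^bsub>M\<^esub> (x \<oplus>\<^bsub>M\<^esub> y)" for z
  proof
    assume "z \<in> (N +>\<^bsub>M\<^esub> x) <+>\<^bsub>M\<^esub> (N +>\<^bsub>M\<^esub> y)"
    then obtain h h' where "h \<in> N" "h' \<in> N" "z = (h \<oplus>\<^bsub>M\<^esub> x) \<oplus>\<^bsub>M\<^esub> (h' \<oplus>\<^bsub>M\<^esub> y)"
      by (auto simp: mem_coset_iff mem_set_add_iff)
    with 1[of h h'] add show "z \<in> N +>\<^bsub>M\<^esub> (x \<oplus>\<^bsub>M\<^esub> y)" by (auto simp: mem_coset_iff)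
  next
    assume "z \<in> N +>\<^bsub>M\<^esub> (x \<oplus>\<^bsub>M\<^esub> y)"
    then obtain h where "h \<in> N" "z = h \<oplus>\<^bsub>M\<^esub> (x \<oplus>\<^bsub>M\<^esub> y)" by (auto simp: mem_coset_iff)
    moreover from this zero have "h \<oplus>\<^bsub>M\<^esub> x \<in> N +>\<^bsub>M\<^esub> x" "\<zero>\<^bsub>M\<^esub> \<oplus>\<^bsub>M\<^esub> y \<in> N +>\<^bsub>M\<^esub> y"
      unfolding mem_coset_iff by blast+
    ultimately show "z \<in> (N +>\<^bsub>M\<^esub> x) <+>\<^bsub>M\<^esub> (N +>\<^bsub>M\<^esub> y)"
      using 2[of h] unfolding mem_set_add_iff by metis
  qed
  then show ?thesis by (simp add: quot_module_def set_eq_iff)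
qed

lemma smult_quot_module:
  assumes N: "LinearCombinations.submodule R N M" and x: "x \<in> carrier M" and r: "r \<in> carrier R"
  shows "r \<odot>\<^bsub>quot_module M N\<^esub> (N +>\<^bsub>M\<^esub> x) = N +>\<^bsub>M\<^esub> (r \<odot>\<^bsub>M\<^esub> x)"
proof -
  have Nc: "\<And>h. h \<in> N \<Longrightarrow> h \<in> carrier M" and add: "\<And>a b. a \<in> N \<Longrightarrow> b \<in> N \<Longrightarrow> a \<oplus>\<^bsub>M\<^esub> b \<in> N"
    and zero: "\<zero>\<^bsub>M\<^esub> \<in> N" and sm: "\<And>h. h \<in> N \<Longrightarrow> r \<odot>\<^bsub>M\<^esub> h \<in> N"
    using N r by (auto simp: LinearCombinations.submodule_def)
  have 1: "h \<oplus>\<^bsub>M\<^esub> r \<odot>\<^bsub>M\<^esub> (h' \<oplus>\<^bsub>M\<^esub> x) = (h \<oplus>\<^bsub>M\<^esub> r \<odot>\<^bsub>M\<^esub> h') \<oplus>\<^bsub>M\<^esub> r \<odot>\<^bsub>M\<^esub> x" if "h \<in> N" "h' \<in> N" for h h'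
    using Nc[OF that(1)] Nc[OF that(2)] x r by (simp add: M.add.m_assoc smult_r_distr)
  have 2: "h \<oplus>\<^bsub>M\<^esub> r \<odot>\<^bsub>M\<^esub> x = h \<oplus>\<^bsub>M\<^esub> r \<odot>\<^bsub>M\<^esub> (\<zero>\<^bsub>M\<^esub> \<oplus>\<^bsub>M\<^esub> x)" if "h \<in> N" for h
    using Nc[OF that] x r by simp
  have "z \<in> N <+>\<^bsub>M\<^esub> ((\<lambda>x. r \<odot>\<^bsub>M\<^esub> x) ` (N +>\<^bsub>M\<^esub> x)) \<longleftrightarrow> z \<in> N +>\<^bsub>M\<^esub> (r \<odot>\<^bsub>M\<^esub> x)" for z
  proof
    assume "z \<in> N <+>\<^bsub>M\<^esub> ((\<lambda>x. r \<odot>\<^bsub>M\<^esub> x) ` (N +>\<^bsub>M\<^esub> x))"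
    then obtain h h' where "h \<in> N" "h' \<in> N" "z = h \<oplus>\<^bsub>M\<^esub> r \<odot>\<^bsub>M\<^esub> (h' \<oplus>\<^bsub>M\<^esub> x)"
      by (auto simp: mem_coset_iff mem_set_add_iff)
    with 1[of h h'] add sm show "z \<in> N +>\<^bsub>M\<^esub> (r \<odot>\<^bsub>M\<^esub> x)" by (auto simp: mem_coset_iff)
  next
    assume "z \<in> N +>\<^bsub>M\<^esub> (r \<odot>\<^bsub>M\<^esub> x)"
    then obtain h where "h \<in> N" "z = h \<oplus>\<^bsub>M\<^esub> r \<odot>\<^bsub>M\<^esub> x" by (auto simp: mem_coset_iff)
    moreover have "r \<odot>\<^bsub>M\<^esub> (\<zero>\<^bsub>M\<^esub> \<oplus>\<^bsub>M\<^esub> x) \<in> (\<lambda>x. r \<odot>\<^bsub>M\<^esub> x) ` (N +>\<^bsub>M\<^esub> x)"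
      using zero by (intro imageI) (auto simp: mem_coset_iff)
    ultimately show "z \<in> N <+>\<^bsub>M\<^esub> ((\<lambda>x. r \<odot>\<^bsub>M\<^esub> x) ` (N +>\<^bsub>M\<^esub> x))"
      using 2[of h] unfolding mem_set_add_iff by metis
  qed
  then show ?thesis by (simp add: quot_module_def set_eq_iff)
qed

lemma quot_module_is_module:
  assumes N: "LinearCombinations.submodule R N M"
  shows "Module.module R (quot_module M N)"
proof (rule LinearCombinations.module_criteria)
  have "N \<subseteq> carrier M" using N by (simp add: LinearCombinations.submodule_def)
  then have zero: "\<zero>\<^bsub>quot_module M N\<^esub> = N +>\<^bsub>M\<^esub> \<zero>\<^bsub>M\<^esub>"
    by (simp add: quot_module_def M.a_coset_add_zero)
  show "\<zero>\<^bsub>quot_module M N\<^esub> \<in> carrier (quot_module M N)"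
    using zero by (auto simp: carrier_quot_module)
  show "\<forall>v\<in>carrier (quot_module M N). \<exists>w\<in>carrier (quot_module M N).
      v \<oplus>\<^bsub>quot_module M N\<^esub> w = \<zero>\<^bsub>quot_module M N\<^esub>"
  proof
    fix v assume "v \<in> carrier (quot_module M N)"
    then obtain x where x: "x \<in> carrier M" "v = N +>\<^bsub>M\<^esub> x" by (auto simp: carrier_quot_module)
    then have "v \<oplus>\<^bsub>quot_module M N\<^esub> (N +>\<^bsub>M\<^esub> \<ominus>\<^bsub>M\<^esub> x) = \<zero>\<^bsub>quot_module M N\<^esub>"
      by (simp add: zero add_quot_module[OF N] M.r_neg)
    then show "\<exists>w\<in>carrier (quot_module M N). v \<oplus>\<^bsub>quot_module M N\<^esub> w = \<zero>\<^bsub>quot_module M N\<^esub>"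
      using x by (auto simp: carrier_quot_module)
  qed
  show "\<forall>v\<in>carrier (quot_module M N). v \<oplus>\<^bsub>quot_module M N\<^esub> \<zero>\<^bsub>quot_module M N\<^esub> = v"
    unfolding zero by (auto simp: carrier_quot_module add_quot_module[OF N])
qed (auto simp: carrier_quot_module add_quot_module[OF N] smult_quot_module[OF N] M.add.m_ac
    smult_l_distr smult_r_distr smult_assoc1 intro: R.cring_axioms)

text \<open>The isomorphism theorem, in both directions: homomorphisms out of \<open>M / N\<close> are homomorphisms out of
  \<open>M\<close> that identify exactly the elements that differ by an element of \<open>N\<close>. The condition
  compares pairs of elements, rather than elements with \<open>0\<close>, because the target is an arbitrary
  structure whose zero need not be neutral.\<close>
theorem module_isomorphic_quot_module_iff:
  assumes N: "LinearCombinations.submodule R N M"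
  shows "module_isomorphic R (quot_module M N) P \<longleftrightarrow>
    (\<exists>f \<in> LinearCombinations.module_hom R M P. f ` carrier M = carrier P \<and>
       (\<forall>x\<in>carrier M. \<forall>y\<in>carrier M. f x = f y \<longleftrightarrow> (\<exists>h\<in>N. x = h \<oplus>\<^bsub>M\<^esub> y)))"
proof
  assume "module_isomorphic R (quot_module M N) P"
  then obtain F where F: "F \<in> LinearCombinations.module_hom R (quot_module M N) P"
      "bij_betw F (carrier (quot_module M N)) (carrier P)"
    by (auto simp: module_isomorphic_def)
  define f where "f x = F (N +>\<^bsub>M\<^esub> x)" for x
  have mem: "N +>\<^bsub>M\<^esub> x \<in> carrier (quot_module M N)" if "x \<in> carrier M" for x
    using that by (auto simp: carrier_quot_module)
  have inj: "inj_on F (carrier (quot_module M N))" and im: "F ` carrier (quot_module M N) = carrier P"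
    using F(2) by (auto simp: bij_betw_def)
  have "f \<in> LinearCombinations.module_hom R M P"
    unfolding LinearCombinations.module_hom_def
  proof (intro CollectI conjI allI impI)
    show "f \<in> carrier M \<rightarrow> carrier P" using im mem by (auto simp: f_def)
    show "f (m1 \<oplus>\<^bsub>M\<^esub> m2) = f m1 \<oplus>\<^bsub>P\<^esub> f m2" if "m1 \<in> carrier M \<and> m2 \<in> carrier M" for m1 m2
      using LinearCombinations.module_hom_add[OF F(1) mem[of m1] mem[of m2]] that
        add_quot_module[OF N, of m1 m2] by (simp add: f_def)
    show "f (r \<odot>\<^bsub>M\<^esub> m) = r \<odot>\<^bsub>P\<^esub> f m" if "r \<in> carrier R \<and> m \<in> carrier M" for r m
      using LinearCombinations.module_hom_smult[OF F(1) _ mem[of m], of r] that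
        smult_quot_module[OF N, of m r] by (simp add: f_def)
  qed
  moreover have "f ` carrier M = carrier P"
    using im by (simp add: f_def carrier_quot_module image_image)
  moreover have "f x = f y \<longleftrightarrow> (\<exists>h\<in>N. x = h \<oplus>\<^bsub>M\<^esub> y)" if "x \<in> carrier M" "y \<in> carrier M" for x y
    using inj_on_eq_iff[OF inj mem[OF that(1)] mem[OF that(2)]] coset_eq_iff[OF N that]
    by (simp add: f_def)
  ultimately show "\<exists>f \<in> LinearCombinations.module_hom R M P. f ` carrier M = carrier P \<and>
       (\<forall>x\<in>carrier M. \<forall>y\<in>carrier M. f x = f y \<longleftrightarrow> (\<exists>h\<in>N. x = h \<oplus>\<^bsub>M\<^esub> y))" by blast
next
  assume "\<exists>f \<in> LinearCombinations.module_hom R M P. f ` carrier M = carrier P \<and>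
       (\<forall>x\<in>carrier M. \<forall>y\<in>carrier M. f x = f y \<longleftrightarrow> (\<exists>h\<in>N. x = h \<oplus>\<^bsub>M\<^esub> y))"
  then obtain f where f: "f \<in> LinearCombinations.module_hom R M P" "f ` carrier M = carrier P"
    and ker: "\<And>x y. x \<in> carrier M \<Longrightarrow> y \<in> carrier M \<Longrightarrow> f x = f y \<longleftrightarrow> (\<exists>h\<in>N. x = h \<oplus>\<^bsub>M\<^esub> y)"
    by blast
  define F where "F X = f (SOME x. x \<in> carrier M \<and> X = N +>\<^bsub>M\<^esub> x)" for X
  have F: "F (N +>\<^bsub>M\<^esub> x) = f x" if x: "x \<in> carrier M" for x
  proof -
    define y where "y = (SOME y. y \<in> carrier M \<and> N +>\<^bsub>M\<^esub> x = N +>\<^bsub>M\<^esub> y)"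
    have "y \<in> carrier M \<and> N +>\<^bsub>M\<^esub> x = N +>\<^bsub>M\<^esub> y"
      unfolding y_def by (rule someI[of _ x]) (use x in simp)
    then have "f x = f y" using coset_eq_iff[OF N x] ker[OF x] by blast
    then show ?thesis by (simp add: F_def y_def)
  qed
  have "F \<in> LinearCombinations.module_hom R (quot_module M N) P"
    unfolding LinearCombinations.module_hom_def
  proof (intro CollectI conjI allI impI)
    show "F \<in> carrier (quot_module M N) \<rightarrow> carrier P"
      using F f(2) by (auto simp: carrier_quot_module)
    show "F (m1 \<oplus>\<^bsub>quot_module M N\<^esub> m2) = F m1 \<oplus>\<^bsub>P\<^esub> F m2"
      if "m1 \<in> carrier (quot_module M N) \<and> m2 \<in> carrier (quot_module M N)" for m1 m2
      using that F f(1) by (auto simp: carrier_quot_module add_quot_module[OF N]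
          LinearCombinations.module_hom_def)
    show "F (r \<odot>\<^bsub>quot_module M N\<^esub> m) = r \<odot>\<^bsub>P\<^esub> F m"
      if "r \<in> carrier R \<and> m \<in> carrier (quot_module M N)" for r m
      using that F f(1) by (auto simp: carrier_quot_module smult_quot_module[OF N]
          LinearCombinations.module_hom_def)
  qed
  moreover have "bij_betw F (carrier (quot_module M N)) (carrier P)"
    unfolding bij_betw_def
  proof
    show "inj_on F (carrier (quot_module M N))"
      using F ker coset_eq_iff[OF N] by (auto simp: carrier_quot_module inj_on_def)
    show "F ` carrier (quot_module M N) = carrier P"
      using F f(2) by (auto simp: carrier_quot_module image_image)
  qed
  ultimately show "module_isomorphic R (quot_module M N) P" by (auto simp: module_isomorphic_def)
qed

end

section \<open>Ideals of \<open>k[t]\<close>\<close>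

text \<open>The generator is an element of least degree among the nonzero elements; the zero ideal has
  generator \<open>0\<close>.\<close>
lemma poly_ideal_eq_multiples:
  fixes I :: "'k::field poly set"
  assumes "ideal I class_ring"
  obtains a where "I = {x. a dvd x}"
proof -
  interpret I: ideal I "class_ring :: 'k poly ring" by fact
  have zero: "0 \<in> I" using I.zero_closed by simp
  have mult: "c * x \<in> I" if "x \<in> I" for c x using I.I_l_closed[OF that, of c] by simp
  have add: "x + y \<in> I" if "x \<in> I" "y \<in> I" for x y using I.a_closed[OF that] by simp
  show thesis
  proof (cases "I = {0}")
    case True
    then show thesis using that[of 0] by auto
  next
    case False
    define m where "m = (LEAST m. \<exists>x\<in>I. x \<noteq> 0 \<and> degree x = m)"
    have "\<exists>m. \<exists>x\<in>I. x \<noteq> 0 \<and> degree x = m" using False zero by auto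
    then have "\<exists>x\<in>I. x \<noteq> 0 \<and> degree x = m" unfolding m_def by (rule LeastI_ex)
    then obtain a where a: "a \<in> I" "a \<noteq> 0" "degree a = m" by blast
    have "a dvd x" if "x \<in> I" for x
    proof -
      have "x mod a = x + (- (x div a)) * a" by (simp add: minus_div_mult_eq_mod)
      then have "x mod a \<in> I" using that a mult add by metis
      moreover have "x mod a = 0 \<or> degree (x mod a) < m" using degree_mod_less[of a x] a by auto
      moreover have "\<not> degree (x mod a) < m" if "x mod a \<in> I" "x mod a \<noteq> 0"
        using that not_less_Least[of "degree (x mod a)" "\<lambda>m. \<exists>x\<in>I. x \<noteq> 0 \<and> degree x = m"]
        unfolding m_def by blast
      ultimately have "x mod a = 0" by blast
      then show ?thesis by (simp add: mod_eq_0_iff_dvd)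
    qed
    moreover have "x \<in> I" if "a dvd x" for x using that mult[OF a(1)] by (auto simp: dvd_def mult.commute[of a])
    ultimately have "I = {x. a dvd x}" by blast
    then show thesis by (rule that)
  qed
qed

lemma ideal_multiples:
  "ideal {x. a dvd x} (class_ring :: 'a::comm_ring_1 ring)"
proof -
  have cring: "cring (class_ring :: 'a ring)" by unfold_locales
  have "PIdl\<^bsub>class_ring\<^esub> a = {x. a dvd x}"
    by (auto simp: cgenideal_def dvd_def mult.commute)
  then show ?thesis using cring.cgenideal_ideal[OF cring, of a] by simp
qed

lemma ideal_prod_multiples:
  "ideal_prod (class_ring :: 'a::comm_ring_1 ring) {x. a dvd x} {x. b dvd x} = {x. a * b dvd x}"
proof (intro equalityI subsetI)
  fix x assume "x \<in> ideal_prod (class_ring :: 'a ring) {x. a dvd x} {x. b dvd x}"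
  then show "x \<in> {x. a * b dvd x}"
    by (induction rule: ideal_prod.induct) (auto intro: mult_dvd_mono)
next
  fix x assume "x \<in> {x. a * b dvd x}"
  then obtain c where "x = a * (b * c)" by (auto simp: dvd_def mult.assoc)
  moreover have "a \<otimes>\<^bsub>class_ring\<^esub> (b * c) \<in> ideal_prod class_ring {x. a dvd x} {x. b dvd x}"
    by (intro ideal_prod.prod) auto
  ultimately show "x \<in> ideal_prod class_ring {x. a dvd x} {x. b dvd x}" by simp
qed

lemma ideals_set_simps:
  "carrier (ideals_set (class_ring :: 'a::comm_ring_1 ring)) = {I. ideal I class_ring}"
  "I \<otimes>\<^bsub>ideals_set (class_ring :: 'a::comm_ring_1 ring)\<^esub> J = ideal_prod class_ring I J"
  "\<one>\<^bsub>ideals_set (class_ring :: 'a::comm_ring_1 ring)\<^esub> = UNIV"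
  by (simp_all add: ideals_set_def)

lemma ideals_set_pow_multiples:
  "{x. p dvd x} [^]\<^bsub>ideals_set (class_ring :: 'a::comm_ring_1 ring)\<^esub> (e::nat) = {x. p ^ e dvd x}"
proof -
  have "cring (class_ring :: 'a ring)" by unfold_locales
  then interpret I: comm_monoid "ideals_set (class_ring :: 'a ring)"
    by (rule cring.ideals_set_is_comm_monoid)
  show ?thesis
    by (induction e) (simp_all add: ideals_set_simps ideal_prod_multiples mult.commute)
qed

lemma ideals_set_prod_multiples:
  fixes a :: "'i \<Rightarrow> 'a::comm_ring_1"
  assumes "finite S"
  shows "(\<Otimes>\<^bsub>ideals_set class_ring\<^esub> i\<in>S. {x. a i dvd x}) = {x. (\<Prod>i\<in>S. a i) dvd x}"
proof -
  have "cring (class_ring :: 'a ring)" by unfold_locales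
  then interpret I: comm_monoid "ideals_set (class_ring :: 'a ring)"
    by (rule cring.ideals_set_is_comm_monoid)
  show ?thesis using assms
  proof (induction S rule: finite_induct)
    case empty
    then show ?case by (simp add: ideals_set_simps)
  next
    case (insert i S)
    have "(\<Otimes>\<^bsub>ideals_set class_ring\<^esub> j\<in>insert i S. {x. a j dvd x})
        = {x. a i dvd x} \<otimes>\<^bsub>ideals_set class_ring\<^esub> (\<Otimes>\<^bsub>ideals_set class_ring\<^esub> j\<in>S. {x. a j dvd x})"
      using insert.hyps
      by (intro I.finprod_insert) (simp_all add: ideals_set_simps ideal_multiples)
    then show ?case using insert by (simp add: ideals_set_simps ideal_prod_multiples)
  qed
qed

lemma primeideal_multiples:
  fixes p :: "'k::field poly"
  assumes "irreducible p"
  shows "primeideal {x. p dvd x} class_ring"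
proof (rule primeidealI)
  show "ideal {x. p dvd x} class_ring" by (rule ideal_multiples)
  show "cring (class_ring :: 'k poly ring)" by unfold_locales
  have "\<not> p dvd 1" using assms by (auto simp: irreducible_def)
  then show "carrier class_ring \<noteq> {x. p dvd x}" by auto
next
  fix a b :: "'k poly"
  assume "a \<otimes>\<^bsub>class_ring\<^esub> b \<in> {x. p dvd x}"
  then show "a \<in> {x. p dvd x} \<or> b \<in> {x. p dvd x}"
    using field_poly_irreducible_imp_prime[OF assms] by (auto dest: prime_elem_dvd_multD)
qed

lemma irreducible_divisor_exists:
  fixes a :: "'k::field poly"
  assumes "0 < degree a"
  obtains p where "irreducible p" "p dvd a"
proof -
  have "\<exists>p. irreducible p \<and> p dvd a"
    using assms
  proof (induction "degree a" arbitrary: a rule: less_induct)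
    case less
    show ?case
    proof (cases "irreducible a")
      case False
      have "a \<noteq> 0" using less.prems by auto
      then have "\<not> a dvd 1" using less.prems by (simp add: is_unit_iff_degree)
      with False obtain b c where bc: "a = b * c" "\<not> b dvd 1" "\<not> c dvd 1"
        using \<open>a \<noteq> 0\<close> by (auto simp: irreducible_def)
      with \<open>a \<noteq> 0\<close> have nz: "b \<noteq> 0" "c \<noteq> 0" by auto
      with bc have "0 < degree b" "0 < degree c" by (simp_all add: is_unit_iff_degree)
      moreover from this nz bc have "degree b < degree a" by (simp add: degree_mult_eq)
      ultimately obtain p where "irreducible p" "p dvd b" using less.hyps by blast
      with bc show ?thesis by auto
    qed auto
  qed
  then show thesis using that by blast
qed

text \<open>For \<open>p\<close> itself, the ideal generated by \<open>p\<close> and \<open>b\<close> is principal, and its generator divides the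
  irreducible \<open>p\<close> without being associated to it, so it is a unit. The power follows by multiplying relations.\<close>
lemma bezout_irreducible_power:
  fixes p b :: "'k::field poly"
  assumes "irreducible p" "\<not> p dvd b"
  obtains u w where "u * p ^ e + w * b = 1"
proof -
  have "\<exists>u w. u * p ^ e + w * b = 1"
  proof (induction e)
    case 0
    show ?case by (intro exI[of _ 1] exI[of _ 0]) simp
  next
    case (Suc e)
    then obtain u w where uw: "u * p ^ e + w * b = 1" by blast
    define I where "I = {x. p dvd x} <+>\<^bsub>class_ring\<^esub> {x. b dvd x}"
    have mem_I: "v \<in> I \<longleftrightarrow> (\<exists>x y. v = x * p + y * b)" for v
    proof
      assume "v \<in> I"
      then obtain x y where "p dvd x" "b dvd y" "v = x + y" by (auto simp: I_def mem_set_add_iff)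
      then show "\<exists>x y. v = x * p + y * b" by (metis dvd_def mult.commute)
    next
      assume "\<exists>x y. v = x * p + y * b"
      then obtain x y where "v = x * p + y * b" by blast
      then show "v \<in> I" unfolding I_def mem_set_add_iff
        by (intro bexI[of _ "x * p"] bexI[of _ "y * b"]) auto
    qed
    have "ring (class_ring :: 'k poly ring)" by unfold_locales
    then have "ideal I class_ring"
      unfolding I_def by (intro ring.add_ideals ideal_multiples)
    then obtain g where g: "I = {x. g dvd x}" by (rule poly_ideal_eq_multiples)
    have "p = 1 * p + 0 * b" "b = 0 * p + 1 * b" by simp_all
    then have "p \<in> I" "b \<in> I" unfolding mem_I by blast+
    then have "g dvd p" "g dvd b" using g by auto
    moreover have "\<not> p dvd g" using assms \<open>g dvd b\<close> dvd_trans by blast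
    ultimately have "g dvd 1"
      using assms(1) by (metis irreducible_altdef)
    then have "1 \<in> I" using g by simp
    then obtain x y where xy: "x * p + y * b = 1" using mem_I[of 1] by metis
    have "(u * x) * p ^ Suc e + (u * p ^ e * y + w * x * p + w * y * b) * b
        = (u * p ^ e + w * b) * (x * p + y * b)" by (simp add: algebra_simps)
    also have "\<dots> = 1" by (simp add: uw xy)
    finally show ?case by blast
  qed
  then show thesis using that by blast
qed

section \<open>Splitting into prime powers\<close>

lemma split_off_power:
  fixes a q :: "'k::field poly"
  assumes "a \<noteq> 0" "0 < degree q"
  obtains m c where "a = q ^ m * c" "\<not> q dvd c"
proof -
  have "\<exists>m c. a = q ^ m * c \<and> \<not> q dvd c" using assms(1)
  proof (induction "degree a" arbitrary: a rule: less_induct)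
    case less
    show ?case
    proof (cases "q dvd a")
      case True
      then obtain b where b: "a = q * b" by (auto simp: dvd_def)
      with less.prems have "b \<noteq> 0" "q \<noteq> 0" by auto
      with b assms(2) have "degree b < degree a" by (simp add: degree_mult_eq)
      with less.hyps \<open>b \<noteq> 0\<close> obtain m c where mc: "b = q ^ m * c" "\<not> q dvd c" by blast
      with b have "a = q ^ Suc m * c" by (simp add: mult.assoc)
      with mc(2) show ?thesis by blast
    next
      case False
      moreover have "a = q ^ 0 * a" by simp
      ultimately show ?thesis by blast
    qed
  qed
  then show thesis using that by blast
qed

text \<open>The prime powers \<open>p\<^sub>j\<^sup>e\<^sup>j\<close> together describe the same divisibility conditions as the \<open>d\<^sub>i\<close>, where the
  \<open>j\<close>-th one concerns the entry \<open>ix j\<close>, and they can be prescribed independently. This is the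
  factorization of all \<open>d\<^sub>i\<close> and the Chinese remainder theorem in one statement.\<close>
definition prime_power_split ::
  "nat \<Rightarrow> (nat \<Rightarrow> 'k::field poly) \<Rightarrow> nat \<Rightarrow> (nat \<Rightarrow> 'k poly) \<Rightarrow> (nat \<Rightarrow> nat) \<Rightarrow> (nat \<Rightarrow> nat) \<Rightarrow> bool" where
  "prime_power_split n d r p e ix \<longleftrightarrow>
     (\<forall>j<r. ix j < n \<and> irreducible (p j) \<and> 0 < e j) \<and>
     (\<forall>y. (\<forall>i<n. d i dvd y i) \<longleftrightarrow> (\<forall>j<r. p j ^ e j dvd y (ix j))) \<and>
     (\<forall>b. \<exists>y. \<forall>j<r. p j ^ e j dvd y (ix j) - b j)"

text \<open>Induction on the total degree. One full power \<open>q\<^sup>m\<close> of an irreducible \<open>q\<close> is split off from one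
  \<open>d\<^sub>i = q\<^sup>m c\<close>; since \<open>q\<^sup>m\<close> and \<open>c\<close> are comaximal, a Bezout relation combines residues modulo \<open>c\<close>,
  which the induction hypothesis provides, with a residue modulo \<open>q\<^sup>m\<close>.\<close>
lemma prime_power_split_exists:
  fixes d :: "nat \<Rightarrow> 'k::field poly"
  assumes "\<And>i. i < n \<Longrightarrow> d i \<noteq> 0"
  shows "\<exists>r p e ix. prime_power_split n d r p e ix"
  using assms
proof (induction "\<Sum>i<n. degree (d i)" arbitrary: d rule: less_induct)
  case (less d)
  show ?case
  proof (cases "\<forall>i<n. degree (d i) = 0")
    case True
    have "d i dvd x" if "i < n" for i x
    proof -
      have "is_unit (d i)" using is_unit_iff_degree[OF less.prems[OF that]] True that by simp
      then show ?thesis by (rule unit_imp_dvd)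
    qed
    then have "prime_power_split n d 0 (\<lambda>_. 0) (\<lambda>_. 0) (\<lambda>_. 0)" by (simp add: prime_power_split_def)
    then show ?thesis by blast
  next
    case False
    then obtain i where i: "i < n" "0 < degree (d i)" by auto
    obtain q where q: "irreducible q" "q dvd d i" using irreducible_divisor_exists[OF i(2)] by blast
    have "\<not> q dvd 1" using q by (auto simp: irreducible_def)
    have "q \<noteq> 0" using q by (auto simp: irreducible_def)
    then have degq: "0 < degree q" using \<open>\<not> q dvd 1\<close> is_unit_iff_degree[of q] by auto
    have di: "d i \<noteq> 0" using less.prems i by blast
    obtain m c where c: "d i = q ^ m * c" "\<not> q dvd c"
      using split_off_power[OF di degq] .
    have "0 < m" using c q(2) by (cases m) auto
    have c0: "c \<noteq> 0" using c di by auto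
    obtain u w where uw: "u * q ^ m + w * c = 1" using bezout_irreducible_power[OF q(1) c(2)] .
    have "degree (d i) = m * degree q + degree c"
      using c c0 \<open>q \<noteq> 0\<close> by (simp add: degree_mult_eq degree_power_eq)
    then have degc: "degree c < degree (d i)" using degq \<open>0 < m\<close> by simp
    define d' where "d' = d(i := c)"
    have "(\<Sum>l<n. degree (d' l)) < (\<Sum>l<n. degree (d l))"
      using i degc by (intro sum_strict_mono_ex1) (auto simp: d'_def)
    moreover have "d' l \<noteq> 0" if "l < n" for l using that less.prems c0 by (auto simp: d'_def)
    ultimately have "\<exists>r p e ix. prime_power_split n d' r p e ix" by (intro less.hyps) auto
    then obtain r p e ix where "prime_power_split n d' r p e ix" by blast
    then have IH:
      "\<forall>j<r. ix j < n \<and> irreducible (p j) \<and> 0 < (e j :: nat)"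
      "\<And>y. (\<forall>l<n. d' l dvd y l) \<longleftrightarrow> (\<forall>j<r. p j ^ e j dvd y (ix j))"
      "\<And>b. \<exists>y. \<forall>j<r. p j ^ e j dvd y (ix j) - b j"
      by (simp_all add: prime_power_split_def)
    have split: "d i dvd x \<longleftrightarrow> q ^ m dvd x \<and> c dvd x" for x
    proof
      assume "d i dvd x"
      then show "q ^ m dvd x \<and> c dvd x" using c(1) by (metis dvd_mult_left dvd_mult_right)
    next
      assume "q ^ m dvd x \<and> c dvd x"
      then have "q ^ m dvd x" "c dvd x" by simp_all
      then obtain s t where "x = q ^ m * s" "x = c * t" by (elim dvdE)
      then have "x = u * q ^ m * (c * t) + w * c * (q ^ m * s)"
        using uw by (metis distrib_right mult_1)
      then have "x = d i * (u * t + w * s)" unfolding c(1) by (simp add: algebra_simps)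
      then show "d i dvd x" by simp
    qed
    define p' where "p' = p(r := q)"
    define e' where "e' = e(r := m)"
    define ix' where "ix' = ix(r := i)"
    have 1: "\<forall>j<Suc r. ix' j < n \<and> irreducible (p' j) \<and> 0 < e' j"
      using IH(1) i q \<open>0 < m\<close> by (auto simp: p'_def e'_def ix'_def less_Suc_eq)
    have 2: "(\<forall>l<n. d l dvd y l) \<longleftrightarrow> (\<forall>j<Suc r. p' j ^ e' j dvd y (ix' j))" for y
    proof -
      have "(\<forall>l<n. d l dvd y l) \<longleftrightarrow> (\<forall>l<n. d' l dvd y l) \<and> q ^ m dvd y i"
        using i split[of "y i"] by (auto simp: d'_def)
      then show ?thesis using IH(2)[of y] by (auto simp: p'_def e'_def ix'_def less_Suc_eq)
    qed
    have 3: "\<exists>y. \<forall>j<Suc r. p' j ^ e' j dvd y (ix' j) - b j" for b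
    proof -
      from IH(3)[of b] obtain y where y: "\<forall>j<r. p j ^ e j dvd y (ix j) - b j" ..
      (* idempotents modulo d i: w * c is 0 modulo c and 1 modulo q ^ m, u * q ^ m the reverse *)
      define z where "z = y(i := y i * (u * q ^ m) + b r * (w * c))"
      have "p j ^ e j dvd z (ix j) - b j" if "j < r" for j
      proof (cases "ix j = i")
        case True
        have "\<forall>l<n. d' l dvd (if l = i then c else 0)" by (auto simp: d'_def)
        then have "p j ^ e j dvd c" using IH(2)[of "\<lambda>l. if l = i then c else 0"] that True by auto
        moreover have "z i = y i + c * (w * (b r - y i))"
        proof -
          have uq: "u * q ^ m = 1 - w * c" using uw by (simp add: algebra_simps)
          show ?thesis by (simp add: z_def uq algebra_simps)
        qed
        ultimately have "p j ^ e j dvd z i - y i" by (simp add: dvd_mult2)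
        moreover have "p j ^ e j dvd y i - b j" using y that True by blast
        ultimately have "p j ^ e j dvd (z i - y i) + (y i - b j)" by (rule dvd_add)
        then show ?thesis using True by simp
      qed (use y that in \<open>simp add: z_def\<close>)
      moreover have "q ^ m dvd z i - b r"
      proof -
        have wc: "w * c = 1 - u * q ^ m" using uw by (simp add: algebra_simps)
        have "z i - b r = q ^ m * (u * (y i - b r))" unfolding z_def fun_upd_same wc by (simp add: algebra_simps)
        then show ?thesis by simp
      qed
      ultimately show ?thesis
        by (intro exI[of _ z]) (auto simp: p'_def e'_def ix'_def less_Suc_eq)
    qed
    have "prime_power_split n d (Suc r) p' e' ix'"
      unfolding prime_power_split_def using 1 2 3 by simp
    then show ?thesis by blast
  qed
qed

section \<open>Quotients of the standard lattice\<close>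

abbreviation std_module :: "nat \<Rightarrow> ('k::field poly, 'k poly fract vec) module" where
  "std_module n \<equiv> (Kn_module n)\<lparr>carrier := std_lattice n\<rparr>"

lemma std_lattice_eq: "std_lattice n = map_vec to_fract ` carrier_vec n"
proof (intro equalityI subsetI)
  fix x :: "'a poly fract vec" assume x: "x \<in> std_lattice n"
  then obtain f where f: "\<And>i. i < n \<Longrightarrow> x $ i = to_fract (f i)"
    unfolding std_lattice_def by (auto simp: image_iff) metis
  have "x = map_vec to_fract (vec n f)" using x f by (intro eq_vecI) (auto simp: std_lattice_def)
  then show "x \<in> map_vec to_fract ` carrier_vec n" by auto
qed (auto simp: std_lattice_def)

lemma map_vec_to_fract_add:
  "v \<in> carrier_vec n \<Longrightarrow> w \<in> carrier_vec n \<Longrightarrow>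
    map_vec to_fract (v + w) = map_vec to_fract v + map_vec to_fract w"
  by (intro eq_vecI) auto

lemma map_vec_to_fract_smult:
  "map_vec to_fract (c \<cdot>\<^sub>v v) = to_fract c \<cdot>\<^sub>v map_vec to_fract v"
  by (intro eq_vecI) auto

lemma map_vec_to_fract_eq_iff:
  assumes "v \<in> carrier_vec n" "w \<in> carrier_vec n"
  shows "map_vec to_fract v = map_vec to_fract w \<longleftrightarrow> v = w"
proof
  assume *: "map_vec to_fract v = map_vec to_fract w"
  show "v = w"
  proof (rule eq_vecI)
    fix i assume "i < dim_vec w"
    then show "v $ i = w $ i" using arg_cong[OF *, of "\<lambda>x. x $ i"] assms by simp
  qed (use assms in auto)
qed simp

lemma module_Kn: "Module.module (class_ring :: 'k::field poly ring) (Kn_module n)"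
proof (rule LinearCombinations.module_criteria)
  show "cring (class_ring :: 'k poly ring)" by unfold_locales
  show "\<forall>v\<in>carrier (Kn_module n :: ('k poly, 'k poly fract vec) module). \<exists>w\<in>carrier (Kn_module n). v \<oplus>\<^bsub>Kn_module n\<^esub> w = \<zero>\<^bsub>Kn_module n\<^esub>"
  proof
    fix v :: "'k poly fract vec" assume "v \<in> carrier (Kn_module n)"
    then show "\<exists>w\<in>carrier (Kn_module n). v \<oplus>\<^bsub>Kn_module n\<^esub> w = \<zero>\<^bsub>Kn_module n\<^esub>"
      by (intro bexI[of _ "- v"]) (auto simp: Kn_module_def)
  qed
qed (auto simp: Kn_module_def comm_add_vec assoc_add_vec smult_smult_assoc smult_add_distrib_vec
    add_smult_distrib_vec)

lemma submodule_std: "LinearCombinations.submodule class_ring (std_lattice n) (Kn_module n)"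
proof (rule LinearCombinations.submodule.intro[OF module_Kn])
  show "std_lattice n \<subseteq> carrier (Kn_module n)" by (auto simp: std_lattice_def Kn_module_def)
  show "\<zero>\<^bsub>Kn_module n\<^esub> \<in> std_lattice n"
    by (auto simp: std_lattice_def Kn_module_def intro!: range_eqI[of _ _ 0])
next
  fix v w :: "'a poly fract vec" assume "v \<in> std_lattice n" "w \<in> std_lattice n"
  then obtain v' w' where "v' \<in> carrier_vec n" "w' \<in> carrier_vec n"
    "v = map_vec to_fract v'" "w = map_vec to_fract w'" by (auto simp: std_lattice_eq)
  then show "v \<oplus>\<^bsub>Kn_module n\<^esub> w \<in> std_lattice n"
    by (auto simp: Kn_module_def std_lattice_eq map_vec_to_fract_add intro!: image_eqI[of _ _ "v' + w'"])
next
  fix c and v :: "'a poly fract vec" assume "v \<in> std_lattice n"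
  then obtain v' where "v' \<in> carrier_vec n" "v = map_vec to_fract v'" by (auto simp: std_lattice_eq)
  then show "c \<odot>\<^bsub>Kn_module n\<^esub> v \<in> std_lattice n"
    by (auto simp: Kn_module_def std_lattice_eq map_vec_to_fract_smult intro!: image_eqI[of _ _ "c \<cdot>\<^sub>v v'"])
qed

lemma module_std: "Module.module class_ring (std_module n)"
  by (rule module.submodule_is_module[OF module_Kn submodule_std])

lemma std_module_simps:
  "carrier (std_module n) = std_lattice n" "x \<oplus>\<^bsub>std_module n\<^esub> y = x + y"
  "c \<odot>\<^bsub>std_module n\<^esub> x = to_fract c \<cdot>\<^sub>v x"
  "x \<oplus>\<^bsub>Kn_module n\<^esub> y = x + y" "c \<odot>\<^bsub>Kn_module n\<^esub> x = to_fract c \<cdot>\<^sub>v x"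
  by (simp_all add: Kn_module_def)

lemma poly_module_simps:
  "carrier (poly_module sc) = UNIV" "x \<oplus>\<^bsub>poly_module sc\<^esub> y = x + y"
  "c \<odot>\<^bsub>poly_module sc\<^esub> x = sc c x" "\<zero>\<^bsub>poly_module sc\<^esub> = 0"
  by (simp_all add: poly_module_def)

lemma module_poly_mult: "Module.module (class_ring :: 'k::field poly ring) (poly_module (*))"
proof (rule LinearCombinations.module_criteria)
  show "cring (class_ring :: 'k poly ring)" by unfold_locales
  show "\<forall>v\<in>carrier (poly_module (*)). \<exists>w\<in>carrier (poly_module (*)).
      v \<oplus>\<^bsub>poly_module (*)\<^esub> w = \<zero>\<^bsub>poly_module (*) :: ('k poly, 'k poly) module\<^esub>"
    by (auto simp: poly_module_simps intro: exI[of _ "- x" for x])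
qed (auto simp: poly_module_simps algebra_simps)

lemma module_poly_smult:
  "Module.module (class_ring :: 'k::field ring) (poly_module Polynomial.smult)"
proof (rule LinearCombinations.module_criteria)
  show "cring (class_ring :: 'k ring)" by unfold_locales
  show "\<forall>v\<in>carrier (poly_module Polynomial.smult). \<exists>w\<in>carrier (poly_module Polynomial.smult).
      v \<oplus>\<^bsub>poly_module Polynomial.smult\<^esub> w = \<zero>\<^bsub>poly_module Polynomial.smult :: ('k, 'k poly) module\<^esub>"
    by (auto simp: poly_module_simps intro: exI[of _ "- x" for x])
qed (auto simp: poly_module_simps smult_add_left smult_add_right)

lemma submodule_multiples_mult:
  "LinearCombinations.submodule class_ring {x. a dvd x} (poly_module (*))"
  by (rule LinearCombinations.submodule.intro[OF module_poly_mult]) (auto simp: poly_module_simps)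

lemma submodule_multiples_smult:
  "LinearCombinations.submodule class_ring {x. a dvd x} (poly_module Polynomial.smult)"
  by (rule LinearCombinations.submodule.intro[OF module_poly_smult])
    (auto simp: poly_module_simps dvd_smult)

abbreviation residue_class :: "'k::field poly \<Rightarrow> 'k poly \<Rightarrow> 'k poly set" where
  "residue_class a b \<equiv> {x. a dvd x} +>\<^bsub>poly_module (*)\<^esub> b"

abbreviation residue_module :: "'k::field poly \<Rightarrow> ('k poly, 'k poly set) module" where
  "residue_module a \<equiv> quot_module (poly_module (*)) {x. a dvd x}"

lemma residue_class_eq_iff: "residue_class a b = residue_class a c \<longleftrightarrow> a dvd b - c"
proof -
  have "residue_class a b = residue_class a c \<longleftrightarrow> (\<exists>h. a dvd h \<and> b = h + c)"
    using module.coset_eq_iff[OF module_poly_mult submodule_multiples_mult, of b c a]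
    by (simp add: poly_module_simps)
  also have "\<dots> \<longleftrightarrow> a dvd b - c" by (metis add_diff_cancel_right' diff_add_cancel)
  finally show ?thesis .
qed

lemma residue_module_simps:
  "carrier (residue_module a) = range (residue_class a)"
  "residue_class a b \<oplus>\<^bsub>residue_module a\<^esub> residue_class a c = residue_class a (b + c)"
  "p \<odot>\<^bsub>residue_module a\<^esub> residue_class a b = residue_class a (p * b)"
  using module.carrier_quot_module[OF module_poly_mult, of "{x. a dvd x}"]
    module.add_quot_module[OF module_poly_mult submodule_multiples_mult, of b c a]
    module.smult_quot_module[OF module_poly_mult submodule_multiples_mult, of b p a]
  by (simp_all add: poly_module_simps)

lemma fin_direct_sum_simps:
  "carrier (fin_direct_sum I M) = (\<Pi>\<^sub>E i\<in>I. carrier (M i))"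
  "f \<oplus>\<^bsub>fin_direct_sum I M\<^esub> g = (\<lambda>i\<in>I. f i \<oplus>\<^bsub>M i\<^esub> g i)"
  "c \<odot>\<^bsub>fin_direct_sum I M\<^esub> f = (\<lambda>i\<in>I. c \<odot>\<^bsub>M i\<^esub> f i)"
  by (simp_all add: fin_direct_sum_def)

lemma fin_direct_sum_cong:
  assumes "\<And>i. i \<in> I \<Longrightarrow> M i = M' i"
  shows "fin_direct_sum I M = fin_direct_sum I M'"
  unfolding fin_direct_sum_def using assms
  by (auto intro!: PiE_cong restrict_ext ext)

text \<open>The preimage in \<open>R\<^sup>n\<close> of a subset of \<open>K\<^sup>n\<close>; the passage from vectors over \<open>K\<close> with entries in \<open>R\<close>
  to vectors over \<open>R\<close>.\<close>
abbreviation poly_points :: "nat \<Rightarrow> 'k::field poly fract vec set \<Rightarrow> 'k poly vec set" where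
  "poly_points n L0 \<equiv> {v \<in> carrier_vec n. map_vec to_fract v \<in> L0}"

text \<open>The map \<open>g\<^sub>j\<close> picks a representative of the \<open>j\<close>-th component of the image of \<open>v\<close> under the composite
  of the projection and the isomorphism.\<close>
lemma residue_system_of_isomorphism:
  fixes L0 :: "'k::field poly fract vec set"
  assumes L0: "LinearCombinations.submodule class_ring L0 (std_module n)"
    and iso: "module_isomorphic class_ring (quot_module (std_module n) L0)
      (fin_direct_sum {..<r} (\<lambda>j. residue_module (a j)))"
  obtains g where "residue_system n (poly_points n L0) r a g"
proof -
  define P where "P = fin_direct_sum {..<r} (\<lambda>j. residue_module (a j))"
  obtain f where f: "f \<in> LinearCombinations.module_hom class_ring (std_module n) P"
    and im: "f ` std_lattice n = carrier P"
    and ker: "\<And>x y. x \<in> std_lattice n \<Longrightarrow> y \<in> std_lattice n \<Longrightarrow> f x = f y \<longleftrightarrow> (\<exists>h\<in>L0. x = h + y)"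
    using iso unfolding P_def[symmetric] module.module_isomorphic_quot_module_iff[OF module_std L0]
      std_module_simps by blast
  let ?t = "map_vec to_fract :: 'k poly vec \<Rightarrow> _"
  have std: "?t v \<in> std_lattice n" if "v \<in> carrier_vec n" for v using that by (auto simp: std_lattice_eq)
  have fP: "f (?t v) \<in> (\<Pi>\<^sub>E j\<in>{..<r}. range (residue_class (a j)))" if "v \<in> carrier_vec n" for v
    using imageI[OF std[OF that], of f] unfolding im
    by (simp add: P_def fin_direct_sum_simps residue_module_simps)
  define g where "g j v = (SOME b. f (?t v) j = residue_class (a j) b)" for j v
  have g: "f (?t v) j = residue_class (a j) (g j v)" if "v \<in> carrier_vec n" "j < r" for v j
  proof -
    have "f (?t v) j \<in> range (residue_class (a j))"
      using PiE_mem[OF fP[OF that(1)], of j] that(2) by simp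
    then have "\<exists>b. f (?t v) j = residue_class (a j) b" by blast
    then show ?thesis unfolding g_def by (rule someI_ex)
  qed
  have add: "a j dvd g j (v + w) - (g j v + g j w)"
    if "j < r" "v \<in> carrier_vec n" "w \<in> carrier_vec n" for j v w
  proof -
    have "f (?t v + ?t w) = f (?t v) \<oplus>\<^bsub>P\<^esub> f (?t w)"
      using LinearCombinations.module_hom_add[OF f, of "?t v" "?t w"] std that
      by (simp add: std_module_simps)
    then have "f (?t (v + w)) = f (?t v) \<oplus>\<^bsub>P\<^esub> f (?t w)"
      using that by (simp add: map_vec_to_fract_add)
    then have "f (?t (v + w)) j = (f (?t v) \<oplus>\<^bsub>P\<^esub> f (?t w)) j" by simp
    then have "residue_class (a j) (g j (v + w)) = residue_class (a j) (g j v + g j w)"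
      using that g[of "v + w"] by (simp add: g P_def fin_direct_sum_simps residue_module_simps)
    then show ?thesis by (simp add: residue_class_eq_iff)
  qed
  have smult: "a j dvd g j (c \<cdot>\<^sub>v v) - c * g j v" if "j < r" "v \<in> carrier_vec n" for j c v
  proof -
    have "f (to_fract c \<cdot>\<^sub>v ?t v) = c \<odot>\<^bsub>P\<^esub> f (?t v)"
      using LinearCombinations.module_hom_smult[OF f, of c "?t v"] std that
      by (simp add: std_module_simps)
    then have "f (?t (c \<cdot>\<^sub>v v)) j = (c \<odot>\<^bsub>P\<^esub> f (?t v)) j"
      using that by (simp add: map_vec_to_fract_smult)
    then have "residue_class (a j) (g j (c \<cdot>\<^sub>v v)) = residue_class (a j) (c * g j v)"
      using that g[of "c \<cdot>\<^sub>v v"] by (simp add: g P_def fin_direct_sum_simps residue_module_simps)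
    then show ?thesis by (simp add: residue_class_eq_iff)
  qed
  have surj: "\<exists>v\<in>carrier_vec n. \<forall>j<r. a j dvd g j v - b j" for b
  proof -
    have "(\<lambda>j\<in>{..<r}. residue_class (a j) (b j)) \<in> carrier P"
      by (auto simp: P_def fin_direct_sum_simps residue_module_simps)
    then obtain v where v: "v \<in> carrier_vec n" "f (?t v) = (\<lambda>j\<in>{..<r}. residue_class (a j) (b j))"
      unfolding im[symmetric] std_lattice_eq by (auto simp: image_iff)
    have "residue_class (a j) (g j v) = residue_class (a j) (b j)" if "j < r" for j
      using g[OF v(1) that] v(2) that by simp
    with v(1) show ?thesis by (auto simp: residue_class_eq_iff)
  qed
  have mem: "v \<in> poly_points n L0 \<longleftrightarrow> (\<forall>j<r. a j dvd g j v)" if v: "v \<in> carrier_vec n" for v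
  proof -
    have z: "?t (0\<^sub>v n) = 0\<^sub>v n" by (intro eq_vecI) auto
    have g0: "a j dvd g j (0\<^sub>v n)" if "j < r" for j
    proof -
      have "0 \<cdot>\<^sub>v 0\<^sub>v n = (0\<^sub>v n :: 'k poly vec)" by (intro eq_vecI) auto
      then show ?thesis using smult[OF that, of "0\<^sub>v n" 0] by simp
    qed
    have "L0 \<subseteq> std_lattice n" using L0 by (simp add: LinearCombinations.submodule_def Kn_module_def)
    then have "h + 0\<^sub>v n = h" if "h \<in> L0" for h using that by (auto simp: std_lattice_def)
    then have "v \<in> poly_points n L0 \<longleftrightarrow> (\<exists>h\<in>L0. ?t v = h + ?t (0\<^sub>v n))" using v z by auto
    also have "\<dots> \<longleftrightarrow> f (?t v) = f (?t (0\<^sub>v n))"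
      using ker[OF std[OF v] std[of "0\<^sub>v n"]] by simp
    also have "\<dots> \<longleftrightarrow> (\<forall>j\<in>{..<r}. f (?t v) j = f (?t (0\<^sub>v n)) j)"
      by (intro iffI) (auto intro: PiE_ext[OF fP[OF v] fP[of "0\<^sub>v n"]])
    also have "\<dots> \<longleftrightarrow> (\<forall>j<r. a j dvd g j v - g j (0\<^sub>v n))"
      using g[OF v] g[of "0\<^sub>v n"] by (auto simp: residue_class_eq_iff)
    also have "\<dots> \<longleftrightarrow> (\<forall>j<r. a j dvd g j v)" using g0 by (auto simp: dvd_diff_left_iff)
    finally show ?thesis .
  qed
  have "residue_system n (poly_points n L0) r a g"
    unfolding residue_system_def using add smult surj mem by simp
  then show thesis by (rule that)
qed

lemma isomorphism_of_residue_system: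
  fixes L0 :: "'k::field poly fract vec set"
  assumes L0: "LinearCombinations.submodule class_ring L0 (std_module n)"
    and rs: "residue_system n (poly_points n L0) r a g"
  shows "module_isomorphic class_ring (quot_module (std_module n) L0)
      (fin_direct_sum {..<r} (\<lambda>j. residue_module (a j)))"
proof -
  define P where "P = fin_direct_sum {..<r} (\<lambda>j. residue_module (a j))"
  let ?t = "map_vec to_fract :: 'k poly vec \<Rightarrow> _"
  have add: "\<And>j v w. j < r \<Longrightarrow> v \<in> carrier_vec n \<Longrightarrow> w \<in> carrier_vec n \<Longrightarrow>
      a j dvd g j (v + w) - (g j v + g j w)"
    and smult: "\<And>j c v. j < r \<Longrightarrow> v \<in> carrier_vec n \<Longrightarrow> a j dvd g j (c \<cdot>\<^sub>v v) - c * g j v"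
    and surj: "\<And>b. \<exists>v\<in>carrier_vec n. \<forall>j<r. a j dvd g j v - b j"
    and mem: "\<And>v. v \<in> carrier_vec n \<Longrightarrow> ?t v \<in> L0 \<longleftrightarrow> (\<forall>j<r. a j dvd g j v)"
    using rs by (simp_all add: residue_system_def)
  define f where "f x = (\<lambda>j\<in>{..<r}. residue_class (a j) (g j (inv_into (carrier_vec n) ?t x)))" for x
  have "inj_on ?t (carrier_vec n)" by (auto simp: inj_on_def map_vec_to_fract_eq_iff)
  then have f: "f (?t v) = (\<lambda>j\<in>{..<r}. residue_class (a j) (g j v))" if "v \<in> carrier_vec n" for v
    using that by (simp add: f_def)
  have f_eq: "f (?t v) = (\<lambda>j\<in>{..<r}. residue_class (a j) (b j)) \<longleftrightarrow> (\<forall>j<r. a j dvd g j v - b j)"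
    if "v \<in> carrier_vec n" for v b
    unfolding f[OF that]
    by (auto simp: fun_eq_iff restrict_def residue_class_eq_iff simp flip: residue_class_eq_iff)
  have hom: "f \<in> LinearCombinations.module_hom class_ring (std_module n) P"
    unfolding LinearCombinations.module_hom_def
  proof (intro CollectI conjI allI impI)
    show "f \<in> carrier (std_module n) \<rightarrow> carrier P"
      by (auto simp: f_def P_def fin_direct_sum_simps residue_module_simps)
  next
    fix x y :: "'k poly fract vec" assume "x \<in> carrier (std_module n) \<and> y \<in> carrier (std_module n)"
    then obtain v w where v: "v \<in> carrier_vec n" "x = ?t v" and w: "w \<in> carrier_vec n" "y = ?t w"
      by (auto simp: std_module_simps std_lattice_eq)
    have "f (?t (v + w)) = (\<lambda>j\<in>{..<r}. residue_class (a j) (g j v + g j w))"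
      using f_eq[of "v + w" "\<lambda>j. g j v + g j w"] add v w by simp
    also have "\<dots> = f (?t v) \<oplus>\<^bsub>P\<^esub> f (?t w)"
      using v w by (simp add: f P_def fin_direct_sum_simps residue_module_simps cong: restrict_cong)
    finally show "f (x \<oplus>\<^bsub>std_module n\<^esub> y) = f x \<oplus>\<^bsub>P\<^esub> f y"
      using v w by (simp add: std_module_simps map_vec_to_fract_add)
  next
    fix c :: "'k poly" and x :: "'k poly fract vec" assume "c \<in> carrier class_ring \<and> x \<in> carrier (std_module n)"
    then obtain v where v: "v \<in> carrier_vec n" "x = ?t v"
      by (auto simp: std_module_simps std_lattice_eq)
    have "f (?t (c \<cdot>\<^sub>v v)) = (\<lambda>j\<in>{..<r}. residue_class (a j) (c * g j v))"
      using f_eq[of "c \<cdot>\<^sub>v v" "\<lambda>j. c * g j v"] smult v by simp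
    also have "\<dots> = c \<odot>\<^bsub>P\<^esub> f (?t v)"
      using v by (simp add: f P_def fin_direct_sum_simps residue_module_simps cong: restrict_cong)
    finally show "f (c \<odot>\<^bsub>std_module n\<^esub> x) = c \<odot>\<^bsub>P\<^esub> f x"
      using v by (simp add: std_module_simps map_vec_to_fract_smult)
  qed
  have im: "f ` carrier (std_module n) = carrier P"
  proof
    show "f ` carrier (std_module n) \<subseteq> carrier P"
      using LinearCombinations.module_hom_closed[OF hom] by auto
    show "carrier P \<subseteq> f ` carrier (std_module n)"
    proof
      fix z assume z: "z \<in> carrier P"
      then have "\<forall>j<r. \<exists>b. z j = residue_class (a j) b"
        by (fastforce simp: P_def fin_direct_sum_simps residue_module_simps PiE_def Pi_def)
      then obtain b where b: "\<And>j. j < r \<Longrightarrow> z j = residue_class (a j) (b j)" by metis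
      obtain v where v: "v \<in> carrier_vec n" "\<forall>j<r. a j dvd g j v - b j" using surj[of b] by blast
      have "z = (\<lambda>j\<in>{..<r}. residue_class (a j) (b j))"
      proof
        fix j show "z j = (\<lambda>j\<in>{..<r}. residue_class (a j) (b j)) j"
          using z b by (cases "j < r") (auto simp: P_def fin_direct_sum_simps PiE_def extensional_def)
      qed
      then have "f (?t v) = z" using f_eq[OF v(1), of b] v(2) by simp
      then show "z \<in> f ` carrier (std_module n)"
        using v(1) by (auto simp: std_module_simps std_lattice_eq)
    qed
  qed
  have ker: "f x = f y \<longleftrightarrow> (\<exists>h\<in>L0. x = h \<oplus>\<^bsub>std_module n\<^esub> y)"
    if xy: "x \<in> carrier (std_module n)" "y \<in> carrier (std_module n)" for x y
  proof -
    obtain v w where v: "v \<in> carrier_vec n" "x = ?t v" and w: "w \<in> carrier_vec n" "y = ?t w"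
      using xy by (auto simp: std_module_simps std_lattice_eq)
    define u where "u = v + (- 1) \<cdot>\<^sub>v w"
    have u: "u \<in> carrier_vec n" using v w by (simp add: u_def)
    have vu: "v = u + w" using v w by (intro eq_vecI) (auto simp: u_def)
    have xt: "x = ?t u + y" using v w u vu by (simp add: map_vec_to_fract_add)
    have "f x = f y \<longleftrightarrow> (\<forall>j<r. a j dvd g j v - g j w)"
      using f_eq[OF v(1), of "\<lambda>j. g j w"] f[OF w(1)] v w by simp
    also have "\<dots> \<longleftrightarrow> (\<forall>j<r. a j dvd g j u)"
    proof -
      have "a j dvd g j v - g j w \<longleftrightarrow> a j dvd g j u" if "j < r" for j
      proof -
        have "a j dvd (g j v - g j w) - g j u"
          using add[OF that u w(1)] vu by (simp add: algebra_simps)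
        then show ?thesis by (metis dvd_diff_left_iff dvd_diff_right_iff)
      qed
      then show ?thesis by blast
    qed
    also have "\<dots> \<longleftrightarrow> ?t u \<in> L0" using mem[OF u] by simp
    also have "\<dots> \<longleftrightarrow> (\<exists>h\<in>L0. x = h + y)"
    proof
      assume "\<exists>h\<in>L0. x = h + y"
      then obtain h where h: "h \<in> L0" "x = h + y" by blast
      moreover have "h \<in> carrier_vec n"
        using h L0 by (auto simp: LinearCombinations.submodule_def Kn_module_def std_lattice_def)
      ultimately have "h = ?t u" using xt u w v
        by (intro eq_vecI) (auto dest: arg_cong[of _ _ "\<lambda>x. x $ i" for i] simp: vec_eq_iff)
      with h show "?t u \<in> L0" by simp
    qed (use xt in blast)
    finally show ?thesis by (simp add: std_module_simps)
  qed
  show ?thesis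
    unfolding module.module_isomorphic_quot_module_iff[OF module_std L0] P_def[symmetric]
    using hom im ker by blast
qed

text \<open>A decomposition as in the definition of \<open>chi\<close> exists: the normal form makes the quotient a direct sum
  of the \<open>R / (d\<^sub>i)\<close>, which splits further into prime powers. Conversely \<open>chi\<close> is computed from some
  unknown decomposition into \<open>R / (p\<^sub>i\<^sup>e\<^sup>i)\<close>. The degree of the generator
  \<open>\<Prod> p\<^sub>i\<^sup>e\<^sup>i\<close> is determined nevertheless: it is the dimension of the quotient over \<open>k\<close>, which is also
  \<open>\<Sum> deg d\<^sub>i\<close>.\<close>
theorem chi_of_normal_form:
  fixes L0 :: "'k::field poly fract vec set"
  assumes L0: "LinearCombinations.submodule class_ring L0 (std_module n)"
    and U: "U \<in> carrier_mat n n" and W: "W \<in> carrier_mat n n" and UW: "U * W = 1\<^sub>m n"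
    and mem: "\<And>v. v \<in> carrier_vec n \<Longrightarrow> map_vec to_fract v \<in> L0 \<longleftrightarrow> (\<forall>i<n. d i dvd (U *\<^sub>v v) $ i)"
    and d: "\<And>i. i < n \<Longrightarrow> d i \<noteq> 0"
  obtains a where "a \<noteq> 0" "degree a = (\<Sum>i<n. degree (d i))"
    "chi (quot_module (std_module n) L0) = {x. a dvd x}"
proof -
  let ?R = "class_ring :: 'k poly ring" and ?Q = "quot_module (std_module n) L0"
  define decomp where "decomp J r P e \<longleftrightarrow>
     (\<forall>i<r. primeideal (P i) ?R \<and> P i \<noteq> {0} \<and> 0 < e i) \<and>
     module_isomorphic ?R ?Q
       (fin_direct_sum {..<r} (\<lambda>i. quot_module (poly_module (*)) (P i [^]\<^bsub>ideals_set ?R\<^esub> e i))) \<and>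
     J = (\<Otimes>\<^bsub>ideals_set ?R\<^esub> i\<in>{..<r}. P i [^]\<^bsub>ideals_set ?R\<^esub> e i)"
    for J and r :: nat and P and e :: "nat \<Rightarrow> nat"
  have chi: "chi ?Q = (SOME J. \<exists>r P e. decomp J r P e)"
    by (simp add: chi_def decomp_def)
  have "\<exists>J r P e. decomp J r P e"
  proof -
    obtain r p e ix where "prime_power_split n d r p e ix"
      using prime_power_split_exists[of n d] d by blast
    then have s1: "\<And>j. j < r \<Longrightarrow> ix j < n \<and> irreducible (p j) \<and> 0 < e j"
      and s2: "\<And>y. (\<forall>i<n. d i dvd y i) \<longleftrightarrow> (\<forall>j<r. p j ^ e j dvd y (ix j))"
      and s3: "\<And>b. \<exists>y. \<forall>j<r. p j ^ e j dvd y (ix j) - b j"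
      by (simp_all add: prime_power_split_def)
    have "residue_system n (poly_points n L0) r (\<lambda>j. p j ^ e j) (\<lambda>j v. (U *\<^sub>v v) $ ix j)"
    proof (rule residue_system_coordinates[OF U W UW])
      show "v \<in> poly_points n L0 \<longleftrightarrow> (\<forall>j<r. p j ^ e j dvd (U *\<^sub>v v) $ ix j)"
        if "v \<in> carrier_vec n" for v
        using mem[OF that] s2[of "\<lambda>i. (U *\<^sub>v v) $ i"] that by simp
    qed (use s1 s3 in auto)
    then have iso: "module_isomorphic ?R ?Q (fin_direct_sum {..<r} (\<lambda>j. residue_module (p j ^ e j)))"
      by (rule isomorphism_of_residue_system[OF L0])
    have "{x. p j dvd x} \<noteq> {0}" if "j < r" for j
    proof -
      have "p j \<noteq> 0" using s1[OF that] by (auto simp: irreducible_def)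
      moreover have "p j \<in> {x. p j dvd x}" by simp
      ultimately show ?thesis by blast
    qed
    then have "\<forall>j<r. primeideal {x. p j dvd x} ?R \<and> {x. p j dvd x} \<noteq> {0} \<and> 0 < e j"
      using s1 primeideal_multiples by blast
    then have "decomp (\<Otimes>\<^bsub>ideals_set ?R\<^esub> i\<in>{..<r}. {x. p i dvd x} [^]\<^bsub>ideals_set ?R\<^esub> e i)
        r (\<lambda>j. {x. p j dvd x}) e"
      unfolding decomp_def using iso
      by (simp add: ideals_set_pow_multiples)
    then show ?thesis by blast
  qed
  then have "\<exists>r P e. decomp (chi ?Q) r P e" unfolding chi by (rule someI_ex)
  then obtain r P e where dec: "decomp (chi ?Q) r P e" by blast
  have "\<exists>p. P j = {x. p dvd x} \<and> p \<noteq> 0" if "j < r" for j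
  proof -
    have "primeideal (P j) ?R" "P j \<noteq> {0}" using dec that by (auto simp: decomp_def)
    then have "ideal (P j) ?R" by (simp add: primeideal_def)
    then obtain p where "P j = {x. p dvd x}" by (rule poly_ideal_eq_multiples)
    with \<open>P j \<noteq> {0}\<close> show ?thesis by (intro exI[of _ p]) auto
  qed
  then obtain p where p: "\<And>j. j < r \<Longrightarrow> P j = {x. p j dvd x}" "\<And>j. j < r \<Longrightarrow> p j \<noteq> 0" by metis
  have P: "P j [^]\<^bsub>ideals_set ?R\<^esub> e j = {x. p j ^ e j dvd x}" if "j < r" for j
    unfolding p(1)[OF that] by (rule ideals_set_pow_multiples)
  have "fin_direct_sum {..<r} (\<lambda>i. quot_module (poly_module (*)) (P i [^]\<^bsub>ideals_set ?R\<^esub> e i))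
      = fin_direct_sum {..<r} (\<lambda>i. residue_module (p i ^ e i))"
    by (rule fin_direct_sum_cong) (simp add: P)
  then have "module_isomorphic ?R ?Q (fin_direct_sum {..<r} (\<lambda>i. residue_module (p i ^ e i)))"
    using dec by (simp add: decomp_def)
  then obtain g where "residue_system n (poly_points n L0) r (\<lambda>i. p i ^ e i) g"
    by (rule residue_system_of_isomorphism[OF L0])
  then have "has_codim n (poly_points n L0) (\<Sum>i<r. degree (p i ^ e i))"
    using p(2) by (intro has_codim_residues) auto
  moreover have "residue_system n (poly_points n L0) n d (\<lambda>i v. (U *\<^sub>v v) $ i)"
  proof (rule residue_system_coordinates[OF U W UW])
    show "\<exists>y. \<forall>j<n. d j dvd y j - b j" for b by (intro exI[of _ b]) simp
    show "v \<in> poly_points n L0 \<longleftrightarrow> (\<forall>j<n. d j dvd (U *\<^sub>v v) $ j)" if "v \<in> carrier_vec n" for v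
      using mem[OF that] that by auto
  qed
  then have "has_codim n (poly_points n L0) (\<Sum>i<n. degree (d i))"
    using d by (intro has_codim_residues) auto
  ultimately have deg: "(\<Sum>i<r. degree (p i ^ e i)) = (\<Sum>i<n. degree (d i))"
    by (rule has_codim_unique)
  have comm: "comm_monoid (ideals_set ?R)"
    by (rule cring.ideals_set_is_comm_monoid) unfold_locales
  have "chi ?Q = (\<Otimes>\<^bsub>ideals_set ?R\<^esub> i\<in>{..<r}. P i [^]\<^bsub>ideals_set ?R\<^esub> e i)"
    using dec by (simp add: decomp_def)
  also have "\<dots> = (\<Otimes>\<^bsub>ideals_set ?R\<^esub> i\<in>{..<r}. {x. p i ^ e i dvd x})"
    by (rule comm_monoid.finprod_cong'[OF comm refl]) (simp_all add: P ideals_set_simps ideal_multiples)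
  also have "\<dots> = {x. (\<Prod>i<r. p i ^ e i) dvd x}" by (rule ideals_set_prod_multiples) simp
  finally have "chi ?Q = {x. (\<Prod>i<r. p i ^ e i) dvd x}" .
  moreover have "(\<Prod>i<r. p i ^ e i) \<noteq> 0" using p(2) by simp
  moreover have "degree (\<Prod>i<r. p i ^ e i) = (\<Sum>i<n. degree (d i))"
    unfolding deg[symmetric] by (intro degree_prod_eq_sum_degree) (use p(2) in auto)
  ultimately show thesis by (intro that)
qed

section \<open>Norms of ideals and the covolume\<close>

text \<open>The polynomials of degree less than \<open>deg a\<close> represent each residue class modulo \<open>a\<close> exactly once, and
  their coefficient vectors give a linear isomorphism with \<open>k\<^sup>N\<close> for \<open>N = deg a\<close>.\<close>
lemma ideal_norm_multiples:
  fixes a :: "'k::field poly"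
  assumes a: "a \<noteq> 0"
  shows "ideal_norm q {x. a dvd x} = q ^ degree a"
proof -
  define N where "N = degree a"
  let ?M = "poly_module Polynomial.smult :: ('k, 'k poly) module"
  let ?W = "quot_module ?M {x. a dvd x}" and ?V = "module_vec TYPE('k) N"
  define h where "h v = (\<Sum>i<N. monom (v $ i) i)" for v :: "'k vec"
  define T where "T v = {x. a dvd x} +>\<^bsub>?M\<^esub> h v" for v
  note sub = submodule_multiples_smult[of a]
  have W: "vectorspace class_ring ?W"
    using module.quot_module_is_module[OF module_poly_smult sub] class_field
    by (simp add: vectorspace_def)
  have V: "vectorspace class_ring ?V" by (rule vec_vs)
  have coset_eq: "{x. a dvd x} +>\<^bsub>?M\<^esub> x = {x. a dvd x} +>\<^bsub>?M\<^esub> y \<longleftrightarrow> a dvd x - y" for x y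
  proof -
    have "{x. a dvd x} +>\<^bsub>?M\<^esub> x = {x. a dvd x} +>\<^bsub>?M\<^esub> y \<longleftrightarrow> (\<exists>h. a dvd h \<and> x = h + y)"
      using module.coset_eq_iff[OF module_poly_smult sub, of x y] by (simp add: poly_module_simps)
    also have "\<dots> \<longleftrightarrow> a dvd x - y" by (metis add_diff_cancel_right' diff_add_cancel)
    finally show ?thesis .
  qed
  have h_coeff: "coeff (h v) i = (if i < N then v $ i else 0)" for v i
    by (simp add: h_def coeff_sum)
  have "T \<in> LinearCombinations.module_hom class_ring ?V ?W"
    unfolding LinearCombinations.module_hom_def
  proof (intro CollectI conjI allI impI)
    show "T \<in> carrier ?V \<rightarrow> carrier ?W"
      using module.carrier_quot_module[OF module_poly_smult, of "{x. a dvd x}"]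
      by (auto simp: T_def poly_module_simps)
  next
    fix v w assume "v \<in> carrier ?V \<and> w \<in> carrier ?V"
    then have "h (v + w) = h v + h w"
      by (intro poly_eqI) (auto simp: h_coeff module_vec_simps)
    then show "T (v \<oplus>\<^bsub>?V\<^esub> w) = T v \<oplus>\<^bsub>?W\<^esub> T w"
      using module.add_quot_module[OF module_poly_smult sub, of "h v" "h w"]
      by (simp add: T_def poly_module_simps module_vec_simps)
  next
    fix c v assume "c \<in> carrier (class_ring :: 'k ring) \<and> v \<in> carrier ?V"
    then have "h (c \<cdot>\<^sub>v v) = Polynomial.smult c (h v)"
      by (intro poly_eqI) (auto simp: h_coeff module_vec_simps)
    then show "T (c \<odot>\<^bsub>?V\<^esub> v) = c \<odot>\<^bsub>?W\<^esub> T v"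
      using module.smult_quot_module[OF module_poly_smult sub, of "h v" c]
      by (simp add: T_def poly_module_simps module_vec_simps)
  qed
  then have lin: "linear_map class_ring ?V ?W T"
    using V W by (simp add: linear_map_def mod_hom_def mod_hom_axioms_def vectorspace_def)
  have inj: "inj_on T (carrier ?V)"
  proof (rule inj_onI)
    fix v w assume vw: "v \<in> carrier ?V" "w \<in> carrier ?V" "T v = T w"
    then have "a dvd h v - h w" by (simp add: T_def coset_eq)
    moreover have "h v - h w = 0 \<or> degree (h v - h w) < degree a"
    proof (cases "N = 0")
      case False
      have "degree (h v - h w) \<le> N - 1" by (intro degree_le) (auto simp: h_coeff)
      with False show ?thesis unfolding N_def by linarith
    qed (simp add: h_def)
    ultimately have "h v - h w = 0" using dvd_imp_degree_le[of a "h v - h w"] by (meson not_less)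
    then have "v $ i = w $ i" if "i < N" for i using that h_coeff by (metis eq_iff_diff_eq_0)
    then show "v = w" using vw by (intro eq_vecI) (auto simp: module_vec_simps)
  qed
  have surj: "T ` carrier ?V = carrier ?W"
  proof
    show "T ` carrier ?V \<subseteq> carrier ?W"
      using module.carrier_quot_module[OF module_poly_smult, of "{x. a dvd x}"]
      by (auto simp: T_def poly_module_simps)
    show "carrier ?W \<subseteq> T ` carrier ?V"
    proof
      fix X assume "X \<in> carrier ?W"
      then obtain x where x: "X = {x. a dvd x} +>\<^bsub>?M\<^esub> x"
        using module.carrier_quot_module[OF module_poly_smult, of "{x. a dvd x}"] by auto
      have "coeff (x mod a) i = 0" if "\<not> i < N" for i
        using degree_mod_less[OF a, of x] that unfolding N_def by (auto simp: coeff_eq_0)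
      then have "h (vec N (coeff (x mod a))) = x mod a"
        by (intro poly_eqI) (auto simp: h_coeff)
      then have "X = T (vec N (coeff (x mod a)))"
        unfolding x T_def coset_eq by (metis minus_mod_eq_mult_div dvd_triv_left)
      then show "X \<in> T ` carrier ?V" by (auto simp: module_vec_simps)
    qed
  qed
  have "vectorspace.dim class_ring ?V = vectorspace.dim class_ring ?W"
    by (rule linear_map.dim_eq[OF lin vec_space.fin_dim inj surj])
  then show ?thesis by (simp add: ideal_norm_def vec_space.dim_is_n N_def)
qed

text \<open>Whichever denominator \<open>c\<close> the definition of the norm picks, the integral ideal has the generator
  \<open>m = c a / b\<close>, and \<open>deg m - deg c\<close> does not depend on \<open>c\<close>.\<close>
lemma frac_ideal_norm_multiples:
  fixes a b :: "'k::field poly"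
  assumes q: "1 < q" and a: "a \<noteq> 0" and b: "b \<noteq> 0"
  shows "frac_ideal_norm q ((\<lambda>p. inverse (to_fract b) * to_fract p) ` {x. a dvd x})
    = q ^ degree a / q ^ degree b"
proof -
  define J where "J = (\<lambda>p. inverse (to_fract b) * to_fract p) ` {x. a dvd x}"
  define c where "c = (SOME c. c \<noteq> 0 \<and> (\<lambda>x. to_fract c * x) ` J \<subseteq> range to_fract)"
  have "b \<noteq> 0 \<and> (\<lambda>x. to_fract b * x) ` J \<subseteq> range to_fract"
    using b by (auto simp: J_def simp flip: mult.assoc)
  then have c: "c \<noteq> 0" "(\<lambda>x. to_fract c * x) ` J \<subseteq> range to_fract"
    unfolding c_def by (metis (mono_tags, lifting) someI_ex)+
  have "inverse (to_fract b) * to_fract a \<in> J" by (auto simp: J_def)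
  then have "to_fract c * (inverse (to_fract b) * to_fract a) \<in> range to_fract" using c(2) by blast
  then obtain m where m: "to_fract m = to_fract c * (inverse (to_fract b) * to_fract a)" by auto
  have "m \<noteq> 0" using m a b c(1) by (metis inverse_nonzero_iff_nonzero mult_eq_0_iff to_fract_eq_0_iff)
  have "to_fract (m * b) = to_fract (c * a)" using b by (simp add: m)
  then have "m * b = c * a" by (simp only: to_fract_eq_iff)
  then have deg: "degree m + degree b = degree c + degree a"
    using \<open>m \<noteq> 0\<close> a b c(1) degree_mult_eq by metis
  have "{y. \<exists>x\<in>J. to_fract y = to_fract c * x} = {y. m dvd y}"
  proof -
    have "(\<exists>x\<in>J. to_fract y = to_fract c * x) \<longleftrightarrow> m dvd y" for y
    proof
      assume "\<exists>x\<in>J. to_fract y = to_fract c * x"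
      then obtain p where p: "a dvd p" "to_fract y = to_fract c * (inverse (to_fract b) * to_fract p)"
        by (auto simp: J_def)
      from p(1) obtain k where "p = a * k" by (rule dvdE)
      with p(2) have "to_fract y = to_fract c * (inverse (to_fract b) * to_fract (a * k))" by simp
      then have "to_fract y = to_fract (m * k)" by (simp add: m)
      then show "m dvd y" by (simp only: to_fract_eq_iff dvd_triv_left)
    next
      assume "m dvd y"
      then obtain k where "y = m * k" by (auto simp: dvd_def)
      then have "to_fract y = to_fract c * (inverse (to_fract b) * to_fract (a * k))" by (simp add: m)
      moreover have "inverse (to_fract b) * to_fract (a * k) \<in> J"
        unfolding J_def by (rule imageI) simp
      ultimately show "\<exists>x\<in>J. to_fract y = to_fract c * x" by blast
    qed
    then show ?thesis by blast
  qed
  moreover have "range (\<lambda>x. c * x) = {y. c dvd y}" by (auto simp: dvd_def)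
  ultimately have "frac_ideal_norm q J = q ^ degree m / q ^ degree c"
    unfolding frac_ideal_norm_def Let_def c_def[symmetric]
    by (simp add: ideal_norm_multiples \<open>m \<noteq> 0\<close> c(1))
  also have "\<dots> = q ^ degree a / q ^ degree b"
  proof -
    have "q ^ degree m * q ^ degree b = q ^ degree c * q ^ degree a"
      using deg by (simp flip: power_add)
    then show ?thesis using q by (simp add: field_simps)
  qed
  finally show ?thesis by (simp add: J_def)
qed

lemma submodule_of_range:
  assumes A: "A \<in> carrier_mat n n"
  shows "LinearCombinations.submodule class_ring
    {map_vec to_fract (A *\<^sub>v y) | y. y \<in> carrier_vec n} (std_module n)"
    (is "LinearCombinations.submodule _ ?L _")
proof (rule LinearCombinations.submodule.intro[OF module_std])
  show "?L \<subseteq> carrier (std_module n)" using A by (auto simp: std_lattice_eq)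
  have "map_vec to_fract (A *\<^sub>v 0\<^sub>v n) = 0\<^sub>v n" using A by (intro eq_vecI) (auto simp: scalar_prod_def)
  then show "\<zero>\<^bsub>std_module n\<^esub> \<in> ?L"
    by (intro CollectI exI[of _ "0\<^sub>v n"]) (simp add: Kn_module_def)
next
  fix v w assume "v \<in> ?L" "w \<in> ?L"
  then obtain y z where *: "v = map_vec to_fract (A *\<^sub>v y)" "w = map_vec to_fract (A *\<^sub>v z)"
    "y \<in> carrier_vec n" "z \<in> carrier_vec n" by auto
  then have "v + w = map_vec to_fract (A *\<^sub>v (y + z))"
    using A by (simp add: mult_add_distrib_mat_vec[of _ n n] map_vec_to_fract_add[of _ n])
  then show "v \<oplus>\<^bsub>std_module n\<^esub> w \<in> ?L"
    using * by (auto simp: std_module_simps intro!: exI[of _ "y + z"])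
next
  fix c v assume "v \<in> ?L"
  then obtain y where *: "v = map_vec to_fract (A *\<^sub>v y)" "y \<in> carrier_vec n" by auto
  then have "to_fract c \<cdot>\<^sub>v v = map_vec to_fract (A *\<^sub>v (c \<cdot>\<^sub>v y))"
    using A by (simp add: mult_mat_vec_smult[of _ n n] map_vec_to_fract_smult)
  then show "c \<odot>\<^bsub>std_module n\<^esub> v \<in> ?L"
    using * by (auto simp: std_module_simps intro!: exI[of _ "c \<cdot>\<^sub>v y"])
qed

lemma common_denominator:
  fixes S :: "'k::field poly fract set"
  assumes "finite S"
  shows "\<exists>b. b \<noteq> 0 \<and> (\<forall>x\<in>S. to_fract b * x \<in> range to_fract)"
  using assms
proof (induction S rule: finite_induct)
  case empty
  show ?case by (intro exI[of _ 1]) simp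
next
  case (insert x S)
  then obtain b where b: "b \<noteq> 0" "\<And>y. y \<in> S \<Longrightarrow> to_fract b * y \<in> range to_fract" by blast
  obtain f g where fg: "g \<noteq> 0" "x = to_fract f / to_fract g"
    by (cases x) (auto simp: Fract_conv_to_fract)
  have "to_fract (g * b) * x = to_fract (b * f)" using fg by simp
  moreover have "to_fract (g * b) * y \<in> range to_fract" if y: "y \<in> S" for y
  proof -
    obtain p where "to_fract b * y = to_fract p" using b(2)[OF y] by auto
    then have "to_fract (g * b) * y = to_fract (g * p)" by (simp add: mult.assoc)
    then show ?thesis by blast
  qed
  ultimately show ?case using b(1) fg(1) by (intro exI[of _ "g * b"]) (metis insert_iff mult_eq_0_iff rangeI)
qed

lemma clear_denominators_mat:
  fixes M :: "'k::field poly fract mat"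
  assumes M: "M \<in> carrier_mat n m"
  obtains b A where "b \<noteq> 0" "A \<in> carrier_mat n m" "map_mat to_fract A = to_fract b \<cdot>\<^sub>m M"
proof -
  have "finite ((\<lambda>(i, j). M $$ (i, j)) ` ({..<n} \<times> {..<m}))" by simp
  then obtain b where b: "b \<noteq> 0"
    "\<forall>x\<in>(\<lambda>(i, j). M $$ (i, j)) ` ({..<n} \<times> {..<m}). to_fract b * x \<in> range to_fract"
    using common_denominator by blast
  then have "\<forall>i<n. \<forall>j<m. \<exists>p. to_fract b * M $$ (i, j) = to_fract p" by auto
  then obtain p where p: "\<And>i j. i < n \<Longrightarrow> j < m \<Longrightarrow> to_fract b * M $$ (i, j) = to_fract (p i j)"
    by metis
  have "map_mat to_fract (mat n m (\<lambda>(i, j). p i j)) = to_fract b \<cdot>\<^sub>m M"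
    using M p by (intro eq_matI) auto
  with b(1) show thesis by (intro that[of b "mat n m (\<lambda>(i, j). p i j)"]) auto
qed

interpretation to_fract_hom: comm_ring_hom "to_fract :: 'a::idom \<Rightarrow> 'a fract"
  by unfold_locales auto

lemma smult_mat_mult_vec:
  fixes A :: "'a::comm_ring_1 mat"
  assumes "A \<in> carrier_mat m n" "v \<in> carrier_vec n"
  shows "(c \<cdot>\<^sub>m A) *\<^sub>v v = c \<cdot>\<^sub>v (A *\<^sub>v v)"
  using assms by (intro eq_vecI) auto

definition lattice_of :: "nat \<Rightarrow> 'k::field poly fract mat \<Rightarrow> 'k poly fract vec set" where
  "lattice_of n B = {B *\<^sub>v map_vec to_fract y | y. y \<in> carrier_vec n}"

text \<open>For the denominator \<open>\<alpha>\<close> that the definition of \<open>chi\<close> of a lattice picks, \<open>A = \<alpha> B\<close> has entries in \<open>R\<close>, and \<open>chi\<close> of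
  \<open>R\<^sup>n / A R\<^sup>n\<close> has a generator of degree \<open>deg (det A)\<close>. Since \<open>det A = \<alpha>\<^sup>n det B\<close>, the factor \<open>\<alpha>\<^sup>-\<^sup>n\<close>
  in the definition restores \<open>|det B|\<close>.\<close>
theorem covol_lattice_of:
  fixes B :: "'k::field poly fract mat"
  assumes q: "1 < q" and B: "B \<in> carrier_mat n n" and det: "det B \<noteq> 0"
  shows "covol q n (lattice_of n B) = fract_abs q (det B)"
proof -
  let ?t = "map_vec to_fract :: 'k poly vec \<Rightarrow> _"
  define \<alpha> where "\<alpha> = (SOME \<alpha>. \<alpha> \<noteq> 0 \<and> (\<lambda>v. to_fract \<alpha> \<cdot>\<^sub>v v) ` lattice_of n B \<subseteq> std_lattice n)"
  have scaled: "to_fract c \<cdot>\<^sub>v (B *\<^sub>v ?t y) = ?t (A *\<^sub>v y)"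
    if "map_mat to_fract A = to_fract c \<cdot>\<^sub>m B" "A \<in> carrier_mat n n" "y \<in> carrier_vec n" for c A y
  proof -
    have "?t (A *\<^sub>v y) = map_mat to_fract A *\<^sub>v ?t y"
      using that by (intro to_fract_hom.mult_mat_vec_hom) auto
    then show ?thesis using that B by (simp add: smult_mat_mult_vec[of _ n n])
  qed
  obtain b A0 where "b \<noteq> 0" "A0 \<in> carrier_mat n n" "map_mat to_fract A0 = to_fract b \<cdot>\<^sub>m B"
    by (rule clear_denominators_mat[OF B])
  then have "b \<noteq> 0 \<and> (\<lambda>v. to_fract b \<cdot>\<^sub>v v) ` lattice_of n B \<subseteq> std_lattice n"
    using scaled by (auto simp: lattice_of_def std_lattice_eq)
  then have "\<alpha> \<noteq> 0 \<and> (\<lambda>v. to_fract \<alpha> \<cdot>\<^sub>v v) ` lattice_of n B \<subseteq> std_lattice n"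
    unfolding \<alpha>_def by (rule someI)
  then have \<alpha>: "\<alpha> \<noteq> 0" "\<And>v. v \<in> lattice_of n B \<Longrightarrow> to_fract \<alpha> \<cdot>\<^sub>v v \<in> std_lattice n" by auto
  have "\<exists>p. to_fract \<alpha> * B $$ (i, j) = to_fract p" if "i < n" "j < n" for i j
  proof -
    have "?t (unit_vec n j) = unit_vec n j" by (intro eq_vecI) (auto simp: unit_vec_def)
    then have "B *\<^sub>v unit_vec n j \<in> lattice_of n B"
      unfolding lattice_of_def by (metis (mono_tags, lifting) mem_Collect_eq unit_vec_carrier)
    then have "to_fract \<alpha> \<cdot>\<^sub>v col B j \<in> std_lattice n"
      using \<alpha>(2) that by (simp add: mult_unit_vec[OF B])
    then have "(to_fract \<alpha> \<cdot>\<^sub>v col B j) $ i \<in> range to_fract"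
      using that by (simp add: std_lattice_def)
    then show ?thesis using that B by auto
  qed
  then obtain p where p: "\<And>i j. i < n \<Longrightarrow> j < n \<Longrightarrow> to_fract \<alpha> * B $$ (i, j) = to_fract (p i j)"
    by metis
  define A where "A = mat n n (\<lambda>(i, j). p i j)"
  have A: "A \<in> carrier_mat n n" and AB: "map_mat to_fract A = to_fract \<alpha> \<cdot>\<^sub>m B"
    using B p by (auto simp: A_def intro!: eq_matI)
  define L0 where "L0 = (\<lambda>v. to_fract \<alpha> \<cdot>\<^sub>v v) ` lattice_of n B"
  have L0: "L0 = {?t (A *\<^sub>v y) | y. y \<in> carrier_vec n}"
    unfolding L0_def lattice_of_def using scaled[OF AB A] by (force simp: image_iff)
  have sub: "LinearCombinations.submodule class_ring L0 (std_module n)"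
    unfolding L0 by (rule submodule_of_range[OF A])
  have "to_fract (det A) = to_fract \<alpha> ^ n * det B"
    using B by (simp add: AB flip: to_fract_hom.hom_det)
  then have detA: "det A \<noteq> 0" "to_fract (det A) = to_fract \<alpha> ^ n * det B"
    using \<alpha>(1) det by (metis mult_eq_0_iff power_not_zero to_fract_eq_0_iff)+
  obtain U W d where U: "U \<in> carrier_mat n n" and W: "W \<in> carrier_mat n n" and UW: "U * W = 1\<^sub>m n"
    and mem: "\<And>v. v \<in> carrier_vec n \<Longrightarrow>
      (\<exists>y\<in>carrier_vec n. v = A *\<^sub>v y) \<longleftrightarrow> (\<forall>i<n. d i dvd (U *\<^sub>v v) $ i)"
    and d: "\<And>i. i < n \<Longrightarrow> d i \<noteq> 0" "(\<Sum>i<n. degree (d i)) = degree (det A)"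
    using range_normal_form[OF A detA(1)] by blast
  have mem0: "?t v \<in> L0 \<longleftrightarrow> (\<forall>i<n. d i dvd (U *\<^sub>v v) $ i)" if v: "v \<in> carrier_vec n" for v
  proof -
    have "?t v \<in> L0 \<longleftrightarrow> (\<exists>y\<in>carrier_vec n. ?t v = ?t (A *\<^sub>v y))" by (auto simp: L0)
    also have "\<dots> \<longleftrightarrow> (\<exists>y\<in>carrier_vec n. v = A *\<^sub>v y)"
      using v A by (intro bex_cong refl map_vec_to_fract_eq_iff[of _ n]) auto
    finally show ?thesis using mem[OF v] by simp
  qed
  obtain a where a: "a \<noteq> 0" "degree a = (\<Sum>i<n. degree (d i))"
    "chi (quot_module (std_module n) L0) = {x. a dvd x}"
    by (rule chi_of_normal_form[OF sub U W UW mem0 d(1)])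
  have "to_fract (\<alpha> ^ n) = to_fract \<alpha> ^ n" by (rule to_fract_hom.hom_power)
  then have "lattice_chi n (lattice_of n B) = (\<lambda>p. inverse (to_fract (\<alpha> ^ n)) * to_fract p) ` {x. a dvd x}"
    unfolding lattice_chi_def Let_def \<alpha>_def[symmetric] L0_def[symmetric] by (simp add: a(3))
  then have "covol q n (lattice_of n B) = q ^ degree (det A) / q ^ degree (\<alpha> ^ n)"
    unfolding covol_def using frac_ideal_norm_multiples[OF q a(1), of "\<alpha> ^ n"] \<alpha>(1) a(2) d(2) by simp
  also have "\<dots> = fract_abs q (to_fract (det A)) / fract_abs q (to_fract (\<alpha> ^ n))"
    using detA(1) \<alpha>(1) by (simp add: fract_abs_to_fract)
  also have "\<dots> = fract_abs q (det B)"
  proof -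
    have "fract_abs q (to_fract (\<alpha> ^ n)) \<noteq> 0"
      using \<alpha>(1) q by (simp add: fract_abs_to_fract del: to_fract_hom.hom_power)
    moreover have "to_fract (det A) = to_fract (\<alpha> ^ n) * det B"
      by (simp only: detA(2) to_fract_hom.hom_power)
    then have "fract_abs q (to_fract (det A)) = fract_abs q (to_fract (\<alpha> ^ n)) * fract_abs q (det B)"
      by (simp only: fract_abs_mult[OF q])
    ultimately show ?thesis by (simp only: nonzero_mult_div_cancel_left not_False_eq_True)
  qed
  finally show ?thesis .
qed

section \<open>Bases of lattices\<close>

text \<open>After clearing the denominators of a finite generating set, the normal form of the resulting
  submodule of \<open>R\<^sup>n\<close> exhibits the basis \<open>d\<^sub>i w\<^sub>i\<close>, with \<open>w\<^sub>i\<close> the columns of \<open>W\<close>. No \<open>d\<^sub>i\<close> vanishes, since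
  otherwise \<open>\<Lambda>\<close> would lie in the hyperplane where the \<open>i\<close>-th coordinate of \<open>U x\<close> is zero.\<close>
theorem lattice_has_basis:
  fixes \<Lambda> :: "'k::field poly fract vec set"
  assumes "is_lattice n \<Lambda>"
  obtains B where "B \<in> carrier_mat n n" "det B \<noteq> 0" "\<Lambda> = lattice_of n B"
proof -
  let ?t = "map_vec to_fract :: 'k poly vec \<Rightarrow> _"
  obtain S where S: "finite S" "S \<subseteq> \<Lambda>"
    "LinearCombinations.module.span (class_ring :: 'k poly ring) (Kn_module n) S = \<Lambda>"
    and sub: "LinearCombinations.submodule (class_ring :: 'k poly ring) \<Lambda> (Kn_module n)"
    and spanning: "LinearCombinations.module.span (class_ring :: 'k poly fract ring)
       (module_vec TYPE('k poly fract) n) \<Lambda> = carrier_vec n"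
    using assms unfolding is_lattice_def by blast
  have \<Lambda>: "\<Lambda> \<subseteq> carrier_vec n" "0\<^sub>v n \<in> \<Lambda>" "\<And>v w. v \<in> \<Lambda> \<Longrightarrow> w \<in> \<Lambda> \<Longrightarrow> v + w \<in> \<Lambda>"
    "\<And>c v. v \<in> \<Lambda> \<Longrightarrow> to_fract c \<cdot>\<^sub>v v \<in> \<Lambda>"
    using sub by (auto simp: LinearCombinations.submodule_def Kn_module_def)
  have "finite ((\<lambda>(s, i). s $ i) ` (S \<times> {..<n}))" using S by simp
  then obtain \<alpha> where \<alpha>: "\<alpha> \<noteq> 0"
    "\<forall>x\<in>(\<lambda>(s, i). s $ i) ` (S \<times> {..<n}). to_fract \<alpha> * x \<in> range to_fract"
    using common_denominator by blast
  define H where "H = {v \<in> carrier_vec n. to_fract \<alpha> \<cdot>\<^sub>v v \<in> std_lattice n}"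
  have "LinearCombinations.submodule (class_ring :: 'k poly ring) H (Kn_module n)"
  proof (rule LinearCombinations.submodule.intro[OF module_Kn])
    have std: "\<And>v w. v \<in> std_lattice n \<Longrightarrow> w \<in> std_lattice n \<Longrightarrow> v + w \<in> (std_lattice n :: 'k poly fract vec set)"
      "\<And>c v. v \<in> std_lattice n \<Longrightarrow> to_fract c \<cdot>\<^sub>v v \<in> (std_lattice n :: 'k poly fract vec set)"
      "0\<^sub>v n \<in> (std_lattice n :: 'k poly fract vec set)"
      using submodule_std[where ?'a = 'k] by (auto simp: LinearCombinations.submodule_def Kn_module_def)
    show "H \<subseteq> carrier (Kn_module n)" by (auto simp: H_def Kn_module_def)
    show "\<zero>\<^bsub>Kn_module n\<^esub> \<in> H" using std(2)[OF std(3), of \<alpha>] by (simp add: H_def Kn_module_def)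
    show "v \<oplus>\<^bsub>Kn_module n\<^esub> w \<in> H" if "v \<in> H" "w \<in> H" for v w
      using that std(1) by (simp add: H_def Kn_module_def smult_add_distrib_vec[of _ n])
    show "c \<odot>\<^bsub>Kn_module n\<^esub> v \<in> H" if "v \<in> H" for c v
      using that std(2)[of "to_fract \<alpha> \<cdot>\<^sub>v v" c]
      by (simp add: H_def Kn_module_def smult_smult_assoc mult.commute)
  qed
  moreover have "S \<subseteq> H"
  proof
    fix s assume s: "s \<in> S"
    then have sc: "s \<in> carrier_vec n" using S(2) \<Lambda>(1) by blast
    have "(to_fract \<alpha> \<cdot>\<^sub>v s) $ i \<in> range to_fract" if i: "i < n" for i
    proof -
      have "s $ i \<in> (\<lambda>(s, i). s $ i) ` (S \<times> {..<n})" using s i by (intro image_eqI[of _ _ "(s, i)"]) auto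
      then have "to_fract \<alpha> * s $ i \<in> range to_fract" using \<alpha>(2) by blast
      then show ?thesis using sc i by simp
    qed
    then show "s \<in> H" using sc by (simp add: H_def std_lattice_def)
  qed
  ultimately have "\<Lambda> \<subseteq> H" using module.span_is_subset[OF module_Kn] S(3) by metis
  then have \<alpha>\<Lambda>: "\<exists>v\<in>carrier_vec n. to_fract \<alpha> \<cdot>\<^sub>v x = ?t v" if "x \<in> \<Lambda>" for x
    using that by (auto simp: H_def std_lattice_eq)
  define L where "L = {v \<in> carrier_vec n. \<exists>x\<in>\<Lambda>. ?t v = to_fract \<alpha> \<cdot>\<^sub>v x}"
  have "vec_submodule n L"
    unfolding vec_submodule_def
  proof (intro conjI ballI allI)
    show "L \<subseteq> carrier_vec n" by (auto simp: L_def)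
    have "?t (0\<^sub>v n) = to_fract \<alpha> \<cdot>\<^sub>v 0\<^sub>v n" by (intro eq_vecI) auto
    then show "0\<^sub>v n \<in> L" using \<Lambda>(2) by (auto simp: L_def)
  next
    fix v w assume "v \<in> L" "w \<in> L"
    then obtain x y where *: "v \<in> carrier_vec n" "w \<in> carrier_vec n" "x \<in> \<Lambda>" "y \<in> \<Lambda>"
      "?t v = to_fract \<alpha> \<cdot>\<^sub>v x" "?t w = to_fract \<alpha> \<cdot>\<^sub>v y" by (auto simp: L_def)
    then have "?t (v + w) = to_fract \<alpha> \<cdot>\<^sub>v (x + y)"
      using \<Lambda>(1) by (simp add: map_vec_to_fract_add[of _ n] smult_add_distrib_vec[of _ n] subset_eq)
    with * \<Lambda>(3) show "v + w \<in> L" by (auto simp: L_def)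
  next
    fix c v assume "v \<in> L"
    then obtain x where *: "v \<in> carrier_vec n" "x \<in> \<Lambda>" "?t v = to_fract \<alpha> \<cdot>\<^sub>v x" by (auto simp: L_def)
    then have "?t (c \<cdot>\<^sub>v v) = to_fract \<alpha> \<cdot>\<^sub>v (to_fract c \<cdot>\<^sub>v x)"
      by (simp add: map_vec_to_fract_smult smult_smult_assoc mult.commute)
    with * \<Lambda>(4) show "c \<cdot>\<^sub>v v \<in> L" by (auto simp: L_def)
  qed
  then obtain U W d where U: "U \<in> carrier_mat n n" and W: "W \<in> carrier_mat n n"
    and UW: "U * W = 1\<^sub>m n" "W * U = 1\<^sub>m n"
    and mem: "\<And>v. v \<in> carrier_vec n \<Longrightarrow> v \<in> L \<longleftrightarrow> (\<forall>i<n. d i dvd (U *\<^sub>v v) $ i)"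
    by (rule submodule_normal_form) blast
  define UK where "UK = map_mat to_fract U"
  have UK: "UK \<in> carrier_mat n n" using U by (simp add: UK_def)
  have UKt: "UK *\<^sub>v ?t v = ?t (U *\<^sub>v v)" if "v \<in> carrier_vec n" for v
    unfolding UK_def using U that by (simp add: to_fract_hom.mult_mat_vec_hom[of _ n n])
  have d: "d i \<noteq> 0" if i: "i < n" for i
  proof
    assume di: "d i = 0"
    define H where "H = {x \<in> carrier_vec n. (UK *\<^sub>v x) $ i = 0}"
    have "\<Lambda> \<subseteq> H"
    proof
      fix x assume x: "x \<in> \<Lambda>"
      then have xc: "x \<in> carrier_vec n" using \<Lambda>(1) by auto
      obtain v where v: "v \<in> carrier_vec n" "to_fract \<alpha> \<cdot>\<^sub>v x = ?t v" using \<alpha>\<Lambda>[OF x] by blast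
      have "v \<in> L" unfolding L_def using x v(1) v(2)[symmetric] by blast
      then have "(U *\<^sub>v v) $ i = 0" using mem[OF v(1)] i di by auto
      then have "(UK *\<^sub>v ?t v) $ i = 0" using UKt[OF v(1)] i U v(1) by simp
      then have "to_fract \<alpha> * (UK *\<^sub>v x) $ i = 0"
        unfolding v(2)[symmetric] using i UK xc by (simp add: mult_mat_vec_smult[of _ n n])
      then show "x \<in> H" using \<alpha>(1) xc by (simp add: H_def)
    qed
    moreover have "LinearCombinations.submodule class_ring H (module_vec TYPE('k poly fract) n)"
    proof (rule LinearCombinations.submodule.intro[OF vec_module])
      show "\<zero>\<^bsub>module_vec TYPE('k poly fract) n\<^esub> \<in> H"
        using UK i by (simp add: H_def module_vec_simps scalar_prod_def)
    qed (use UK i in \<open>auto simp: H_def module_vec_simps scalar_prod_add_distrib[of _ n]\<close>)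
    ultimately have all: "carrier_vec n \<subseteq> H"
      using module.span_is_subset[OF vec_module] spanning by metis
    have "?t (W *\<^sub>v unit_vec n i) \<in> carrier_vec n" using W by simp
    from subsetD[OF all this] have "(UK *\<^sub>v ?t (W *\<^sub>v unit_vec n i)) $ i = 0"
      unfolding H_def by blast
    moreover have "UK *\<^sub>v ?t (W *\<^sub>v unit_vec n i) = ?t (unit_vec n i)"
      using UKt[of "W *\<^sub>v unit_vec n i"] U W UW
      by (simp flip: assoc_mult_mat_vec[of U n n W n])
    ultimately show False using i by simp
  qed
  define D where "D = mat n n (\<lambda>(i, j). if i = j then d i else 0)"
  have D: "D \<in> carrier_mat n n" by (simp add: D_def)
  define B where "B = inverse (to_fract \<alpha>) \<cdot>\<^sub>m map_mat to_fract (W * D)"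
  have WD: "W * D \<in> carrier_mat n n" using W D by simp
  then have B: "B \<in> carrier_mat n n" by (simp add: B_def)
  have "det U * det W = 1" using U W UW(1) det_mult[of U n W] by simp
  then have "det W \<noteq> 0" by auto
  moreover have "det D \<noteq> 0" unfolding D_def det_diagonal using d by simp
  ultimately have "det (W * D) \<noteq> 0" using W D by (simp add: det_mult[of _ n])
  then have detB: "det B \<noteq> 0" using \<alpha>(1) by (simp add: B_def)
  have By: "to_fract \<alpha> \<cdot>\<^sub>v (B *\<^sub>v ?t y) = ?t (W *\<^sub>v (D *\<^sub>v y))" if y: "y \<in> carrier_vec n" for y
  proof -
    have "B *\<^sub>v ?t y = inverse (to_fract \<alpha>) \<cdot>\<^sub>v (map_mat to_fract (W * D) *\<^sub>v ?t y)"
      unfolding B_def using WD y by (intro smult_mat_mult_vec[of _ n n]) auto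
    also have "map_mat to_fract (W * D) *\<^sub>v ?t y = ?t ((W * D) *\<^sub>v y)"
      using WD y by (intro to_fract_hom.mult_mat_vec_hom[symmetric]) auto
    also have "(W * D) *\<^sub>v y = W *\<^sub>v (D *\<^sub>v y)"
      using W D y by (intro assoc_mult_mat_vec[of _ n n _ n]) auto
    finally show ?thesis using \<alpha>(1) by (simp add: smult_smult_assoc)
  qed
  have "x \<in> \<Lambda> \<longleftrightarrow> (\<exists>y\<in>carrier_vec n. x = B *\<^sub>v ?t y)" for x
  proof
    assume x: "x \<in> \<Lambda>"
    obtain v where v: "v \<in> carrier_vec n" "to_fract \<alpha> \<cdot>\<^sub>v x = ?t v" using \<alpha>\<Lambda>[OF x] by blast
    have "v \<in> L" unfolding L_def using x v(1) v(2)[symmetric] by blast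
    define y where "y = vec n (\<lambda>i. (U *\<^sub>v v) $ i div d i)"
    have "D *\<^sub>v y = U *\<^sub>v v"
      unfolding D_def using mem[OF v(1)] \<open>v \<in> L\<close> U
      by (subst mult_vec_diagonal) (auto simp: y_def intro!: eq_vecI)
    then have "W *\<^sub>v (D *\<^sub>v y) = v"
      using U W UW v(1) by (simp flip: assoc_mult_mat_vec[of W n n U n])
    then have "to_fract \<alpha> \<cdot>\<^sub>v (B *\<^sub>v ?t y) = to_fract \<alpha> \<cdot>\<^sub>v x"
      using By[of y] v(2) by (simp add: y_def)
    then have "inverse (to_fract \<alpha>) \<cdot>\<^sub>v (to_fract \<alpha> \<cdot>\<^sub>v (B *\<^sub>v ?t y))
        = inverse (to_fract \<alpha>) \<cdot>\<^sub>v (to_fract \<alpha> \<cdot>\<^sub>v x)" by simp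
    then have "B *\<^sub>v ?t y = x" using \<alpha>(1) by (simp add: smult_smult_assoc)
    then show "\<exists>y\<in>carrier_vec n. x = B *\<^sub>v ?t y" by (intro bexI[of _ y]) (auto simp: y_def)
  next
    assume "\<exists>y\<in>carrier_vec n. x = B *\<^sub>v ?t y"
    then obtain y where y: "y \<in> carrier_vec n" "x = B *\<^sub>v ?t y" by blast
    let ?v = "W *\<^sub>v (D *\<^sub>v y)"
    have Dy: "D *\<^sub>v y = vec n (\<lambda>i. d i * y $ i)" unfolding D_def by (rule mult_vec_diagonal[OF y(1)])
    have "U *\<^sub>v ?v = D *\<^sub>v y"
      using U W D UW y(1) by (simp add: Dy flip: assoc_mult_mat_vec[of U n n W n])
    then have "?v \<in> L" using mem[of ?v] W Dy by auto
    then obtain x' where x': "x' \<in> \<Lambda>" "?t ?v = to_fract \<alpha> \<cdot>\<^sub>v x'" by (auto simp: L_def)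
    then have "inverse (to_fract \<alpha>) \<cdot>\<^sub>v (to_fract \<alpha> \<cdot>\<^sub>v x)
        = inverse (to_fract \<alpha>) \<cdot>\<^sub>v (to_fract \<alpha> \<cdot>\<^sub>v x')" using By[OF y(1)] y(2) by simp
    then have "x = x'" using \<alpha>(1) by (simp add: smult_smult_assoc)
    with x' show "x \<in> \<Lambda>" by simp
  qed
  then have "\<Lambda> = lattice_of n B" by (auto simp: lattice_of_def)
  with B detB show thesis by (rule that)
qed

section \<open>The linear constant\<close>

text \<open>Multiplying the \<open>i\<close>-th row of \<open>N\<close> by \<open>t\<close> to the power \<open>- e i\<close> reduces to the bounds \<open>1\<close>, and a common
  denominator \<open>b\<close> turns the result into a matrix \<open>A\<close> over \<open>R\<close>. What is needed is then a nonzero vector of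
  \<open>A R\<^sup>n\<close> whose entries have degree at most \<open>deg b\<close>. The assumption becomes
  \<open>deg (det A) \<le> n deg b + n - 1\<close>, so the codimension of \<open>A R\<^sup>n\<close> is less than the dimension
  \<open>n (deg b + 1)\<close> of the space of vectors with such entries.\<close>
theorem minkowski_function_field:
  fixes N :: "'k::field poly fract mat"
  assumes q: "1 < q" and n: "1 \<le> n" and N: "N \<in> carrier_mat n n" and det: "det N \<noteq> 0"
    and le: "fract_abs q (det N) \<le> q ^ (n - 1) * (\<Prod>i<n. q powi e i)"
  obtains y where "y \<in> carrier_vec n" "y \<noteq> 0\<^sub>v n"
    "\<And>i. i < n \<Longrightarrow> fract_abs q ((N *\<^sub>v map_vec to_fract y) $ i) \<le> q powi e i"
proof -
  define t :: "'k poly fract" where "t = to_fract [:0, 1:]"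
  have t: "t \<noteq> 0" "fract_abs q t = q" by (simp_all add: t_def fract_abs_to_fract)
  define E where "E = mat n n (\<lambda>(i, j). if i = j then t powi (- e i) else 0)"
  have E: "E \<in> carrier_mat n n" by (simp add: E_def)
  have EN: "E * N \<in> carrier_mat n n" using E N by simp
  obtain b A where b: "b \<noteq> 0" and A: "A \<in> carrier_mat n n" and Ab: "map_mat to_fract A = to_fract b \<cdot>\<^sub>m (E * N)"
    by (rule clear_denominators_mat[OF EN])
  have dA: "to_fract (det A) = to_fract b ^ n * (det E * det N)"
    using E N by (simp add: Ab det_mult[of _ n] flip: to_fract_hom.hom_det)
  have detE: "det E = (\<Prod>i<n. t powi (- e i))" unfolding E_def by (rule det_diagonal)
  then have "det E \<noteq> 0" using t by simp
  with b det have "to_fract (det A) \<noteq> 0" unfolding dA by simp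
  then have detA: "det A \<noteq> 0" by simp
  have abs_detA: "fract_abs q (to_fract (det A))
      = fract_abs q (to_fract b) ^ n * ((\<Prod>i<n. q powi (- e i)) * fract_abs q (det N))"
    unfolding dA detE by (simp only: fract_abs_mult[OF q] fract_abs_power[OF q] fract_abs_prod[OF q]
        fract_abs_power_int[OF q] t(2))
  have "(\<Prod>i<n. q powi (- e i)) * fract_abs q (det N)
      \<le> (\<Prod>i<n. q powi (- e i)) * (q ^ (n - 1) * (\<Prod>i<n. q powi e i))"
    using le q by (intro mult_left_mono prod_nonneg) auto
  also have "\<dots> = q ^ (n - 1)"
  proof -
    have "(\<Prod>i<n. q powi (- e i)) * (\<Prod>i<n. q powi e i) = (\<Prod>i<n. q powi (- e i) * q powi e i)"
      by (simp add: prod.distrib)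
    also have "\<dots> = 1" using q by (intro prod.neutral) (simp add: power_int_minus)
    finally show ?thesis by (simp add: ac_simps)
  qed
  finally have "q ^ degree (det A) \<le> (q ^ degree b) ^ n * q ^ (n - 1)"
    using abs_detA detA b q by (simp add: fract_abs_to_fract mult_left_mono)
  then have "q ^ degree (det A) \<le> q ^ (degree b * n + (n - 1))"
    by (simp add: power_add power_mult)
  then have "degree (det A) \<le> degree b * n + (n - 1)" using q by simp
  then have lt: "degree (det A) < n * (degree b + 1)" using n by (simp add: algebra_simps)
  obtain w where w: "w \<in> {A *\<^sub>v y | y. y \<in> carrier_vec n}" "w \<in> carrier_vec n" "w \<noteq> 0\<^sub>v n"
    "\<And>i. i < n \<Longrightarrow> w $ i = 0 \<or> degree (w $ i) < degree b + 1"
    by (rule has_codim_short_vector[OF has_codim_range[OF A detA] lt]) blast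
  then obtain y where y: "y \<in> carrier_vec n" "w = A *\<^sub>v y" by blast
  have "A *\<^sub>v 0\<^sub>v n = 0\<^sub>v n" using A by (intro eq_vecI) (auto simp: scalar_prod_def)
  then have "y \<noteq> 0\<^sub>v n" using w(3) y(2) by auto
  moreover have "fract_abs q ((N *\<^sub>v map_vec to_fract y) $ i) \<le> q powi e i" if i: "i < n" for i
  proof -
    let ?z = "N *\<^sub>v map_vec to_fract y"
    have z: "?z \<in> carrier_vec n" using N y(1) by simp
    have "map_vec to_fract w = map_mat to_fract A *\<^sub>v map_vec to_fract y"
      unfolding y(2) using A y(1) by (intro to_fract_hom.mult_mat_vec_hom) auto
    also have "\<dots> = to_fract b \<cdot>\<^sub>v ((E * N) *\<^sub>v map_vec to_fract y)"
      unfolding Ab using EN y(1) by (intro smult_mat_mult_vec[of _ n n]) auto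
    also have "(E * N) *\<^sub>v map_vec to_fract y = E *\<^sub>v ?z"
      using E N y(1) by (intro assoc_mult_mat_vec[of _ n n _ n]) auto
    also have "E *\<^sub>v ?z = vec n (\<lambda>i. t powi (- e i) * ?z $ i)"
      unfolding E_def by (rule mult_vec_diagonal[OF z])
    finally have "to_fract (w $ i) = to_fract b * (t powi (- e i) * ?z $ i)"
      using i w(2) by (metis (no_types, lifting) carrier_vecD index_map_vec(1) index_smult_vec(1) dim_vec index_vec)
    then have "fract_abs q (to_fract (w $ i)) = q ^ degree b * (q powi (- e i) * fract_abs q (?z $ i))"
      using b by (simp add: fract_abs_mult[OF q] fract_abs_power_int[OF q] t(2) fract_abs_to_fract)
    moreover have "fract_abs q (to_fract (w $ i)) \<le> q ^ degree b"
    proof (cases "w $ i = 0")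
      case False
      with w(4)[OF i] q show ?thesis by (simp add: fract_abs_to_fract)
    qed (use q in \<open>simp add: fract_abs_def\<close>)
    ultimately have "q powi (- e i) * fract_abs q (?z $ i) \<le> 1"
      using q by (simp add: mult_le_cancel_left1)
    then show ?thesis using q by (simp add: power_int_minus field_simps)
  qed
  ultimately show thesis using that[OF y(1)] by blast
qed

lemma std_lattice_eq_lattice_of: "std_lattice n = lattice_of n (1\<^sub>m n)"
proof -
  have "1\<^sub>m n *\<^sub>v map_vec to_fract y = map_vec to_fract y" if "y \<in> carrier_vec n" for y :: "'a poly vec"
    using that by simp
  then show ?thesis by (force simp: std_lattice_eq lattice_of_def)
qed

lemma is_lattice_std: "is_lattice n (std_lattice n :: 'k::field poly fract vec set)"
proof -
  define S :: "'k poly fract vec set" where "S = unit_vec n ` {..<n}"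
  have unit: "unit_vec n i = map_vec to_fract (unit_vec n i)" for i
    by (intro eq_vecI) (auto simp: unit_vec_def)
  have S_std: "S \<subseteq> std_lattice n"
  proof
    fix x assume "x \<in> S"
    then obtain i where "x = map_vec to_fract (unit_vec n i)" using unit by (auto simp: S_def)
    then show "x \<in> std_lattice n" by (auto simp: std_lattice_eq)
  qed
  let ?span = "LinearCombinations.module.span (class_ring :: 'k poly ring) (Kn_module n) S"
  have Sc: "S \<subseteq> carrier (Kn_module n)" by (auto simp: S_def Kn_module_def)
  have sp: "LinearCombinations.submodule (class_ring :: 'k poly ring) ?span (Kn_module n)"
    by (rule module.span_is_submodule[OF module_Kn Sc])
  have S_span: "S \<subseteq> ?span" by (rule module.in_own_span[OF module_Kn Sc])
  have "map_vec to_fract y \<in> ?span" if y: "y \<in> carrier_vec n" for y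
  proof -
    have "vec n (\<lambda>i. if i < k then to_fract (y $ i) else 0) \<in> ?span" if "k \<le> n" for k
      using that
    proof (induction k)
      case 0
      have "vec n (\<lambda>i. if i < 0 then to_fract (y $ i) else 0) = 0\<^sub>v n" by auto
      then show ?case using sp by (simp add: LinearCombinations.submodule_def Kn_module_def)
    next
      case (Suc k)
      have "vec n (\<lambda>i. if i < Suc k then to_fract (y $ i) else 0)
          = vec n (\<lambda>i. if i < k then to_fract (y $ i) else 0) + to_fract (y $ k) \<cdot>\<^sub>v unit_vec n k"
        using Suc.prems by (intro eq_vecI) (auto simp: unit_vec_def less_Suc_eq)
      moreover have "unit_vec n k \<in> ?span" using S_span Suc.prems by (auto simp: S_def)
      ultimately show ?case using Suc sp by (simp add: LinearCombinations.submodule_def Kn_module_def)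
    qed
    from this[of n] have "vec n (\<lambda>i. if i < n then to_fract (y $ i) else 0) \<in> ?span" by simp
    moreover have "vec n (\<lambda>i. if i < n then to_fract (y $ i) else 0) = map_vec to_fract y"
      using y by (intro eq_vecI) auto
    ultimately show ?thesis by simp
  qed
  then have "?span = std_lattice n"
    using module.span_is_subset[OF module_Kn S_std submodule_std] by (auto simp: std_lattice_eq)
  moreover have "LinearCombinations.module.span (class_ring :: 'k poly fract ring)
       (module_vec TYPE('k poly fract) n) (std_lattice n) = carrier_vec n"
  proof
    have "std_lattice n \<subseteq> carrier (module_vec TYPE('k poly fract) n)"
      by (auto simp: std_lattice_def module_vec_simps)
    then show "LinearCombinations.module.span class_ring (module_vec TYPE('k poly fract) n) (std_lattice n)
        \<subseteq> carrier_vec n"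
      using module.span_is_subset2[OF vec_module, of "std_lattice n" n] by (simp add: module_vec_simps)
    have "set (unit_vecs n) \<subseteq> (std_lattice n :: 'k poly fract vec set)"
      using S_std by (auto simp: S_def unit_vecs_def)
    then show "carrier_vec n \<subseteq>
        LinearCombinations.module.span class_ring (module_vec TYPE('k poly fract) n) (std_lattice n)"
      using module.span_is_monotone[OF vec_module] vec_space.span_unit_vecs_is_carrier by metis
  qed
  ultimately show ?thesis
    unfolding is_lattice_def using submodule_std S_std by (auto simp: S_def intro!: exI[of _ S])
qed

lemma det_nonzero_if_invertible:
  fixes M :: "'a::field mat"
  assumes M: "M \<in> carrier_mat n n" and "invertible_mat M"
  shows "det M \<noteq> 0"
proof -
  obtain B where MB: "M * B = 1\<^sub>m (dim_row M)" and BM: "B * M = 1\<^sub>m (dim_row B)"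
    using assms(2) by (auto simp: invertible_mat_def inverts_mat_def)
  have "dim_col B = n" using arg_cong[OF MB, of dim_col] M by simp
  moreover have "dim_row B = n" using arg_cong[OF BM, of dim_col] M by simp
  ultimately have "B \<in> carrier_mat n n" by auto
  then have "det M * det B = 1" using MB M det_mult[OF M] by (metis carrier_matD(1) det_one)
  then show ?thesis by auto
qed

text \<open>In a basis \<open>B\<close> of \<open>\<Lambda>\<close> the hypothesis on \<open>M\<close> and \<open>\<Lambda>\<close> becomes a bound for \<open>|det (M B)|\<close>.\<close>
theorem admissible_constant_minkowski:
  assumes q: "1 < q" and n: "1 \<le> n"
  shows "admissible_constant TYPE('k::field) q n (q ^ (n - 1))"
  unfolding admissible_constant_def
proof (intro ballI allI impI)
  fix M :: "'k poly fract mat" and \<Lambda> :: "'k poly fract vec set" and \<epsilon> :: "nat \<Rightarrow> real"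
  assume M: "M \<in> carrier_mat n n" and inv: "invertible_mat M" and lat: "is_lattice n \<Lambda>"
    and \<epsilon>: "\<forall>i<n. \<epsilon> i \<in> qpowers q"
    and le: "fract_abs q (det M) * covol q n \<Lambda> \<le> q ^ (n - 1) * (\<Prod>i<n. \<epsilon> i)"
  have detM: "det M \<noteq> 0" by (rule det_nonzero_if_invertible[OF M inv])
  obtain B where B: "B \<in> carrier_mat n n" and detB: "det B \<noteq> 0" and \<Lambda>: "\<Lambda> = lattice_of n B"
    by (rule lattice_has_basis[OF lat])
  have "\<forall>i<n. \<exists>e. \<epsilon> i = q powi e" using \<epsilon> by (auto simp: qpowers_def)
  then obtain e where e: "\<And>i. i < n \<Longrightarrow> \<epsilon> i = q powi e i" by metis
  have MB: "M * B \<in> carrier_mat n n" using M B by simp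
  have detMB: "det (M * B) = det M * det B" by (rule det_mult[OF M B])
  have "fract_abs q (det (M * B)) \<le> q ^ (n - 1) * (\<Prod>i<n. q powi e i)"
    using le e by (simp add: \<Lambda> covol_lattice_of[OF q B detB] detMB fract_abs_mult[OF q])
  then obtain y where y: "y \<in> carrier_vec n" "y \<noteq> 0\<^sub>v n"
    "\<And>i. i < n \<Longrightarrow> fract_abs q (((M * B) *\<^sub>v map_vec to_fract y) $ i) \<le> q powi e i"
    using minkowski_function_field[OF q n MB] detM detB detMB by (metis mult_eq_0_iff)
  define x where "x = B *\<^sub>v map_vec to_fract y"
  have x: "x \<in> carrier_vec n" "x \<in> \<Lambda>" using B y(1) by (auto simp: x_def \<Lambda> lattice_of_def)
  let ?y = "map_vec to_fract y :: 'k poly fract vec"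
  have yc: "?y \<in> carrier_vec n" using y(1) by simp
  have "?y \<noteq> 0\<^sub>v n"
  proof
    have "0\<^sub>v n = map_vec to_fract (0\<^sub>v n :: 'k poly vec)" by (intro eq_vecI) auto
    moreover assume "?y = 0\<^sub>v n"
    ultimately show False using y map_vec_to_fract_eq_iff[of y n "0\<^sub>v n"] by simp
  qed
  then have "x \<noteq> 0\<^sub>v n"
    unfolding x_def using det_0_iff_vec_prod_zero_field[OF B] detB yc by blast
  moreover have "fract_abs q (\<Sum>j<n. M $$ (i, j) * x $ j) \<le> \<epsilon> i" if i: "i < n" for i
  proof -
    have "(M * B) *\<^sub>v map_vec to_fract y = M *\<^sub>v x"
      unfolding x_def using M B y(1) by (intro assoc_mult_mat_vec[of _ n n _ n]) auto
    moreover have "(M *\<^sub>v x) $ i = (\<Sum>j<n. M $$ (i, j) * x $ j)"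
      using M x(1) i by (simp add: scalar_prod_def lessThan_atLeast0)
    ultimately show ?thesis using y(3)[OF i] e[OF i] by simp
  qed
  ultimately show "\<exists>x\<in>\<Lambda>. x \<noteq> 0\<^sub>v n \<and> (\<forall>i<n. fract_abs q (\<Sum>j<n. M $$ (i, j) * x $ j) \<le> \<epsilon> i)"
    using x(2) by blast
qed

text \<open>For the identity matrix, the standard lattice and \<open>\<epsilon>\<^sub>i = 1/q\<close>, the volume condition holds as soon as
  \<open>m \<ge> n\<close>, while a nonzero polynomial has absolute value at least \<open>1\<close>.\<close>
theorem admissible_constant_upper_bound:
  assumes q: "1 < q" and adm: "admissible_constant TYPE('k::field) q n (q powi m)"
  shows "m \<le> int n - 1"
proof (rule ccontr)
  assume "\<not> m \<le> int n - 1"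
  then have m: "int n \<le> m" by simp
  let ?I = "1\<^sub>m n :: 'k poly fract mat"
  have "invertible_mat ?I" unfolding invertible_mat_def inverts_mat_def
    by (intro conjI exI[of _ ?I]) auto
  moreover have one: "fract_abs q (1 :: 'k poly fract) = 1"
    using fract_abs_to_fract[of "1 :: 'k poly" q] by simp
  have "covol q n (std_lattice n :: 'k poly fract vec set) = 1"
    unfolding std_lattice_eq_lattice_of using covol_lattice_of[OF q, of ?I n] one by simp
  moreover have "1 \<le> q powi m * (\<Prod>i<n. q powi (- 1))"
  proof -
    have "q powi m * (\<Prod>i<n. q powi (- 1)) = q powi (m - int n)"
      using q by (simp add: power_int_diff power_int_minus field_simps)
    also have "\<dots> \<ge> 1" using m q by (intro one_le_power_int) auto
    finally show ?thesis .
  qed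
  moreover have "q powi (- 1) \<in> qpowers q" by (simp only: qpowers_def rangeI)
  ultimately obtain x where x: "x \<in> (std_lattice n :: 'k poly fract vec set)" "x \<noteq> 0\<^sub>v n"
    "\<And>i. i < n \<Longrightarrow> fract_abs q (\<Sum>j<n. ?I $$ (i, j) * x $ j) \<le> q powi (- 1)"
    using adm[unfolded admissible_constant_def, rule_format, of ?I "std_lattice n" "\<lambda>_. q powi (- 1)"]
      is_lattice_std one by auto
  obtain v where v: "v \<in> carrier_vec n" "x = map_vec to_fract v" using x(1) by (auto simp: std_lattice_eq)
  have "v $ i = 0" if i: "i < n" for i
  proof (rule ccontr)
    assume nz: "v $ i \<noteq> 0"
    have "(\<Sum>j<n. ?I $$ (i, j) * x $ j) = (\<Sum>j<n. if j = i then x $ j else 0)"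
      using i by (intro sum.cong) auto
    also have "\<dots> = to_fract (v $ i)" using i v by simp
    finally have "q ^ degree (v $ i) \<le> inverse q"
      using x(3)[OF i] nz by (simp add: fract_abs_to_fract power_int_minus)
    moreover have "inverse q < 1" using q by (simp add: field_simps)
    moreover have "1 \<le> q ^ degree (v $ i)" using q by simp
    ultimately show False by linarith
  qed
  then have "x = 0\<^sub>v n" using v by (intro eq_vecI) auto
  with x(2) show False by simp
qed

theorem corollary4p4:
  fixes q :: real and n :: nat
  assumes "1 < q" and "1 \<le> n"
  shows "log_linear_constant TYPE('k::field) q n = real n - 1"
proof -
  let ?C = "{C \<in> qpowers q. admissible_constant TYPE('k) q n C}"
  have pow: "q powi (int n - 1) = q ^ (n - 1)"
    using assms(2) by (simp add: power_int_def nat_diff_distrib)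
  have "Sup ?C = q ^ (n - 1)"
  proof (rule cSup_eq_maximum)
    have "q ^ (n - 1) \<in> qpowers q" unfolding qpowers_def pow[symmetric] by (rule rangeI)
    then show "q ^ (n - 1) \<in> ?C" using admissible_constant_minkowski[OF assms] by simp
    fix C assume "C \<in> ?C"
    then obtain m where m: "C = q powi m" "admissible_constant TYPE('k) q n (q powi m)"
      by (auto simp: qpowers_def)
    then have "m \<le> int n - 1" using admissible_constant_upper_bound[OF assms(1)] by blast
    then show "C \<le> q ^ (n - 1)"
      unfolding m(1) pow[symmetric] using assms(1) by (intro power_int_increasing) auto
  qed
  then show ?thesis
    using assms by (simp add: log_linear_constant_def linear_constant_def log_nat_power)
qed

end
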